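(* Let $Y$ be a Markov chain that takes values in a measurable space $(\mathcal X,\mathcal F)$ and has a $\sigma$-finite recurrent invariant measure $\mu$ on $(\mathcal X,\mathcal F)$. Let $A\in\mathcal F$ be a set such that $\mathbb P_\mu(Y_0\in A^c,\ Y_1\in A)>0$. Then the measures $$\mu_A^{entr}:=\int_{A^c}\mathbb P_x(Y_1\in\cdot)\,\mu(dx)\ \text{ on }(A,\mathcal F_A)\qquad\text{and}\qquad \mu_{A^c}^{exit}(dx):=\mathbb P_x(Y_1\in A)\,\mu(dx)\ \text{ on }(A^c,\mathcal F_{A^c})$$ are proper, recurrent, and invariant for the entrance chain $Y^{\rangle A}$ and the exit chain $Y^{A^c\rangle}$, respectively. They are ergodic if $\mu$ is irreducible, and in this case $$\mu=\mathbb E_{\mu_A^{entr}}\Bigl[\sum_{k=0}^{T_1^{\rangle A}-1}\mathbf 1(Y_k\in\cdot)\Bigr].\qquad ( * )$$ Moreover, equality $( * )$ holds true (irreducible $\mu$ or not) when $$\mathbb P_{\mu_A}(\tau_{A^c}(Y)=\infty)=0\quad\text{and}\quad \mathbb P_{\mu_{A^c}}(\tau_A(Y)=\infty)=0 .$$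
   Context: Markov chains. All Markov chains are time-homogeneous. $Y=(Y_n)_{n\ge 0}$ has a probability transition kernel $P$ on $(\mathcal X,\mathcal F)$; $\mathbb P_x$ denotes the law under which $Y$ is a Markov chain with kernel $P$ and $\mathbb P_x(Y_0=x)=1$, with $x\mapsto \mathbb P_x(Y\in B)$ measurable. For $A\in\mathcal F$, $\mathcal F_A:=\{B\subset A: B\in\mathcal F\}$, and $\mu_A$ is the restriction of $\mu$ to $\mathcal F_A$. For a (possibly infinite) measure $\nu$ on $(A,\mathcal F_A)$, $\mathbb P_\nu:=\int_A\mathbb P_x(\cdot)\,\nu(dx)$, and $\mathbb E_\nu$ is the integral with respect to $\mathbb P_\nu$. A measure $\nu$ on $(A,\mathcal F_A)$ is invariant for a chain with kernel $K$ if $\int_A K(x,B)\,\nu(dx)=\nu(B)$ for every $B\in\mathcal F_A$. For $B\in\mathcal F$, $\tau_B(Y):=\inf\{n\ge 1: Y_n\in B\}$; $\inf\varnothing:=\infty$. Recurrence, irreducibility, ergodicity. Let $Z$ be a Markov chain on $(E,\mathcal E)$ with invariant measure $\nu$. $\nu$ is recurrent for $Z$ if for every $B\in\mathcal E$ with $\nu(B)<\infty$, the chain started at $x$ returns to $B$ at some time $n\ge1$ with probability one for $\nu$-a.e. $x\in B$. $\nu$ is irreducible for $Z$ if for every $B\in\mathcal E$, the equality $\mathbb P_x(Z_1\in B)=\mathbf 1_B(x)$ for $\nu$-a.e. $x$ implies $\nu(B)=0$ or $\nu(B^c)=0$. $\nu$ is ergodic for $Z$ if the one-sided shift on the sequence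 space of $E$, which preserves the law of $Z$ started under $\nu$, is ergodic (every set invariant under the shift modulo this law is null or has null complement). Entrance and exit chains. $T_0^{\rangle A}:=0$ and $T_n^{\rangle A}:=\inf\{k>T_{n-1}^{\rangle A}: Y_{k-1}\in A^c, Y_k\in A\}$ for $n\ge1$. Put $Y_n^{\rangle A}:=Y_{T_n^{\rangle A}}$, $Y_n^{A^c\rangle}:=Y_{T_n^{\rangle A}-1}$ for $n\ge1$, where $Y_\infty:=\dagger\notin\mathcal X$ is a cemetery state. The sequence $Y^{\rangle A}=(Y_n^{\rangle A})_{n\ge1}$ (entrance chain) is a Markov chain on $A\cup\{\dagger\}$ with kernel $P_A^{entr}(x,dy)=\mathbb P_x(Y_1^{\rangle A}\in dy)$, $x\in A$. The sequence $Y^{A^c\rangle}=(Y_n^{A^c\rangle})_{n\ge1}$ (exit chain) is a Markov chain on $A^c\cup\{\dagger\}$ with kernel $P_{A^c}^{exit}(x,dy)=\int_A\mathbb P_z(Y_1^{A^c\rangle}\in dy)\,\mathbb P_x(Y_1\in dz\mid Y_1\in A)$ for $x\in A^c_{ex}:=\{x\in A^c:\mathbb P_x(Y_1\in A)>0\}$, and $P_{A^c}^{exit}(x,\{\dagger\})=1$ for $x\in A^c\setminus A^c_{ex}$. Both chains are absorbed at $\dagger$. Let $N_A:=\{x\in\mathcal X:\mathbb P_x(Y_k\in A\text{ infinitely often and }Y_k\in A^c\text{ infinitely often})=1\}$. A measure $\nu$ on $(A,\mathcal F_A)$ is proper for $Y^{\rangle A}$ if $\nu(A\setminus N_A)=0$;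 a measure $\nu$ on $(A^c,\mathcal F_{A^c})$ is proper for $Y^{A^c\rangle}$ if $\nu(A^c\setminus(A^c_{ex}\cap N_A))=0$. Proper invariant measures are regarded as invariant measures of the chains on $A\cap N_A$ and $A^c_{ex}\cap N_A$ (i.e. with zero mass at $\dagger$). *)

theory Defs
  imports "HOL-Probability.Probability" "HOL-Library.Extended_Nat"
begin

text \<open>
  A chain is given by its state space \<open>X\<close> (only its \<open>\<sigma>\<close>-algebra matters) and its transition kernel
  \<open>K\<close>, so \<open>K x\<close> is the law \<open>\<bbbP>\<^sub>x(Y\<^sub>1 \<in> \<cdot>)\<close>. It is realised as the coordinate process on the
  sequence space of \<open>X\<close>.
\<close>

abbreviation path_space :: "'a measure \<Rightarrow> (nat \<Rightarrow> 'a) measure" where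
  "path_space X \<equiv> PiM UNIV (\<lambda>_. X)"

fun chain_step :: "'a measure \<Rightarrow> ('a \<Rightarrow> 'a measure) \<Rightarrow> 'a \<Rightarrow> nat \<Rightarrow> (nat \<Rightarrow> 'a) \<Rightarrow> 'a measure" where
  "chain_step X K x 0 \<omega> = return X x"
| "chain_step X K x (Suc n) \<omega> = K (\<omega> n)"

text \<open>The law \<open>\<bbbP>\<^sub>x\<close>, by the Ionescu-Tulcea theorem.\<close>

definition chain_law :: "'a measure \<Rightarrow> ('a \<Rightarrow> 'a measure) \<Rightarrow> 'a \<Rightarrow> (nat \<Rightarrow> 'a) measure" where
  "chain_law X K x =
    projective_family.lim UNIV (Ionescu_Tulcea.CI (chain_step X K x) (\<lambda>_. X)) (\<lambda>_. X)"

lemma Ionescu_Tulcea_chain_step: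
  assumes K: "K \<in> X \<rightarrow>\<^sub>M prob_algebra X" and x: "x \<in> space X"
  shows "Ionescu_Tulcea (chain_step X K x) (\<lambda>_. X)"
proof (rule Ionescu_Tulcea.intro)
  fix i :: nat
  show "chain_step X K x i \<in> measurable (PiM {0..<i} (\<lambda>_. X)) (subprob_algebra X)"
  proof (cases i)
    case 0
    have "return X x \<in> space (subprob_algebra X)"
      using x by (simp add: space_subprob_algebra prob_space_return prob_space_imp_subprob_space)
    moreover have "chain_step X K x i = (\<lambda>_. return X x)"
      using 0 by (auto simp: fun_eq_iff)
    ultimately show ?thesis by simp
  next
    case (Suc n)
    have "(\<lambda>\<omega>. \<omega> n) \<in> measurable (PiM {0..<i} (\<lambda>_. X)) X"
      using Suc by (intro measurable_component_singleton) auto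
    from measurable_compose[OF this measurable_prob_algebraD[OF K]]
    show ?thesis using Suc by (simp add: fun_eq_iff cong: measurable_cong)
  qed
next
  fix i :: nat and \<omega> assume \<omega>: "\<omega> \<in> space (PiM {0..<i} (\<lambda>_. X))"
  show "prob_space (chain_step X K x i \<omega>)"
  proof (cases i)
    case 0 then show ?thesis using x by (simp add: prob_space_return)
  next
    case (Suc n)
    then have "\<omega> n \<in> space X" using \<omega> by (auto simp: space_PiM PiE_iff)
    then show ?thesis
      using measurable_space[OF K] Suc by (simp add: space_prob_algebra)
  qed
qed

text \<open>
  \<open>\<bbbP>\<^sub>\<nu>\<close> for a possibly infinite measure \<open>\<nu>\<close>, which may live on a subspace of \<open>X\<close>: bind does not
  require the measure on its left to be finite, but it does require a nonempty space.
\<close>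

definition chain_law_init ::
    "'a measure \<Rightarrow> ('a \<Rightarrow> 'a measure) \<Rightarrow> 'a measure \<Rightarrow> (nat \<Rightarrow> 'a) measure" where
  "chain_law_init X K \<nu> = \<nu> \<bind> chain_law X K"


definition invariant_measure :: "'a measure \<Rightarrow> ('a \<Rightarrow> 'a measure) \<Rightarrow> 'a measure \<Rightarrow> bool" where
  "invariant_measure E K \<nu> \<longleftrightarrow> sets \<nu> = sets E \<and>
    (\<forall>B\<in>sets E. (\<integral>\<^sup>+x. emeasure (K x) B \<partial>\<nu>) = emeasure \<nu> B)"

definition recurrent_measure :: "'a measure \<Rightarrow> ('a \<Rightarrow> 'a measure) \<Rightarrow> 'a measure \<Rightarrow> bool" where
  "recurrent_measure E K \<nu> \<longleftrightarrow>
    (\<forall>B\<in>sets E. emeasure \<nu> B < \<infinity> \<longrightarrow>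
      (AE x in \<nu>. x \<in> B \<longrightarrow> (AE \<omega> in chain_law E K x. \<exists>n\<ge>1. \<omega> n \<in> B)))"

definition irreducible_measure :: "'a measure \<Rightarrow> ('a \<Rightarrow> 'a measure) \<Rightarrow> 'a measure \<Rightarrow> bool" where
  "irreducible_measure E K \<nu> \<longleftrightarrow>
    (\<forall>B\<in>sets E. (AE x in \<nu>. emeasure (K x) B = indicator B x) \<longrightarrow>
      emeasure \<nu> B = 0 \<or> emeasure \<nu> (space E - B) = 0)"

definition path_shift :: "(nat \<Rightarrow> 'a) \<Rightarrow> nat \<Rightarrow> 'a" where
  "path_shift \<omega> = (\<lambda>n. \<omega> (Suc n))"

text \<open>Ergodicity is used for invariant \<open>\<nu>\<close> only; then the shift preserves the law of the chain under \<open>\<nu>\<close>.\<close>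

definition ergodic_measure :: "'a measure \<Rightarrow> ('a \<Rightarrow> 'a measure) \<Rightarrow> 'a measure \<Rightarrow> bool" where
  "ergodic_measure E K \<nu> \<longleftrightarrow>
    (\<forall>S\<in>sets (path_space E).
      emeasure (chain_law_init E K \<nu>) (sym_diff (path_shift -` S \<inter> space (path_space E)) S) = 0 \<longrightarrow>
      emeasure (chain_law_init E K \<nu>) S = 0 \<or>
      emeasure (chain_law_init E K \<nu>) (space (path_space E) - S) = 0)"


definition hit_time :: "'a set \<Rightarrow> (nat \<Rightarrow> 'a) \<Rightarrow> enat" where
  "hit_time B \<omega> = Inf {enat n | n. 1 \<le> n \<and> \<omega> n \<in> B}"

text \<open>
  The times \<open>T\<^sub>n\<close> of entrance into \<open>A\<close>. The condition \<open>k > T\<^sub>n\<close> forces \<open>k \<ge> 1\<close>, so \<open>k - 1\<close> is not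
  truncated. On paths in \<open>X\<close>, not being in \<open>A\<close> is the same as being in \<open>A\<^sup>c = space X - A\<close>.
\<close>

primrec entr_time :: "'a set \<Rightarrow> nat \<Rightarrow> (nat \<Rightarrow> 'a) \<Rightarrow> enat" where
  "entr_time A 0 \<omega> = 0"
| "entr_time A (Suc n) \<omega> =
    Inf {enat k | k. enat k > entr_time A n \<omega> \<and> \<omega> (k - 1) \<notin> A \<and> \<omega> k \<in> A}"

text \<open>The cemetery state is \<open>None\<close>; note \<open>\<infinity> - 1 = \<infinity>\<close> in \<^typ>\<open>enat\<close>.\<close>

definition path_at :: "(nat \<Rightarrow> 'a) \<Rightarrow> enat \<Rightarrow> 'a option" where
  "path_at \<omega> t = (case t of enat k \<Rightarrow> Some (\<omega> k) | \<infinity> \<Rightarrow> None)"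

definition entr_chain :: "'a set \<Rightarrow> nat \<Rightarrow> (nat \<Rightarrow> 'a) \<Rightarrow> 'a option" where
  "entr_chain A n \<omega> = path_at \<omega> (entr_time A n \<omega>)"

definition exit_chain :: "'a set \<Rightarrow> nat \<Rightarrow> (nat \<Rightarrow> 'a) \<Rightarrow> 'a option" where
  "exit_chain A n \<omega> = path_at \<omega> (entr_time A n \<omega> - 1)"

definition cemetery_space :: "'a measure \<Rightarrow> 'a option measure" where
  "cemetery_space M =
    sigma (insert None (Some ` space M)) (insert {None} ((`) Some ` sets M))"

text \<open>A measure on \<open>A\<close> regarded as a measure on \<open>A \<union> {\<dagger>}\<close> without mass at \<open>\<dagger>\<close>.\<close>

definition with_cemetery :: "'a measure \<Rightarrow> 'a option measure" where
  "with_cemetery \<nu> = distr \<nu> (cemetery_space \<nu>) Some"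

definition entr_space :: "'a measure \<Rightarrow> 'a set \<Rightarrow> 'a option measure" where
  "entr_space X A = cemetery_space (restrict_space X A)"

definition exit_space :: "'a measure \<Rightarrow> 'a set \<Rightarrow> 'a option measure" where
  "exit_space X A = cemetery_space (restrict_space X (space X - A))"

definition entr_kernel ::
    "'a measure \<Rightarrow> ('a \<Rightarrow> 'a measure) \<Rightarrow> 'a set \<Rightarrow> 'a option \<Rightarrow> 'a option measure" where
  "entr_kernel X K A y = (case y of
      None \<Rightarrow> return (entr_space X A) None
    | Some x \<Rightarrow> distr (chain_law X K x) (entr_space X A) (entr_chain A 1))"

definition exit_set :: "'a measure \<Rightarrow> ('a \<Rightarrow> 'a measure) \<Rightarrow> 'a set \<Rightarrow> 'a set" where
  "exit_set X K A = {x \<in> space X - A. emeasure (K x) A > 0}"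

text \<open>\<open>uniform_measure (K x) A\<close> is the conditional law \<open>\<bbbP>\<^sub>x(Y\<^sub>1 \<in> \<cdot> | Y\<^sub>1 \<in> A)\<close>.\<close>

definition exit_kernel ::
    "'a measure \<Rightarrow> ('a \<Rightarrow> 'a measure) \<Rightarrow> 'a set \<Rightarrow> 'a option \<Rightarrow> 'a option measure" where
  "exit_kernel X K A y = (case y of
      None \<Rightarrow> return (exit_space X A) None
    | Some x \<Rightarrow>
        if x \<in> exit_set X K A
        then uniform_measure (K x) A \<bind>
          (\<lambda>z. distr (chain_law X K z) (exit_space X A) (exit_chain A 1))
        else return (exit_space X A) None)"

definition alternating_set :: "'a measure \<Rightarrow> ('a \<Rightarrow> 'a measure) \<Rightarrow> 'a set \<Rightarrow> 'a set" where
  "alternating_set X K A = {x \<in> space X.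
    emeasure (chain_law X K x)
      {\<omega> \<in> space (path_space X). (\<exists>\<^sub>\<infinity>k. \<omega> k \<in> A) \<and> (\<exists>\<^sub>\<infinity>k. \<omega> k \<in> space X - A)} = 1}"

definition proper_entr :: "'a measure \<Rightarrow> ('a \<Rightarrow> 'a measure) \<Rightarrow> 'a set \<Rightarrow> 'a measure \<Rightarrow> bool" where
  "proper_entr X K A \<nu> \<longleftrightarrow> emeasure \<nu> (A - alternating_set X K A) = 0"

definition proper_exit :: "'a measure \<Rightarrow> ('a \<Rightarrow> 'a measure) \<Rightarrow> 'a set \<Rightarrow> 'a measure \<Rightarrow> bool" where
  "proper_exit X K A \<nu> \<longleftrightarrow>
    emeasure \<nu> ((space X - A) - (exit_set X K A \<inter> alternating_set X K A)) = 0"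

text \<open>
  The entrance measure on \<open>A\<close> and the exit measure on \<open>A\<^sup>c\<close>. In the former, the bind is the measure
  \<open>B \<mapsto> \<integral>\<^bsub>A\<^sup>c\<^esub> K x B \<mu>(dx)\<close> on \<open>X\<close>.
\<close>

definition entr_measure ::
    "'a measure \<Rightarrow> ('a \<Rightarrow> 'a measure) \<Rightarrow> 'a set \<Rightarrow> 'a measure \<Rightarrow> 'a measure" where
  "entr_measure X K A \<mu> = restrict_space (restrict_space \<mu> (space X - A) \<bind> K) A"

definition exit_measure ::
    "'a measure \<Rightarrow> ('a \<Rightarrow> 'a measure) \<Rightarrow> 'a set \<Rightarrow> 'a measure \<Rightarrow> 'a measure" where
  "exit_measure X K A \<mu> = density (restrict_space \<mu> (space X - A)) (\<lambda>x. emeasure (K x) A)"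

definition occupation_before_entr ::
    "'a measure \<Rightarrow> ('a \<Rightarrow> 'a measure) \<Rightarrow> 'a set \<Rightarrow> 'a measure \<Rightarrow> 'a set \<Rightarrow> ennreal" where
  "occupation_before_entr X K A \<nu> B =
    (\<integral>\<^sup>+\<omega>. (\<Sum>k. if enat k < entr_time A 1 \<omega> then indicator B (\<omega> k) else 0)
      \<partial>chain_law_init X K \<nu>)"

end

theory Submission
  imports Defs
begin

text \<open>
  Realise the chain started from \<open>\<mu>\<close> as the path shift \<open>\<theta>\<close> on the infinite measure space
  \<open>(X\<^sup>\<nat>, \<bbbP>\<^sub>\<mu>)\<close>. Invariance of \<open>\<mu>\<close> makes \<open>\<theta>\<close> measure preserving and recurrence makes it
  conservative. Let \<open>C = {Y\<^sub>0 \<notin> A, Y\<^sub>1 \<in> A}\<close>. By the strong Markov property, the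
  entrance chain started from the entrance measure and the exit chain started from the exit measure are
  the images of \<open>\<bbbP>\<^sub>\<mu>\<close> restricted to \<open>C\<close> under the sequence of crossing positions, and \<open>\<theta>\<close> induces
  their shift. Hence recurrence is conservativity of \<open>\<theta>\<close>, ergodicity is inherited from \<open>\<theta>\<close>, and both invariance and the formula for
  \<open>\<mu>\<close> are cases of Kac's formula
  \<open>\<bbbP>\<^sub>\<mu>(S) = \<Sum>\<^sub>n \<bbbP>\<^sub>\<mu>(C \<inter> \<theta>\<^sup>-\<^sup>1(C\<^sup>c) \<inter> \<dots> \<inter> \<theta>\<^sup>-\<^sup>n(C\<^sup>c) \<inter> \<theta>\<^sup>-\<^sup>n\<^sup>-\<^sup>1(S))\<close>, valid for \<open>S\<close> almost all of whose
  points visit \<open>C\<close>. Properness and ergodicity of \<open>\<theta>\<close> use that a bounded harmonic function is almost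
  surely constant along the path of a recurrent chain.
\<close>

section \<open>Path space and the first-step decomposition\<close>

text \<open>Recurrence is assumed only for sets of states of finite measure, whereas the crossing
  argument needs returns to arbitrary path events, possibly of infinite measure. Potentials bridge
  the gap: a nonnegative function of the state whose expected sum along the path is at most 1 must
  vanish almost everywhere. Applied to the probability of being in an event now and never again,
  this gives conservativity; applied to the one-step variance of a harmonic function, it gives
  constancy along the path. The shift is not invertible, so the last visit to \<open>C\<close>
  before \<open>E\<close> cannot be read off a point of \<open>E\<close>. Kac's formula is therefore
  written forwards, with excursions that start in \<open>C\<close>, and its remainder consists of
  paths that avoid \<open>C\<close> before reaching \<open>E\<close>. The hypothesis, however,
  speaks of visits to \<open>C\<close> after \<open>E\<close>. Conservativity converts one into the
  other: a path that avoids \<open>C\<close> for long before \<open>E\<close> and then meets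
  \<open>C\<close> has avoided a finite-measure piece of \<open>C\<close> for long before meeting
  it, and such paths have vanishing measure.\<close>

definition cylinder :: "'a measure \<Rightarrow> nat \<Rightarrow> (nat \<Rightarrow> 'a set) \<Rightarrow> (nat \<Rightarrow> 'a) set" where
  "cylinder X n B = {\<omega> \<in> space (path_space X). \<forall>i<n. \<omega> i \<in> B i}"

lemma cylinder_sets [measurable]:
  assumes "\<And>i. B i \<in> sets X"
  shows "cylinder X n B \<in> sets (path_space X)"
proof -
  note assms[measurable]
  show ?thesis unfolding cylinder_def by measurable
qed

lemma Int_stable_cylinders: "Int_stable {cylinder X n B | n B. \<forall>i. B i \<in> sets X}"
proof (rule Int_stableI)
  fix C D assume "C \<in> {cylinder X n B | n B. \<forall>i. B i \<in> sets X}"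
    and "D \<in> {cylinder X n B | n B. \<forall>i. B i \<in> sets X}"
  then obtain n B m B' where *: "C = cylinder X n B" "\<forall>i. B i \<in> sets X"
    "D = cylinder X m B'" "\<forall>i. B' i \<in> sets X" by auto
  define D' where "D' i = (if i < n then B i else space X) \<inter> (if i < m then B' i else space X)" for i
  have "C \<inter> D = cylinder X (max n m) D'"
    by (auto simp: * cylinder_def D'_def space_PiM)
  moreover have "\<forall>i. D' i \<in> sets X" using * by (auto simp: D'_def)
  ultimately show "C \<inter> D \<in> {cylinder X n B | n B. \<forall>i. B i \<in> sets X}" by blast
qed

lemma sets_path_space_cylinders:
  "sets (path_space X) = sigma_sets (space (path_space X)) {cylinder X n B | n B. \<forall>i. B i \<in> sets X}"
proof (rule antisym)
  show "sigma_sets (space (path_space X)) {cylinder X n B | n B. \<forall>i. B i \<in> sets X} \<subseteq> sets (path_space X)"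
    by (intro sets.sigma_sets_subset) auto
  have "{{\<omega> \<in> space (path_space X). \<omega> i \<in> C} | i C. i \<in> UNIV \<and> C \<in> sets X}
    \<subseteq> {cylinder X n B | n B. \<forall>i. B i \<in> sets X}"
  proof safe
    fix i C assume C: "C \<in> sets X"
    have "{\<omega> \<in> space (path_space X). \<omega> i \<in> C} = cylinder X (Suc i) ((\<lambda>_. space X)(i := C))"
      by (auto simp: cylinder_def space_PiM)
    then show "\<exists>n B. {\<omega> \<in> space (path_space X). \<omega> i \<in> C} = cylinder X n B \<and> (\<forall>i. B i \<in> sets X)"
      using C by (intro exI[of _ "Suc i"] exI[of _ "(\<lambda>_. space X)(i := C)"]) auto
  qed
  then show "sets (path_space X) \<subseteq> sigma_sets (space (path_space X)) {cylinder X n B | n B. \<forall>i. B i \<in> sets X}"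
    unfolding sets_PiM_single space_PiM[symmetric] by (rule sigma_sets_mono')
qed

text \<open>The cylinder with \<open>n = 0\<close> is the whole space, so agreement on cylinders
  includes equality of total masses, and finiteness has to be known for one of the two measures
  only.\<close>

lemma path_measure_eqI:
  assumes sets: "sets M = sets (path_space X)" "sets N = sets (path_space X)"
    and "finite_measure M"
    and eq: "\<And>n B. (\<And>i. B i \<in> sets X) \<Longrightarrow> emeasure M (cylinder X n B) = emeasure N (cylinder X n B)"
  shows "M = N"
proof (rule measure_eqI_generator_eq[OF Int_stable_cylinders, where A="\<lambda>_. space (path_space X)"])
  show "{cylinder X n B | n B. \<forall>i. B i \<in> sets X} \<subseteq> Pow (space (path_space X))"
    by (auto simp: cylinder_def)
  show "sets M = sigma_sets (space (path_space X)) {cylinder X n B | n B. \<forall>i. B i \<in> sets X}"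
    "sets N = sigma_sets (space (path_space X)) {cylinder X n B | n B. \<forall>i. B i \<in> sets X}"
    using sets sets_path_space_cylinders by auto
  have "space (path_space X) = cylinder X 0 (\<lambda>_. space X)"
    by (auto simp: cylinder_def)
  then show "range (\<lambda>_. space (path_space X)) \<subseteq> {cylinder X n B | n B. \<forall>i. B i \<in> sets X}"
    by (auto intro!: exI[of _ 0] exI[of _ "\<lambda>_. space X"])
  show "emeasure M (space (path_space X)) \<noteq> \<infinity>"
    using finite_measure.emeasure_finite[OF assms(3)] by auto
qed (use eq in auto)

lemma measurable_path_shift [measurable]: "path_shift \<in> path_space X \<rightarrow>\<^sub>M path_space X"
  unfolding path_shift_def by (intro measurable_PiM_single') (auto simp: space_PiM)

lemma measurable_path_shift_funpow [measurable]:
  "(path_shift ^^ n) \<in> path_space X \<rightarrow>\<^sub>M path_space X"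
  by (induction n) (auto intro: measurable_comp)

lemma path_shift_funpow: "(path_shift ^^ n) \<omega> = (\<lambda>k. \<omega> (n + k))"
  by (induction n arbitrary: \<omega>) (auto simp: path_shift_def)

lemma path_shift_case_nat [simp]: "path_shift (case_nat x \<omega>) = \<omega>"
  by (simp add: path_shift_def)

section \<open>The path law: finite-dimensional integrals and the first-step formula\<close>

locale markov_kernel =
  fixes X :: "'a measure" and K :: "'a \<Rightarrow> 'a measure"
  assumes kernel: "K \<in> X \<rightarrow>\<^sub>M prob_algebra X"
begin

abbreviation "\<Omega> \<equiv> path_space X"
abbreviation "P \<equiv> chain_law X K"

lemma measurable_kernel [measurable]: "K \<in> X \<rightarrow>\<^sub>M subprob_algebra X"
  using kernel by (rule measurable_prob_algebraD)

lemma prob_space_kernel: "x \<in> space X \<Longrightarrow> prob_space (K x)"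
  and sets_kernel': "x \<in> space X \<Longrightarrow> sets (K x) = sets X"
  using measurable_space[OF kernel] by (auto simp: space_prob_algebra)

lemma space_kernel: "x \<in> space X \<Longrightarrow> space (K x) = space X"
  using sets_kernel' by (rule sets_eq_imp_space_eq)

lemma prob_space_chain_law: "x \<in> space X \<Longrightarrow> prob_space (P x)"
  and sets_chain_law: "x \<in> space X \<Longrightarrow> sets (P x) = sets \<Omega>"
proof -
  assume x: "x \<in> space X"
  interpret IT: Ionescu_Tulcea "chain_step X K x" "\<lambda>_. X"
    by (rule Ionescu_Tulcea_chain_step[OF kernel x])
  show "sets (P x) = sets \<Omega>" unfolding chain_law_def by (rule IT.PF.sets_lim)
  have sp: "space (P x) = space \<Omega>" by (rule sets_eq_imp_space_eq) fact
  have *: "prod_emb UNIV (\<lambda>_. X) {} (space (PiM {} (\<lambda>_. X))) = space \<Omega>"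
    by (auto simp: prod_emb_def space_PiM)
  show "prob_space (P x)"
  proof
    have "emeasure (P x) (space \<Omega>) = emeasure (IT.CI {}) (space (PiM {} (\<lambda>_. X)))"
      unfolding chain_law_def *[symmetric] by (rule IT.lim) auto
    also have "\<dots> = 1"
      using prob_space.emeasure_space_1[OF IT.PF.prob_space_P[of "{}"]]
      by (simp add: IT.PF.space_P)
    finally show "emeasure (P x) (space (P x)) = 1" using sp by simp
  qed
qed

lemma space_chain_law: "x \<in> space X \<Longrightarrow> space (P x) = space \<Omega>"
  using sets_chain_law by (rule sets_eq_imp_space_eq)

text \<open>Bridge from the projective limit to the iterated kernels \<open>C 0 n\<close>. They
  start at the function that is \<open>undefined\<close> everywhere, the only point of the product
  over no coordinates.\<close>

lemma nn_integral_chain_law_restrict: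
  assumes x: "x \<in> space X" and F[measurable]: "F \<in> borel_measurable (PiM {0..<n} (\<lambda>_. X))"
  shows "(\<integral>\<^sup>+\<omega>. F (restrict \<omega> {0..<n}) \<partial>P x) =
    (\<integral>\<^sup>+\<omega>. F \<omega> \<partial>Ionescu_Tulcea.C (chain_step X K x) (\<lambda>_. X) 0 n (\<lambda>_. undefined))"
proof -
  interpret IT: Ionescu_Tulcea "chain_step X K x" "\<lambda>_. X"
    by (rule Ionescu_Tulcea_chain_step[OF kernel x])
  \<comment> \<open>\<open>CI\<close> runs \<open>C\<close> up to \<open>up_to\<close> of the index
    set and then projects. On an initial segment this bound is the length itself, so the projection
    is the identity.\<close>
  have up: "IT.up_to {0..<n} = n"
    using IT.up_to_iff_Ico[of "{0..<n}" n] IT.up_to[of "{0..<n}"] by (auto intro: antisym)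
  have [measurable]: "(\<lambda>\<omega>. restrict \<omega> {0..<n}) \<in> \<Omega> \<rightarrow>\<^sub>M PiM {0..<n} (\<lambda>_. X)"
    by (rule measurable_restrict_subset) auto
  have m: "(\<lambda>\<omega>. restrict \<omega> {0..<n}) \<in> P x \<rightarrow>\<^sub>M PiM {0..<n} (\<lambda>_. X)"
    using sets_chain_law[OF x] by (simp cong: measurable_cong_sets)
  have "(\<integral>\<^sup>+\<omega>. F (restrict \<omega> {0..<n}) \<partial>P x) =
      (\<integral>\<^sup>+\<omega>. F \<omega> \<partial>distr (P x) (PiM {0..<n} (\<lambda>_. X)) (\<lambda>\<omega>. restrict \<omega> {0..<n}))"
    by (subst nn_integral_distr[OF m]) auto
  also have "distr (P x) (PiM {0..<n} (\<lambda>_. X)) (\<lambda>\<omega>. restrict \<omega> {0..<n}) = IT.CI {0..<n}"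
    unfolding chain_law_def by (rule IT.distr_lim) simp
  also have "\<dots> = IT.C 0 n (\<lambda>_. undefined)"
    unfolding IT.CI_def up
    by (subst IT.distr_C[of n n "\<lambda>_. undefined" 0, simplified, symmetric]) auto
  finally show ?thesis .
qed

lemma nn_integral_chain_law_0:
  assumes x: "x \<in> space X" and h[measurable]: "h \<in> borel_measurable X"
  shows "(\<integral>\<^sup>+\<omega>. h (\<omega> 0) \<partial>P x) = h x"
proof -
  interpret IT: Ionescu_Tulcea "chain_step X K x" "\<lambda>_. X"
    by (rule Ionescu_Tulcea_chain_step[OF kernel x])
  have "(\<integral>\<^sup>+\<omega>. h (\<omega> 0) \<partial>P x) = (\<integral>\<^sup>+\<omega>. h (restrict \<omega> {0..<1} 0) \<partial>P x)" by simp
  also have "\<dots> = (\<integral>\<^sup>+\<omega>. h (\<omega> 0) \<partial>IT.C 0 1 (\<lambda>_. undefined))"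
    by (rule nn_integral_chain_law_restrict[OF x]) simp
  also have "IT.C 0 1 (\<lambda>_. undefined) = IT.eP 0 (\<lambda>_. undefined)"
    using bind_return[OF IT.measurable_eP[of 0], of "\<lambda>_. undefined"] by (simp add: space_PiM)
  also have "(\<integral>\<^sup>+\<omega>. h (\<omega> 0) \<partial>IT.eP 0 (\<lambda>_. undefined)) = h x"
    using x by (subst IT.nn_integral_eP) (auto simp: nn_integral_return space_PiM)
  finally show ?thesis .
qed

lemma measurable_kernel_integral [measurable]:
  assumes [measurable]: "h \<in> borel_measurable X"
  shows "(\<lambda>y. \<integral>\<^sup>+z. h z \<partial>K y) \<in> borel_measurable X"
  by (rule nn_integral_measurable_subprob_algebra2[OF _ measurable_kernel]) measurable

text \<open>The Ionescu-Tulcea construction extends a path at its end, so the last coordinate is the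
  one that can be integrated out directly. The decomposition at the first step has to be derived
  from this.\<close>

lemma nn_integral_chain_law_last_step:
  assumes x: "x \<in> space X" and h[measurable]: "h \<in> borel_measurable X"
    and B[measurable]: "\<And>i. B i \<in> sets X"
  shows "(\<integral>\<^sup>+\<omega>. (\<Prod>i<Suc n. indicator (B i) (\<omega> i)) * h (\<omega> (Suc n)) \<partial>P x) =
    (\<integral>\<^sup>+\<omega>. (\<Prod>i<n. indicator (B i) (\<omega> i)) * (indicator (B n) (\<omega> n) * (\<integral>\<^sup>+y. h y \<partial>K (\<omega> n))) \<partial>P x)"
    (is "?L = ?R")
proof -
  interpret IT: Ionescu_Tulcea "chain_step X K x" "\<lambda>_. X"
    by (rule Ionescu_Tulcea_chain_step[OF kernel x])

  let ?F = "\<lambda>\<omega>. (\<Prod>i<Suc n. indicator (B i) (\<omega> i)) * h (\<omega> (Suc n))"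
  let ?G = "\<lambda>\<omega>. (\<Prod>i<n. indicator (B i) (\<omega> i)) * (indicator (B n) (\<omega> n) * (\<integral>\<^sup>+y. h y \<partial>K (\<omega> n)))"
  have F[measurable]: "?F \<in> borel_measurable (PiM {0..<Suc (Suc n)} (\<lambda>_. X))"
    by (intro borel_measurable_times_ennreal borel_measurable_prod_ennreal
      borel_measurable_indicator' measurable_compose[OF _ h] B) auto
  have F': "?F \<in> borel_measurable (PiM {0..<0 + Suc (Suc n)} (\<lambda>_. X))" using F by simp
  have G[measurable]: "?G \<in> borel_measurable (PiM {0..<Suc n} (\<lambda>_. X))"
    by (intro borel_measurable_times_ennreal borel_measurable_prod_ennreal
      borel_measurable_indicator' B measurable_compose[OF _ measurable_kernel_integral[OF h]]) auto
  have "?L = (\<integral>\<^sup>+\<omega>. ?F (restrict \<omega> {0..<Suc (Suc n)}) \<partial>P x)"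
    by (intro nn_integral_cong) (auto intro!: arg_cong2[where f="(*)"] prod.cong)
  also have "\<dots> = (\<integral>\<^sup>+\<omega>. ?F \<omega> \<partial>IT.C 0 (Suc (Suc n)) (\<lambda>_. undefined))"
    by (rule nn_integral_chain_law_restrict[OF x F])
  also have "\<dots> = (\<integral>\<^sup>+\<omega>. (\<integral>\<^sup>+\<omega>'. ?F \<omega>' \<partial>IT.eP (Suc n) \<omega>) \<partial>IT.C 0 (Suc n) (\<lambda>_. undefined))"
  proof -
    have "IT.eP (Suc n) \<in> IT.C 0 (Suc n) (\<lambda>_. undefined) \<rightarrow>\<^sub>M subprob_algebra (PiM {0..<Suc (Suc n)} (\<lambda>_. X))"
      using IT.measurable_eP[of "Suc n"] IT.sets_C[of "\<lambda>_. undefined" 0 "Suc n"]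
      by (simp add: space_PiM cong: measurable_cong_sets del: IT.C.simps)
    from nn_integral_bind[OF F this] show ?thesis by (simp del: prod.lessThan_Suc)
  qed
  also have "\<dots> = (\<integral>\<^sup>+\<omega>. ?G \<omega> \<partial>IT.C 0 (Suc n) (\<lambda>_. undefined))"
  proof (intro nn_integral_cong)
    fix \<omega> assume "\<omega> \<in> space (IT.C 0 (Suc n) (\<lambda>_. undefined))"
    then have \<omega>: "\<omega> \<in> space (PiM {0..<Suc n} (\<lambda>_. X))"
      using IT.space_C[of "\<lambda>_. undefined" 0 "Suc n"] by (simp add: space_PiM del: IT.C.simps)
    then have \<omega>n: "\<omega> n \<in> space X" by (auto simp: space_PiM PiE_iff)
    have "(\<integral>\<^sup>+\<omega>'. ?F \<omega>' \<partial>IT.eP (Suc n) \<omega>) = (\<integral>\<^sup>+y. ?F (fun_upd \<omega> (Suc n) y) \<partial>K (\<omega> n))"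
      using IT.nn_integral_eP[OF \<omega> F] by simp
    also have "\<dots> = (\<integral>\<^sup>+y. (\<Prod>i<Suc n. indicator (B i) (\<omega> i)) * h y \<partial>K (\<omega> n))"
      by (intro nn_integral_cong) (auto intro!: arg_cong2[where f="(*)"] prod.cong)
    also have "\<dots> = (\<Prod>i<Suc n. indicator (B i) (\<omega> i)) * (\<integral>\<^sup>+y. h y \<partial>K (\<omega> n))"
      by (rule nn_integral_cmult) (simp add: sets_kernel'[OF \<omega>n] cong: measurable_cong_sets)
    finally show "(\<integral>\<^sup>+\<omega>'. ?F \<omega>' \<partial>IT.eP (Suc n) \<omega>) = ?G \<omega>" by (simp add: ac_simps)
  qed
  also have "\<dots> = (\<integral>\<^sup>+\<omega>. ?G (restrict \<omega> {0..<Suc n}) \<partial>P x)"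
    by (rule nn_integral_chain_law_restrict[OF x G, symmetric])
  also have "\<dots> = ?R"
    by (intro nn_integral_cong) (auto intro!: arg_cong2[where f="(*)"] prod.cong)
  finally show ?thesis .
qed

text \<open>The iterated integral that computes the expectation under \<open>P x\<close> of
  \<open>h (\<omega> n)\<close> on the event that \<open>\<omega> i \<in> B i\<close> for all
  \<open>i < n\<close>. The recursion absorbs the last factor into \<open>h\<close>, in step with
  \<open>nn_integral_chain_law_last_step\<close>.\<close>

primrec cyl_int :: "nat \<Rightarrow> (nat \<Rightarrow> 'a set) \<Rightarrow> ('a \<Rightarrow> ennreal) \<Rightarrow> 'a \<Rightarrow> ennreal" where
  "cyl_int 0 B h x = h x"
| "cyl_int (Suc n) B h x = cyl_int n B (\<lambda>y. indicator (B n) y * (\<integral>\<^sup>+z. h z \<partial>K y)) x"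

lemma cyl_int_0: "cyl_int 0 B h = h"
  by auto

lemma measurable_cyl_int [measurable]:
  assumes "h \<in> borel_measurable X" "\<And>i. B i \<in> sets X"
  shows "cyl_int n B h \<in> borel_measurable X"
  using assms(1)
proof (induction n arbitrary: h)
  case (Suc n)
  note [measurable] = Suc.prems assms(2)
  have "cyl_int n B (\<lambda>y. indicator (B n) y * (\<integral>\<^sup>+z. h z \<partial>K y)) \<in> borel_measurable X"
    by (rule Suc.IH) measurable
  also have "cyl_int n B (\<lambda>y. indicator (B n) y * (\<integral>\<^sup>+z. h z \<partial>K y)) = cyl_int (Suc n) B h"
    by auto
  finally show ?case .
qed (simp add: cong: measurable_cong)

lemma nn_integral_chain_law_cyl:
  assumes x: "x \<in> space X" and h: "h \<in> borel_measurable X" and B: "\<And>i. B i \<in> sets X"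
  shows "(\<integral>\<^sup>+\<omega>. (\<Prod>i<n. indicator (B i) (\<omega> i)) * h (\<omega> n) \<partial>P x) = cyl_int n B h x"
  using h
proof (induction n arbitrary: h)
  case 0
  then show ?case using nn_integral_chain_law_0[OF x] by simp
next
  case (Suc n)
  note [measurable] = Suc.prems B
  have "(\<integral>\<^sup>+\<omega>. (\<Prod>i<n. indicator (B i) (\<omega> i)) * (indicator (B n) (\<omega> n) * (\<integral>\<^sup>+y. h y \<partial>K (\<omega> n))) \<partial>P x)
      = cyl_int n B (\<lambda>y. indicator (B n) y * (\<integral>\<^sup>+z. h z \<partial>K y)) x"
    by (rule Suc.IH) measurable
  then show ?case
    using nn_integral_chain_law_last_step[OF x Suc.prems, where n=n and B=B] B by simp
qed

text \<open>Turns the recursion at the end into a recursion at the beginning. The induction works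
  because \<open>h\<close> is arbitrary: the last factor is hidden in it while the first one is
  split off.\<close>

lemma cyl_int_first_step:
  assumes h: "h \<in> borel_measurable X" and B: "\<And>i. B i \<in> sets X" and x: "x \<in> space X"
  shows "cyl_int (Suc n) B h x =
    indicator (B 0) x * (\<integral>\<^sup>+y. cyl_int n (\<lambda>i. B (Suc i)) h y \<partial>K x)"
  using h
proof (induction n arbitrary: h)
  case (Suc n)
  note [measurable] = Suc.prems B
  have "cyl_int (Suc n) B (\<lambda>y. indicator (B (Suc n)) y * (\<integral>\<^sup>+z. h z \<partial>K y)) x =
    indicator (B 0) x * (\<integral>\<^sup>+y. cyl_int n (\<lambda>i. B (Suc i)) (\<lambda>y. indicator (B (Suc n)) y * (\<integral>\<^sup>+z. h z \<partial>K y)) y \<partial>K x)"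
    by (rule Suc.IH) measurable
  then show ?case by simp
qed (simp add: cyl_int_0)

lemma emeasure_cylinder:
  assumes x: "x \<in> space X" and B: "\<And>i. B i \<in> sets X"
  shows "emeasure (P x) (cylinder X n B) = cyl_int n B (\<lambda>_. 1) x"
proof -
  have "emeasure (P x) (cylinder X n B) = (\<integral>\<^sup>+\<omega>. indicator (cylinder X n B) \<omega> \<partial>P x)"
    using B by (simp add: sets_chain_law[OF x])
  also have "\<dots> = (\<integral>\<^sup>+\<omega>. (\<Prod>i<n. indicator (B i) (\<omega> i)) * 1 \<partial>P x)"
    by (intro nn_integral_cong)
      (auto simp: space_chain_law[OF x] cylinder_def indicator_def intro!: prod.neutral[symmetric])
  finally show ?thesis
    using nn_integral_chain_law_cyl[OF x _ B, where h="\<lambda>_. 1" and n=n] by simp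
qed

lemma chain_law_measurable: "P \<in> X \<rightarrow>\<^sub>M prob_algebra \<Omega>"
proof (rule measurable_prob_algebra_generated[OF sets_path_space_cylinders Int_stable_cylinders])
  show "{cylinder X n B | n B. \<forall>i. B i \<in> sets X} \<subseteq> Pow (space \<Omega>)"
    by (auto simp: cylinder_def)
  fix C assume "C \<in> {cylinder X n B | n B. \<forall>i. B i \<in> sets X}"
  then obtain n B where "C = cylinder X n B" "\<And>i. B i \<in> sets X" by auto
  then show "(\<lambda>a. emeasure (P a) C) \<in> borel_measurable X"
    by (simp add: emeasure_cylinder cong: measurable_cong)
qed (use prob_space_chain_law sets_chain_law in auto)

lemma measurable_chain_law [measurable]: "P \<in> X \<rightarrow>\<^sub>M subprob_algebra \<Omega>"
  using chain_law_measurable by (rule measurable_prob_algebraD)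

lemma cylinder_Suc_case_nat:
  assumes "x \<in> space X"
  shows "{\<omega> \<in> space \<Omega>. case_nat x \<omega> \<in> cylinder X (Suc n) B} =
    (if x \<in> B 0 then cylinder X n (\<lambda>i. B (Suc i)) else {})"
  using assms by (auto simp: cylinder_def space_PiM less_Suc_eq_0_disj PiE_iff split: nat.split)

text \<open>The first-step equation determines the probabilities of cylinders by induction on their
  length, for all starting points at once. This is how the embedded chains, whose laws are built by
  hand from paths of the original chain, are later recognised as chains of their kernels.\<close>

lemma chain_law_unique:
  assumes Q: "\<And>x. x \<in> space X \<Longrightarrow> prob_space (Q x)" "\<And>x. x \<in> space X \<Longrightarrow> sets (Q x) = sets \<Omega>"
    and step: "\<And>x B. x \<in> space X \<Longrightarrow> B \<in> sets \<Omega> \<Longrightarrow>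
      emeasure (Q x) B = (\<integral>\<^sup>+y. emeasure (Q y) {\<omega> \<in> space \<Omega>. case_nat x \<omega> \<in> B} \<partial>K x)"
    and x: "x \<in> space X"
  shows "Q x = P x"
proof (rule path_measure_eqI[where X=X])
  show "finite_measure (Q x)" using Q(1)[OF x] by (simp add: prob_space_def)
  fix n and B :: "nat \<Rightarrow> 'a set" assume B: "\<And>i. B i \<in> sets X"
  have "emeasure (Q x) (cylinder X n B) = cyl_int n B (\<lambda>_. 1) x"
    using x B
  proof (induction n arbitrary: x B)
    case 0
    have "cylinder X 0 B = space (Q x)"
      using sets_eq_imp_space_eq[OF Q(2)[OF 0(1)]] by (auto simp: cylinder_def)
    then show ?case using prob_space.emeasure_space_1[OF Q(1)[OF 0(1)]] by simp
  next
    case (Suc n)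
    have "emeasure (Q x) (cylinder X (Suc n) B) =
        (\<integral>\<^sup>+y. indicator (B 0) x * cyl_int n (\<lambda>i. B (Suc i)) (\<lambda>_. 1) y \<partial>K x)"
      using Suc.prems
      by (subst step) (auto intro!: nn_integral_cong simp: cylinder_Suc_case_nat Suc.IH space_kernel)
    also have "\<dots> = indicator (B 0) x * (\<integral>\<^sup>+y. cyl_int n (\<lambda>i. B (Suc i)) (\<lambda>_. 1) y \<partial>K x)"
    proof (rule nn_integral_cmult)
      have "cyl_int n (\<lambda>i. B (Suc i)) (\<lambda>_. 1) \<in> borel_measurable X"
        using Suc.prems by auto
      then show "cyl_int n (\<lambda>i. B (Suc i)) (\<lambda>_. 1) \<in> borel_measurable (K x)"
        using sets_kernel'[OF Suc.prems(1)] by (simp cong: measurable_cong_sets)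
    qed
    finally show ?case using cyl_int_first_step[of "\<lambda>_. 1" B x n] Suc.prems by simp
  qed
  then show "emeasure (Q x) (cylinder X n B) = emeasure (P x) (cylinder X n B)"
    using emeasure_cylinder[OF x B] by simp
qed (use Q(2)[OF x] sets_chain_law[OF x] in auto)

lemma measurable_path_integral [measurable]:
  assumes "(\<lambda>(x, \<omega>). F x \<omega>) \<in> borel_measurable (X \<Otimes>\<^sub>M \<Omega>)"
  shows "(\<lambda>x. \<integral>\<^sup>+\<omega>. F x \<omega> \<partial>P x) \<in> borel_measurable X"
  by (rule nn_integral_measurable_subprob_algebra2[OF assms measurable_chain_law])

text \<open>The Markov property at time 1. Both laws agree on cylinders:
  \<open>cyl_int_first_step\<close> splits off the first factor on one side, and prefixing the fixed
  state \<open>x\<close> produces the same factor on the other.\<close>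

lemma chain_law_first_step:
  assumes x: "x \<in> space X" and F[measurable]: "F \<in> borel_measurable \<Omega>"
  shows "(\<integral>\<^sup>+\<omega>. F \<omega> \<partial>P x) = (\<integral>\<^sup>+y. \<integral>\<^sup>+\<omega>. F (case_nat x \<omega>) \<partial>P y \<partial>K x)"
proof -
  have D[measurable]: "(\<lambda>y. distr (P y) \<Omega> (case_nat x)) \<in> X \<rightarrow>\<^sub>M prob_algebra \<Omega>"
    using x by (intro measurable_compose[OF chain_law_measurable] measurable_distr_prob_space) auto
  have D'[measurable]: "(\<lambda>y. distr (P y) \<Omega> (case_nat x)) \<in> K x \<rightarrow>\<^sub>M subprob_algebra \<Omega>"
    using measurable_prob_algebraD[OF D] sets_kernel'[OF x] by (simp cong: measurable_cong_sets)
  have Kx: "K x \<in> space (prob_algebra X)"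
    using measurable_space[OF kernel x] .
  have ne: "space (K x) \<noteq> {}" using prob_space.not_empty[OF prob_space_kernel[OF x]] .
  have "P x = K x \<bind> (\<lambda>y. distr (P y) \<Omega> (case_nat x))"
  proof (rule path_measure_eqI[where X=X])
    show "finite_measure (P x)" using prob_space_chain_law[OF x] by (simp add: prob_space_def)
    show "sets (P x) = sets \<Omega>" by (rule sets_chain_law[OF x])
    show "sets (K x \<bind> (\<lambda>y. distr (P y) \<Omega> (case_nat x))) = sets \<Omega>"
      by (rule sets_bind[OF _ ne]) simp
    fix n and B :: "nat \<Rightarrow> 'a set" assume B: "\<And>i. B i \<in> sets X"
    show "emeasure (P x) (cylinder X n B) =
      emeasure (K x \<bind> (\<lambda>y. distr (P y) \<Omega> (case_nat x))) (cylinder X n B)"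
    proof (cases n)
      case 0
      have "cylinder X 0 B = space \<Omega>" by (auto simp: cylinder_def)
      moreover have "prob_space (K x \<bind> (\<lambda>y. distr (P y) \<Omega> (case_nat x)))"
        by (rule prob_space_bind'[OF Kx D])
      moreover have "space (K x \<bind> (\<lambda>y. distr (P y) \<Omega> (case_nat x))) = space \<Omega>"
        by (rule space_bind[OF _ ne]) simp
      ultimately show ?thesis
        using 0 prob_space.emeasure_space_1[OF prob_space_chain_law[OF x]] space_chain_law[OF x]
          prob_space.emeasure_space_1 by metis
    next
      case (Suc m)
      have meas: "cyl_int m (\<lambda>i. B (Suc i)) (\<lambda>_. 1) \<in> borel_measurable (K x)"
        using sets_kernel'[OF x] B by (simp cong: measurable_cong_sets)
      have vim: "case_nat x -` cylinder X (Suc m) B \<inter> space (P y) =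
          (if x \<in> B 0 then cylinder X m (\<lambda>i. B (Suc i)) else {})" if "y \<in> space X" for y
        using cylinder_Suc_case_nat[OF x, of m B] space_chain_law[OF that] by (auto simp: Collect_conj_eq)
      have "emeasure (K x \<bind> (\<lambda>y. distr (P y) \<Omega> (case_nat x))) (cylinder X n B) =
          (\<integral>\<^sup>+y. emeasure (distr (P y) \<Omega> (case_nat x)) (cylinder X n B) \<partial>K x)"
        using B by (intro emeasure_bind[OF ne D']) auto
      also have "\<dots> = (\<integral>\<^sup>+y. indicator (B 0) x * cyl_int m (\<lambda>i. B (Suc i)) (\<lambda>_. 1) y \<partial>K x)"
      proof (intro nn_integral_cong)
        fix y assume "y \<in> space (K x)"
        then have y: "y \<in> space X" by (simp add: space_kernel[OF x])
        have "case_nat x \<in> P y \<rightarrow>\<^sub>M \<Omega>"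
          using x sets_chain_law[OF y] by (simp cong: measurable_cong_sets)
        then show "emeasure (distr (P y) \<Omega> (case_nat x)) (cylinder X n B) =
            indicator (B 0) x * cyl_int m (\<lambda>i. B (Suc i)) (\<lambda>_. 1) y"
          using B y by (simp add: emeasure_distr Suc vim emeasure_cylinder)
      qed
      also have "\<dots> = emeasure (P x) (cylinder X n B)"
        using emeasure_cylinder[OF x, where n=n and B=B] cyl_int_first_step[of "\<lambda>_. 1" B x m] B x meas
        by (simp add: nn_integral_cmult Suc)
      finally show ?thesis by simp
    qed
  qed
  then have "(\<integral>\<^sup>+\<omega>. F \<omega> \<partial>P x) = (\<integral>\<^sup>+\<omega>. F \<omega> \<partial>(K x \<bind> (\<lambda>y. distr (P y) \<Omega> (case_nat x))))"
    by simp
  also have "\<dots> = (\<integral>\<^sup>+y. \<integral>\<^sup>+\<omega>. F \<omega> \<partial>distr (P y) \<Omega> (case_nat x) \<partial>K x)"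
    by (rule nn_integral_bind[OF F D'])
  also have "\<dots> = (\<integral>\<^sup>+y. \<integral>\<^sup>+\<omega>. F (case_nat x \<omega>) \<partial>P y \<partial>K x)"
  proof (intro nn_integral_cong)
    fix y assume "y \<in> space (K x)"
    then have y: "y \<in> space X" by (simp add: space_kernel[OF x])
    have "case_nat x \<in> P y \<rightarrow>\<^sub>M \<Omega>"
      using x sets_chain_law[OF y] by (simp cong: measurable_cong_sets)
    then show "(\<integral>\<^sup>+\<omega>. F \<omega> \<partial>distr (P y) \<Omega> (case_nat x)) = (\<integral>\<^sup>+\<omega>. F (case_nat x \<omega>) \<partial>P y)"
      by (simp add: nn_integral_distr)
  qed
  finally show ?thesis .
qed

end

section \<open>Conservative systems and Kac's formula\<close>

lemma suminf_swap_ennreal: "(\<Sum>i. \<Sum>j. f i j) = (\<Sum>j. \<Sum>i. f i j :: ennreal)"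
proof -
  have "(\<Sum>i. \<Sum>j. f i j) = (\<integral>\<^sup>+i. (\<Sum>j. f i j) \<partial>count_space UNIV)"
    by (simp add: nn_integral_count_space_nat)
  also have "\<dots> = (\<Sum>j. \<integral>\<^sup>+i. f i j \<partial>count_space UNIV)"
    by (rule nn_integral_suminf) simp
  finally show ?thesis by (simp add: nn_integral_count_space_nat)
qed

lemma funpow_Suc_apply: "(T ^^ Suc n) x = (T ^^ n) (T x)"
  by (simp add: funpow_swap1)

lemma funpow_funpow_apply: "(T ^^ m) ((T ^^ n) x) = (T ^^ (n + m)) x"
  by (simp add: funpow_add add.commute[of n m])

lemma ex_first_time:
  assumes "\<exists>n. Q ((T ^^ n) x)"
  shows "\<exists>n. (\<forall>k<n. \<not> Q ((T ^^ k) x)) \<and> Q ((T ^^ n) x)"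
  using assms by (intro exI[of _ "LEAST n. Q ((T ^^ n) x)"]) (auto intro: LeastI dest: not_less_Least)

locale conservative_system = sigma_finite_measure M
  for M :: "'b measure" and T :: "'b \<Rightarrow> 'b" +
  assumes measurable_T [measurable]: "T \<in> M \<rightarrow>\<^sub>M M"
    and preserving: "B \<in> sets M \<Longrightarrow> emeasure M {x \<in> space M. T x \<in> B} = emeasure M B"
    and conservative: "W \<in> sets M \<Longrightarrow> AE x in M. x \<in> W \<longrightarrow> (\<exists>n\<ge>1. (T ^^ n) x \<in> W)"
begin

lemma measurable_T_funpow [measurable]: "(T ^^ n) \<in> M \<rightarrow>\<^sub>M M"
proof (induction n)
  case (Suc n)
  then show ?case using measurable_comp[OF Suc measurable_T] by simp
qed simp

text \<open>The remainder in Kac's formula. Were \<open>T\<close> invertible, this would be the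
  measure of the part of \<open>E\<close> that has not seen \<open>C\<close> during the
  \<open>n\<close> preceding steps.\<close>

definition avoiding :: "'b set \<Rightarrow> nat \<Rightarrow> 'b set \<Rightarrow> ennreal" where
  "avoiding C n E = emeasure M {x \<in> space M. (\<forall>k<n. (T ^^ k) x \<notin> C) \<and> (T ^^ n) x \<in> E}"

text \<open>Were \<open>T\<close> invertible, this would be the measure of the part of
  \<open>E\<close> whose last earlier visit to \<open>C\<close> lies exactly \<open>n + 1\<close>
  steps back. Starting in \<open>C\<close> states it without an inverse.\<close>

definition excursion :: "'b set \<Rightarrow> nat \<Rightarrow> 'b set \<Rightarrow> ennreal" where
  "excursion C n E = emeasure M {x \<in> space M. x \<in> C \<and>
    (\<forall>k<n. (T ^^ k) (T x) \<notin> C) \<and> (T ^^ n) (T x) \<in> E}"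

lemma avoiding_0: "E \<in> sets M \<Longrightarrow> avoiding C 0 E = emeasure M E"
  unfolding avoiding_def by (auto intro!: arg_cong[where f="emeasure M"] dest: sets.sets_into_space)

lemma avoiding_mono:
  assumes [measurable]: "D \<in> sets M" "E \<in> sets M" and sub: "D \<subseteq> C" "E' \<subseteq> E"
  shows "avoiding C n E' \<le> avoiding D n E"
  unfolding avoiding_def using sub by (intro emeasure_mono) (blast, measurable)

text \<open>Preservation of measure prepends one step to the orbit, and the new initial point either
  lies in \<open>C\<close>, which gives an excursion, or prolongs the avoidance.\<close>

lemma avoiding_Suc:
  assumes [measurable]: "C \<in> sets M" "E \<in> sets M"
  shows "avoiding C n E = excursion C n E + avoiding C (Suc n) E"
proof -
  let ?B = "{x \<in> space M. (\<forall>k<n. (T ^^ k) x \<notin> C) \<and> (T ^^ n) x \<in> E}"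
  have *: "(\<forall>k<Suc n. (T ^^ k) x \<notin> C) \<longleftrightarrow> x \<notin> C \<and> (\<forall>k<n. (T ^^ k) (T x) \<notin> C)" for x
    by (auto simp: less_Suc_eq_0_disj funpow_swap1)
  have "avoiding C n E = emeasure M {x \<in> space M. T x \<in> ?B}"
    unfolding avoiding_def by (rule preserving[symmetric]) measurable
  also have "{x \<in> space M. T x \<in> ?B} =
      {x \<in> space M. x \<in> C \<and> (\<forall>k<n. (T ^^ k) (T x) \<notin> C) \<and> (T ^^ n) (T x) \<in> E} \<union>
      {x \<in> space M. (\<forall>k<Suc n. (T ^^ k) x \<notin> C) \<and> (T ^^ Suc n) x \<in> E}"
    unfolding * funpow_Suc_apply using measurable_space[OF measurable_T] by auto
  also have "emeasure M \<dots> = excursion C n E + avoiding C (Suc n) E"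
    unfolding avoiding_def excursion_def
    by (rule plus_emeasure[symmetric]) (measurable, auto)
  finally show ?thesis .
qed

lemma emeasure_eq_excursions:
  assumes "C \<in> sets M" "E \<in> sets M"
  shows "emeasure M E = (\<Sum>n<N. excursion C n E) + avoiding C N E"
proof (induction N)
  case (Suc N)
  then show ?case using avoiding_Suc[OF assms, of N] by (simp add: ac_simps)
qed (simp add: avoiding_0 assms)

lemma suminf_excursion_le:
  assumes "C \<in> sets M" "E \<in> sets M"
  shows "(\<Sum>n. excursion C n E) \<le> emeasure M E"
proof (rule suminf_le_const)
  show "sum (\<lambda>n. excursion C n E) {..<N} \<le> emeasure M E" for N
    using emeasure_eq_excursions[OF assms, of N] by (simp add: add_increasing2)
qed simp

lemma kac_if_avoiding_tendsto_0:
  assumes sets: "C \<in> sets M" "E \<in> sets M" and lim: "(\<lambda>n. avoiding C n E) \<longlonglongrightarrow> 0"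
  shows "(\<Sum>n. excursion C n E) = emeasure M E"
proof -
  have "(\<lambda>N. (\<Sum>n<N. excursion C n E) + avoiding C N E) \<longlonglongrightarrow> (\<Sum>n. excursion C n E) + 0"
    by (intro tendsto_add lim summable_LIMSEQ) simp
  then have "(\<lambda>N::nat. emeasure M E) \<longlonglongrightarrow> (\<Sum>n. excursion C n E)"
    unfolding emeasure_eq_excursions[OF sets, symmetric] by simp
  then show ?thesis by (simp add: LIMSEQ_const_iff)
qed

text \<open>The only use of conservativity: almost every point of \<open>D\<close> returns to \<open>D\<close>.\<close>

lemma avoiding_self_tendsto_0:
  assumes D[measurable]: "D \<in> sets M" and fin: "emeasure M D < \<infinity>"
  shows "(\<lambda>n. avoiding D n D) \<longlonglongrightarrow> 0"
proof -
  \<comment> \<open>Partition of \<open>D\<close>, up to a null set, by the time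
    \<open>n + 1\<close> of the first return.\<close>
  let ?R = "\<lambda>n. {x \<in> space M. x \<in> D \<and> (\<forall>k<n. (T ^^ k) (T x) \<notin> D) \<and> (T ^^ n) (T x) \<in> D}"
  have disj: "disjoint_family ?R"
    unfolding disjoint_family_on_def
  proof (intro ballI impI)
    fix m n :: nat assume "m \<noteq> n"
    then have "m < n \<or> n < m" by auto
    then show "?R m \<inter> ?R n = {}" by auto
  qed
  have "(\<Sum>n. excursion D n D) = emeasure M (\<Union>n. ?R n)"
    unfolding excursion_def by (rule suminf_emeasure) (use disj in auto)
  also have "\<dots> = emeasure M D"
  proof (rule emeasure_eq_AE)
    have "AE x in M. x \<in> D \<longrightarrow> (\<exists>n\<ge>1. (T ^^ n) x \<in> D)" by (rule conservative) fact
    then show "AE x in M. x \<in> (\<Union>n. ?R n) \<longleftrightarrow> x \<in> D"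
    proof (eventually_elim, safe)
      fix x n assume x: "x \<in> D" and "1 \<le> n" "(T ^^ n) x \<in> D"
      then obtain m where "(T ^^ m) (T x) \<in> D"
        by (cases n) (auto simp: funpow_swap1)
      then have "\<exists>n. (\<forall>k<n. (T ^^ k) (T x) \<notin> D) \<and> (T ^^ n) (T x) \<in> D"
        using ex_first_time[of "\<lambda>x. x \<in> D" T "T x"] by auto
      then show "x \<in> (\<Union>n. ?R n)" using x sets.sets_into_space[OF D] by auto
    qed
  qed measurable
  finally have "(\<lambda>N. \<Sum>n<N. excursion D n D) \<longlonglongrightarrow> emeasure M D"
    using summable_LIMSEQ[of "\<lambda>n. excursion D n D"] by simp
  \<comment> \<open>The excursions already exhaust the measure of \<open>D\<close>. Since that
    measure is finite, it can be subtracted, and the remainder in the expansion tends to 0.\<close>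
  then have "(\<lambda>N. emeasure M D - (\<Sum>n<N. excursion D n D)) \<longlonglongrightarrow> emeasure M D - emeasure M D"
    using fin by (intro tendsto_diff_ennreal tendsto_const) auto
  moreover have "emeasure M D - (\<Sum>n<N. excursion D n D) = avoiding D N D" for N
  proof -
    have "(\<Sum>n<N. excursion D n D) \<noteq> top"
      using emeasure_eq_excursions[OF D D, of N] fin by (metis ennreal_add_eq_top infinity_ennreal_def less_irrefl)
    then show ?thesis
      by (subst emeasure_eq_excursions[OF D D, of N]) simp
  qed
  ultimately show ?thesis using fin by simp
qed

text \<open>Two consecutive stretches of avoidance, of lengths \<open>N\<close> and
  \<open>n\<close>, join into one.\<close>

lemma avoiding_first_entrance:
  assumes [measurable]: "C \<in> sets M" "E \<in> sets M"
  shows "avoiding C N {x \<in> space M. (\<forall>k<n. (T ^^ k) x \<notin> C) \<and> (T ^^ n) x \<in> E} = avoiding C (N + n) E"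
proof -
  have *: "(\<forall>k<N + n. (T ^^ k) x \<notin> C) \<longleftrightarrow>
      (\<forall>k<N. (T ^^ k) x \<notin> C) \<and> (\<forall>k<n. (T ^^ k) ((T ^^ N) x) \<notin> C)" for x
  proof safe
    fix k assume *: "\<forall>k<N. (T ^^ k) x \<notin> C" "\<forall>k<n. (T ^^ k) ((T ^^ N) x) \<notin> C" "k < N + n"
      and "(T ^^ k) x \<in> C"
    moreover have "(T ^^ k) x = (T ^^ (k - N)) ((T ^^ N) x)" if "\<not> k < N"
      using that by (simp add: funpow_funpow_apply)
    ultimately show False
      by (cases "k < N") (auto dest!: spec[of _ "k - N"])
  next
    fix k assume *: "\<forall>k<N + n. (T ^^ k) x \<notin> C" and "k < n" "(T ^^ k) ((T ^^ N) x) \<in> C"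
    then show False
      using *[rule_format, of "N + k"] by (simp add: funpow_funpow_apply)
  qed auto
  show ?thesis
    unfolding avoiding_def * funpow_funpow_apply[of n _ N, symmetric]
    using measurable_space[OF measurable_T_funpow[of N]]
    by (intro arg_cong[where f="emeasure M"]) auto
qed

text \<open>The expansion into excursions is exact once the remainder tends to 0. For
  \<open>E\<close> itself this may be out of reach by direct bounds, since \<open>E\<close> may have
  infinite measure, so it is proved on countably many pieces of \<open>E\<close> and summed.\<close>

lemma kac:
  assumes C[measurable]: "C \<in> sets M" and E[measurable]: "E \<in> sets M"
    and hits: "AE x in M. x \<in> E \<longrightarrow> (\<exists>n. (T ^^ n) x \<in> C)"
  shows "emeasure M E = (\<Sum>n. excursion C n E)"
proof (rule antisym)
  obtain A :: "nat \<Rightarrow> 'b set" where A: "range A \<subseteq> sets M" "(\<Union>i. A i) = space M"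
    "\<And>i. emeasure M (A i) \<noteq> \<infinity>" "disjoint_family A"
    using sigma_finite_disjoint by metis
  have [measurable]: "A i \<in> sets M" for i using A(1) by auto
  \<comment> \<open>On each piece both the time \<open>n\<close> of the first contact with
    \<open>C\<close> and the finite-measure set \<open>A i\<close> met there are fixed.
    \<open>prod_decode\<close> merges the two indices into one.\<close>
  define F where "F p = (case prod_decode p of (n, i) \<Rightarrow>
    {x \<in> E. (\<forall>k<n. (T ^^ k) x \<notin> C) \<and> (T ^^ n) x \<in> C \<inter> A i})" for p
  have F[measurable]: "F p \<in> sets M" for p
    unfolding F_def by (cases "prod_decode p") (simp, measurable)
  have disj: "disjoint_family F"
    unfolding disjoint_family_on_def
  proof (intro ballI impI)
    fix p q :: nat assume "p \<noteq> q"
    obtain n i m j where *: "prod_decode p = (n, i)" "prod_decode q = (m, j)"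
      by (metis surj_pair)
    with \<open>p \<noteq> q\<close> have "(n, i) \<noteq> (m, j)" by (metis prod_decode_inverse)
    then consider "n < m" | "m < n" | "n = m" "i \<noteq> j" by force
    then show "F p \<inter> F q = {}"
    proof cases
      case 3
      then have "A i \<inter> A j = {}" using A(4) by (auto simp: disjoint_family_on_def)
      then show ?thesis using 3 by (auto simp: F_def *)
    qed (auto simp: F_def *)
  qed
  have F_kac: "emeasure M (F p) = (\<Sum>n. excursion C n (F p))" for p
  proof -
    obtain n i where p: "prod_decode p = (n, i)" by (metis surj_pair)
    have fin: "emeasure M (C \<inter> A i) < \<infinity>"
      using emeasure_mono[of "C \<inter> A i" "A i" M] A(3)[of i] by (auto simp: less_top[symmetric] top_unique)
    let ?E = "{x \<in> space M. (\<forall>k<n. (T ^^ k) x \<notin> C) \<and> (T ^^ n) x \<in> C \<inter> A i}"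
    \<comment> \<open>Continuing for the \<open>n\<close> steps up to the contact with
      \<open>C \<inter> A i\<close> lengthens the avoidance to \<open>N + n\<close>; avoiding only
      \<open>C \<inter> A i\<close> is a weaker demand. The bound is the remainder of a set of
      finite measure relative to itself.\<close>
    have le: "avoiding C N (F p) \<le> avoiding (C \<inter> A i) (N + n) (C \<inter> A i)" for N
    proof -
      have "avoiding C N (F p) \<le> avoiding C N ?E"
        using sets.sets_into_space[OF E] by (intro avoiding_mono) (auto simp: F_def p)
      also have "\<dots> = avoiding C (N + n) (C \<inter> A i)"
        by (rule avoiding_first_entrance) measurable
      also have "\<dots> \<le> avoiding (C \<inter> A i) (N + n) (C \<inter> A i)"
        by (rule avoiding_mono) auto
      finally show ?thesis .
    qed
    have lim: "(\<lambda>N. avoiding (C \<inter> A i) (N + n) (C \<inter> A i)) \<longlonglongrightarrow> 0"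
      by (rule LIMSEQ_ignore_initial_segment[OF avoiding_self_tendsto_0]) (use fin in auto)
    have "(\<lambda>N. avoiding C N (F p)) \<longlonglongrightarrow> 0"
      by (rule tendsto_sandwich[OF _ _ tendsto_const lim]) (intro always_eventually allI le zero_le)+
    from kac_if_avoiding_tendsto_0[OF C F this] show ?thesis by simp
  qed
  have "emeasure M E = emeasure M (\<Union>p. F p)"
  proof (rule emeasure_eq_AE)
    show "AE x in M. x \<in> E \<longleftrightarrow> x \<in> (\<Union>p. F p)"
      using hits AE_space
    proof eventually_elim
      fix x assume h: "x \<in> E \<longrightarrow> (\<exists>n. (T ^^ n) x \<in> C)" and x: "x \<in> space M"
      have "x \<in> (\<Union>p. F p)" if "x \<in> E"
      proof -
        from h that obtain n where n: "\<forall>k<n. (T ^^ k) x \<notin> C" "(T ^^ n) x \<in> C"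
          using ex_first_time[of "\<lambda>x. x \<in> C" T x] by auto
        obtain i where "(T ^^ n) x \<in> A i"
          using A(2) measurable_space[OF measurable_T_funpow x, of n] by auto
        then have "x \<in> F (prod_encode (n, i))"
          using n that by (auto simp: F_def)
        then show ?thesis by auto
      qed
      moreover have "F p \<subseteq> E" for p by (auto simp: F_def split: prod.splits)
      ultimately show "x \<in> E \<longleftrightarrow> x \<in> (\<Union>p. F p)" by blast
    qed
  qed measurable
  also have "\<dots> = (\<Sum>p. emeasure M (F p))"
    by (rule suminf_emeasure[symmetric]) (use disj in auto)
  also have "\<dots> = (\<Sum>n. \<Sum>p. excursion C n (F p))"
    unfolding F_kac by (rule suminf_swap_ennreal)
  \<comment> \<open>Excursions into the disjoint pieces are disjoint and end in \<open>E\<close>, so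
    together they have at most the measure of the excursions into \<open>E\<close>.\<close>
  also have "\<dots> \<le> (\<Sum>n. excursion C n E)"
  proof (intro suminf_le)
    fix n
    have "(\<Sum>p. excursion C n (F p)) = emeasure M (\<Union>p. {x \<in> space M. x \<in> C \<and>
        (\<forall>k<n. (T ^^ k) (T x) \<notin> C) \<and> (T ^^ n) (T x) \<in> F p})"
      unfolding excursion_def
      by (rule suminf_emeasure) (use disj in \<open>auto simp: disjoint_family_on_def\<close>)
    also have "\<dots> \<le> excursion C n E"
      unfolding excursion_def by (rule emeasure_mono) (auto simp: F_def split: prod.splits)
    finally show "(\<Sum>p. excursion C n (F p)) \<le> excursion C n E" .
  qed auto
  finally show "emeasure M E \<le> (\<Sum>n. excursion C n E)" .
qed (rule suminf_excursion_le[OF C E])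

end

section \<open>Recurrence and conservativity of the path shift\<close>

lemma suminf_ennreal_infinitely_often:
  fixes f :: "nat \<Rightarrow> ennreal"
  assumes io: "\<exists>\<^sub>\<infinity>n. ennreal e \<le> f n" and e: "0 < e"
  shows "suminf f = \<infinity>"
proof (rule ccontr)
  assume "suminf f \<noteq> \<infinity>"
  then obtain c where c: "suminf f = ennreal c" "0 \<le> c" by (cases "suminf f") auto
  have "real k * e \<le> c" for k
  proof -
    obtain S where S: "S \<subseteq> {n. ennreal e \<le> f n}" "finite S" "card S = k"
      using infinite_arbitrarily_large[of "{n. ennreal e \<le> f n}" k] io by (auto simp: INFM_iff_infinite)
    have "ennreal (real k * e) = (\<Sum>n\<in>S. ennreal e)"
      using S e by (simp add: ennreal_mult ennreal_of_nat_eq_real_of_nat)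
    also have "\<dots> \<le> (\<Sum>n\<in>S. f n)" using S by (intro sum_mono) auto
    also have "\<dots> \<le> suminf f" by (rule sum_le_suminf) (use S in auto)
    finally show ?thesis using c by simp
  qed
  moreover obtain k where "c < real k * e" using reals_Archimedean3[OF e] by auto
  ultimately show False by (meson not_le)
qed

context markov_kernel
begin

lemma nn_integral_cong_kernel:
  "x \<in> space X \<Longrightarrow> (\<And>y. y \<in> space X \<Longrightarrow> f y = g y) \<Longrightarrow> (\<integral>\<^sup>+y. f y \<partial>K x) = (\<integral>\<^sup>+y. g y \<partial>K x)"
  by (intro nn_integral_cong) (simp add: space_kernel)

lemma nn_integral_cong_path:
  "x \<in> space X \<Longrightarrow> (\<And>\<omega>. \<omega> \<in> space \<Omega> \<Longrightarrow> F \<omega> = G \<omega>) \<Longrightarrow> (\<integral>\<^sup>+\<omega>. F \<omega> \<partial>P x) = (\<integral>\<^sup>+\<omega>. G \<omega> \<partial>P x)"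
  by (intro nn_integral_cong) (simp add: space_chain_law)

lemma measurable_chain_law_cong [simp]:
  "x \<in> space X \<Longrightarrow> measurable (P x) N = measurable \<Omega> N"
  by (rule measurable_cong_sets) (simp_all add: sets_chain_law)

lemma measurable_kernel_cong [simp]:
  "x \<in> space X \<Longrightarrow> measurable (K x) N = measurable X N"
  by (rule measurable_cong_sets) (simp_all add: sets_kernel')

lemma path_component: "\<omega> \<in> space \<Omega> \<Longrightarrow> \<omega> n \<in> space X"
  by (auto simp: space_PiM PiE_iff)

lemma shift_path: "\<omega> \<in> space \<Omega> \<Longrightarrow> (path_shift ^^ n) \<omega> \<in> space \<Omega>"
  by (auto simp: space_PiM PiE_iff path_shift_funpow)

lemma emeasure_chain_law_space: "x \<in> space X \<Longrightarrow> emeasure (P x) (space \<Omega>) = 1"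
  using prob_space.emeasure_space_1[OF prob_space_chain_law] by (simp add: space_chain_law)

lemma measurable_path_integral_const [measurable]:
  assumes [measurable]: "F \<in> borel_measurable \<Omega>"
  shows "(\<lambda>x. \<integral>\<^sup>+\<omega>. F \<omega> \<partial>P x) \<in> borel_measurable X"
  by (rule measurable_path_integral) measurable

lemma AE_chain_law_start:
  assumes x: "x \<in> space X" and [measurable]: "Measurable.pred X Q" and Q: "Q x"
  shows "AE \<omega> in P x. Q (\<omega> 0)"
proof -
  have "(\<integral>\<^sup>+\<omega>. indicator {y \<in> space X. \<not> Q y} (\<omega> 0) \<partial>P x) = (0::ennreal)"
    using nn_integral_chain_law_0[OF x, of "indicator {y \<in> space X. \<not> Q y}"] Q by simp
  then have "AE \<omega> in P x. indicator {y \<in> space X. \<not> Q y} (\<omega> 0) = (0::ennreal)"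
    by (subst (asm) nn_integral_0_iff_AE) (auto simp: x)
  then show ?thesis
    using AE_space
    by eventually_elim (auto simp: indicator_def space_chain_law[OF x] path_component split: if_splits)
qed

lemma measurable_path_integral_at [measurable]:
  assumes F: "F \<in> borel_measurable \<Omega>"
  shows "(\<lambda>\<omega>. \<integral>\<^sup>+\<omega>'. F \<omega>' \<partial>P (\<omega> n)) \<in> borel_measurable \<Omega>"
  by (rule measurable_compose[OF _ measurable_path_integral_const[OF F]]) measurable

text \<open>Testing the past by cylinders suits induction along first steps: the constraint at time
  0 becomes a constant factor and a shorter cylinder remains. Cylinders are also all that a
  comparison of path measures requires.\<close>

lemma markov_property:
  assumes x: "x \<in> space X" and F[measurable]: "F \<in> borel_measurable \<Omega>"
    and B: "\<And>i. B i \<in> sets X"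
  shows "(\<integral>\<^sup>+\<omega>. indicator (cylinder X n B) \<omega> * F ((path_shift ^^ n) \<omega>) \<partial>P x) =
    (\<integral>\<^sup>+\<omega>. indicator (cylinder X n B) \<omega> * (\<integral>\<^sup>+\<omega>'. F \<omega>' \<partial>P (\<omega> n)) \<partial>P x)"
  using x B
proof (induction n arbitrary: x B)
  case 0
  have *: "cylinder X 0 B = space \<Omega>" by (auto simp: cylinder_def)
  have "(\<integral>\<^sup>+\<omega>. (\<integral>\<^sup>+\<omega>'. F \<omega>' \<partial>P (\<omega> 0)) \<partial>P x) = (\<integral>\<^sup>+\<omega>. F \<omega> \<partial>P x)"
    by (rule nn_integral_chain_law_0[OF 0(1)]) measurable
  then show ?case
    by (simp add: * indicator_def space_chain_law[OF 0(1), symmetric] cong: nn_integral_cong_simp)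
next
  case (Suc n)
  note x = Suc.prems(1) and B[measurable] = Suc.prems(2)
  have ind: "indicator (cylinder X (Suc n) B) (case_nat x \<omega>) =
      indicator (B 0) x * (indicator (cylinder X n (\<lambda>i. B (Suc i))) \<omega> :: ennreal)" if "\<omega> \<in> space \<Omega>" for \<omega>
    using cylinder_Suc_case_nat[OF x, of n B] that
    by (auto simp: indicator_def split: if_splits)
  have [measurable]: "cylinder X (Suc n) B \<in> sets \<Omega>" "cylinder X n (\<lambda>i. B (Suc i)) \<in> sets \<Omega>"
    using B by auto
  have inner: "(\<integral>\<^sup>+\<omega>. indicator (cylinder X (Suc n) B) (case_nat x \<omega>) * G \<omega> \<partial>P y) =
      indicator (B 0) x * (\<integral>\<^sup>+\<omega>. indicator (cylinder X n (\<lambda>i. B (Suc i))) \<omega> * G \<omega> \<partial>P y)"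
    if y: "y \<in> space X" and [measurable]: "G \<in> borel_measurable \<Omega>" for y and G :: "_ \<Rightarrow> ennreal"
    using y by (subst nn_integral_cmult[symmetric])
      (auto intro!: nn_integral_cong_path[OF y] simp: ind mult.assoc)
  have "(\<integral>\<^sup>+\<omega>. indicator (cylinder X (Suc n) B) \<omega> * F ((path_shift ^^ Suc n) \<omega>) \<partial>P x) =
      (\<integral>\<^sup>+y. \<integral>\<^sup>+\<omega>. indicator (cylinder X (Suc n) B) (case_nat x \<omega>) * F ((path_shift ^^ n) \<omega>) \<partial>P y \<partial>K x)"
    by (subst chain_law_first_step[OF x]) (measurable, simp add: funpow_Suc_apply del: funpow.simps)
  also have "\<dots> = (\<integral>\<^sup>+y. \<integral>\<^sup>+\<omega>. indicator (cylinder X (Suc n) B) (case_nat x \<omega>) *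
      (\<integral>\<^sup>+\<omega>'. F \<omega>' \<partial>P (\<omega> n)) \<partial>P y \<partial>K x)"
    by (intro nn_integral_cong_kernel[OF x]) (simp add: inner Suc.IH)
  also have "\<dots> = (\<integral>\<^sup>+\<omega>. indicator (cylinder X (Suc n) B) \<omega> * (\<integral>\<^sup>+\<omega>'. F \<omega>' \<partial>P (\<omega> (Suc n))) \<partial>P x)"
    by (subst chain_law_first_step[OF x]) (auto intro!: borel_measurable_times_ennreal measurable_path_integral_at)
  finally show ?case .
qed

lemma markov_property_shift:
  assumes x: "x \<in> space X" and F[measurable]: "F \<in> borel_measurable \<Omega>"
  shows "(\<integral>\<^sup>+\<omega>. F ((path_shift ^^ n) \<omega>) \<partial>P x) = (\<integral>\<^sup>+\<omega>. (\<integral>\<^sup>+\<omega>'. F \<omega>' \<partial>P (\<omega> n)) \<partial>P x)"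
proof -
  have *: "cylinder X n (\<lambda>_. space X) = space \<Omega>"
    using path_component by (auto simp: cylinder_def)
  have "(\<integral>\<^sup>+\<omega>. F ((path_shift ^^ n) \<omega>) \<partial>P x) =
      (\<integral>\<^sup>+\<omega>. indicator (cylinder X n (\<lambda>_. space X)) \<omega> * F ((path_shift ^^ n) \<omega>) \<partial>P x)"
    by (rule nn_integral_cong_path[OF x]) (simp add: *)
  also have "\<dots> = (\<integral>\<^sup>+\<omega>. indicator (cylinder X n (\<lambda>_. space X)) \<omega> * (\<integral>\<^sup>+\<omega>'. F \<omega>' \<partial>P (\<omega> n)) \<partial>P x)"
    by (rule markov_property[OF x]) auto
  also have "\<dots> = (\<integral>\<^sup>+\<omega>. (\<integral>\<^sup>+\<omega>'. F \<omega>' \<partial>P (\<omega> n)) \<partial>P x)"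
    by (rule nn_integral_cong_path[OF x]) (simp add: *)
  finally show ?thesis .
qed

text \<open>The initial measure may live on a subspace of \<open>X\<close>, hence the hypothesis on the inclusion.\<close>

lemma
  assumes inc: "(\<lambda>x. x) \<in> \<nu> \<rightarrow>\<^sub>M X"
  shows nn_integral_chain_law_init: "F \<in> borel_measurable \<Omega> \<Longrightarrow>
      (\<integral>\<^sup>+\<omega>. F \<omega> \<partial>chain_law_init X K \<nu>) = (\<integral>\<^sup>+x. \<integral>\<^sup>+\<omega>. F \<omega> \<partial>P x \<partial>\<nu>)"
    and AE_chain_law_init: "Measurable.pred \<Omega> Q \<Longrightarrow>
      (AE \<omega> in chain_law_init X K \<nu>. Q \<omega>) \<longleftrightarrow> (AE x in \<nu>. AE \<omega> in P x. Q \<omega>)"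
    and sets_chain_law_init: "space \<nu> \<noteq> {} \<Longrightarrow> sets (chain_law_init X K \<nu>) = sets \<Omega>"
proof -
  have P: "P \<in> \<nu> \<rightarrow>\<^sub>M subprob_algebra \<Omega>"
    using measurable_compose[OF inc measurable_chain_law] .
  show "F \<in> borel_measurable \<Omega> \<Longrightarrow>
      (\<integral>\<^sup>+\<omega>. F \<omega> \<partial>chain_law_init X K \<nu>) = (\<integral>\<^sup>+x. \<integral>\<^sup>+\<omega>. F \<omega> \<partial>P x \<partial>\<nu>)"
    unfolding chain_law_init_def by (rule nn_integral_bind[OF _ P])
  show "Measurable.pred \<Omega> Q \<Longrightarrow>
      (AE \<omega> in chain_law_init X K \<nu>. Q \<omega>) \<longleftrightarrow> (AE x in \<nu>. AE \<omega> in P x. Q \<omega>)"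
    unfolding chain_law_init_def by (rule AE_bind[OF P])
  show "sets (chain_law_init X K \<nu>) = sets \<Omega>" if "space \<nu> \<noteq> {}"
    unfolding chain_law_init_def
    by (rule sets_bind[OF _ that]) (use measurable_space[OF inc] sets_chain_law in auto)
qed

end

section \<open>The path shift under the recurrent invariant measure\<close>

locale recurrent_chain = markov_kernel +
  fixes \<mu> :: "'a measure"
  assumes nonempty: "space X \<noteq> {}"
    and sigma_finite: "sigma_finite_measure \<mu>"
    and invariant: "invariant_measure X K \<mu>"
    and recurrent: "recurrent_measure X K \<mu>"
begin

lemma sets_\<mu> [measurable_cong]: "sets \<mu> = sets X"
  using invariant by (simp add: invariant_measure_def)

lemma space_\<mu>: "space \<mu> = space X"
  by (rule sets_eq_imp_space_eq[OF sets_\<mu>])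

lemma inclusion_\<mu>: "(\<lambda>x. x) \<in> \<mu> \<rightarrow>\<^sub>M X"
  by (rule measurable_ident_sets[OF sets_\<mu>])

abbreviation "P\<mu> \<equiv> chain_law_init X K \<mu>"

lemmas nn_integral_P\<mu> = nn_integral_chain_law_init[OF inclusion_\<mu>]
lemmas AE_P\<mu> = AE_chain_law_init[OF inclusion_\<mu>]

lemma sets_P\<mu> [measurable_cong]: "sets P\<mu> = sets \<Omega>"
  by (rule sets_chain_law_init[OF inclusion_\<mu>]) (simp add: space_\<mu> nonempty)

lemma space_P\<mu>: "space P\<mu> = space \<Omega>"
  by (rule sets_eq_imp_space_eq[OF sets_P\<mu>])

lemma emeasure_P\<mu>: "S \<in> sets \<Omega> \<Longrightarrow> emeasure P\<mu> S = (\<integral>\<^sup>+x. emeasure (P x) S \<partial>\<mu>)"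
  using nn_integral_P\<mu>[of "indicator S"]
  by (simp add: sets_P\<mu>) (auto intro!: nn_integral_cong simp: space_\<mu> sets_chain_law)

lemma nn_integral_invariant:
  assumes f: "f \<in> borel_measurable X"
  shows "(\<integral>\<^sup>+x. \<integral>\<^sup>+y. f y \<partial>K x \<partial>\<mu>) = (\<integral>\<^sup>+x. f x \<partial>\<mu>)"
proof -
  have K: "K \<in> \<mu> \<rightarrow>\<^sub>M subprob_algebra X" by (simp add: measurable_cong_sets[OF sets_\<mu> refl])
  have ne: "space \<mu> \<noteq> {}" by (simp add: space_\<mu> nonempty)
  have sets: "sets (\<mu> \<bind> K) = sets X" by (rule sets_bind[OF _ ne]) (simp add: space_\<mu> sets_kernel')
  have "\<mu> \<bind> K = \<mu>"
  proof (rule measure_eqI)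
    fix B assume "B \<in> sets (\<mu> \<bind> K)"
    then have B: "B \<in> sets X" using sets by simp
    then show "emeasure (\<mu> \<bind> K) B = emeasure \<mu> B"
      using invariant by (simp add: emeasure_bind[OF ne K] invariant_measure_def)
  qed (simp add: sets sets_\<mu>)
  with nn_integral_bind[OF f K] show ?thesis by simp
qed

text \<open>By invariance, \<open>K x\<close> charges a given \<mu>-null set for almost no
  \<open>x\<close>. Thus statements that hold almost everywhere survive one step of the
  chain.\<close>

lemma AE_kernel: "AE x in \<mu>. AE y in K x. Q y" if "AE x in \<mu>. Q x"
proof -
  from that obtain N where N: "{x \<in> space \<mu>. \<not> Q x} \<subseteq> N" "emeasure \<mu> N = 0" "N \<in> sets \<mu>"
    by (rule AE_E)
  then have [measurable]: "N \<in> sets X" by (simp add: sets_\<mu>)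
  have "(\<integral>\<^sup>+x. emeasure (K x) N \<partial>\<mu>) = 0"
    using invariant N by (simp add: invariant_measure_def)
  then have "AE x in \<mu>. emeasure (K x) N = 0"
    by (subst (asm) nn_integral_0_iff_AE) auto
  then show ?thesis
    using AE_space
  proof eventually_elim
    fix x assume 0: "emeasure (K x) N = 0" and "x \<in> space \<mu>"
    then have x: "x \<in> space X" by (simp add: space_\<mu>)
    then show "AE y in K x. Q y"
      by (intro AE_I[OF _ 0]) (use N in \<open>auto simp: sets_kernel' space_kernel space_\<mu>\<close>)
  qed
qed

lemma nn_integral_P\<mu>_0: "f \<in> borel_measurable X \<Longrightarrow> (\<integral>\<^sup>+\<omega>. f (\<omega> 0) \<partial>P\<mu>) = (\<integral>\<^sup>+x. f x \<partial>\<mu>)"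
  by (subst nn_integral_P\<mu>) (auto intro!: nn_integral_cong simp: space_\<mu> nn_integral_chain_law_0)

lemma nn_integral_P\<mu>_shift:
  assumes [measurable]: "F \<in> borel_measurable \<Omega>"
  shows "(\<integral>\<^sup>+\<omega>. F (path_shift \<omega>) \<partial>P\<mu>) = (\<integral>\<^sup>+\<omega>. F \<omega> \<partial>P\<mu>)"
proof -
  have "(\<integral>\<^sup>+\<omega>. F (path_shift \<omega>) \<partial>P\<mu>) = (\<integral>\<^sup>+x. \<integral>\<^sup>+y. \<integral>\<^sup>+\<omega>. F \<omega> \<partial>P y \<partial>K x \<partial>\<mu>)"
    by (subst nn_integral_P\<mu>) (auto intro!: nn_integral_cong simp: space_\<mu> chain_law_first_step)
  also have "\<dots> = (\<integral>\<^sup>+x. \<integral>\<^sup>+\<omega>. F \<omega> \<partial>P x \<partial>\<mu>)"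
    by (rule nn_integral_invariant) measurable
  finally show ?thesis by (simp add: nn_integral_P\<mu>)
qed

lemma emeasure_P\<mu>_shift:
  assumes [measurable]: "S \<in> sets \<Omega>"
  shows "emeasure P\<mu> {\<omega> \<in> space \<Omega>. path_shift \<omega> \<in> S} = emeasure P\<mu> S"
proof -
  have "emeasure P\<mu> {\<omega> \<in> space \<Omega>. path_shift \<omega> \<in> S} = (\<integral>\<^sup>+\<omega>. indicator {\<omega> \<in> space \<Omega>. path_shift \<omega> \<in> S} \<omega> \<partial>P\<mu>)"
    by (rule nn_integral_indicator[symmetric]) measurable
  also have "\<dots> = (\<integral>\<^sup>+\<omega>. indicator S (path_shift \<omega>) \<partial>P\<mu>)"
    by (intro nn_integral_cong) (auto simp: indicator_def space_P\<mu>)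
  also have "\<dots> = emeasure P\<mu> S"
    by (subst nn_integral_P\<mu>_shift) (auto simp: sets_P\<mu>)
  finally show ?thesis .
qed

lemma sigma_finite_P\<mu>: "sigma_finite_measure P\<mu>"
proof -
  obtain A :: "nat \<Rightarrow> 'a set" where A: "range A \<subseteq> sets \<mu>" "(\<Union>i. A i) = space \<mu>" "\<And>i. emeasure \<mu> (A i) \<noteq> \<infinity>"
    using sigma_finite_measure.sigma_finite[OF sigma_finite] by metis
  then have [measurable]: "A i \<in> sets X" for i by (auto simp: sets_\<mu>)
  let ?B = "\<lambda>i. {\<omega> \<in> space \<Omega>. \<omega> 0 \<in> A i}"
  have em: "emeasure P\<mu> (?B i) = emeasure \<mu> (A i)" for i
  proof -
    have "emeasure P\<mu> (?B i) = (\<integral>\<^sup>+\<omega>. indicator (?B i) \<omega> \<partial>P\<mu>)"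
      by (rule nn_integral_indicator[symmetric]) measurable
    also have "\<dots> = (\<integral>\<^sup>+\<omega>. indicator (A i) (\<omega> 0) \<partial>P\<mu>)"
      by (intro nn_integral_cong) (auto simp: indicator_def space_P\<mu>)
    also have "\<dots> = emeasure \<mu> (A i)"
      by (subst nn_integral_P\<mu>_0) (auto simp: sets_\<mu>)
    finally show ?thesis .
  qed
  show ?thesis
  proof
    show "\<exists>Ab. countable Ab \<and> Ab \<subseteq> sets P\<mu> \<and> \<Union> Ab = space P\<mu> \<and> (\<forall>a\<in>Ab. emeasure P\<mu> a \<noteq> \<infinity>)"
    proof (intro exI[of _ "range ?B"] conjI)
      show "range ?B \<subseteq> sets P\<mu>" by (auto simp: sets_P\<mu>)
      have "\<exists>i. \<omega> 0 \<in> A i" if "\<omega> \<in> space \<Omega>" for \<omega>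
        using path_component[OF that, of 0] A(2) by (auto simp: space_\<mu>)
      then show "\<Union> (range ?B) = space P\<mu>" by (auto simp: space_P\<mu>)
      show "\<forall>a\<in>range ?B. emeasure P\<mu> a \<noteq> \<infinity>" using em A(3) by auto
    qed auto
  qed
qed

lemma AE_P\<mu>_shift: "AE \<omega> in P\<mu>. Q (path_shift \<omega>)" if "AE \<omega> in P\<mu>. Q \<omega>"
proof -
  from that obtain N where N: "{x \<in> space P\<mu>. \<not> Q x} \<subseteq> N" "emeasure P\<mu> N = 0" "N \<in> sets P\<mu>"
    by (rule AE_E)
  then have [measurable]: "N \<in> sets \<Omega>" by (simp add: sets_P\<mu>)
  have "{\<omega> \<in> space \<Omega>. path_shift \<omega> \<in> N} \<in> null_sets P\<mu>"
    using emeasure_P\<mu>_shift[of N] N(2) by (auto simp: null_sets_def)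
  then show ?thesis
    by (rule AE_I') (use N measurable_space[OF measurable_path_shift, of _ X] in \<open>auto simp: space_P\<mu>\<close>)
qed

lemma AE_P\<mu>_shift_funpow: "AE \<omega> in P\<mu>. Q ((path_shift ^^ n) \<omega>)" if "AE \<omega> in P\<mu>. Q \<omega>"
proof (induction n)
  case (Suc n)
  from AE_P\<mu>_shift[OF Suc.IH] show ?case by (simp add: funpow_swap1)
qed (simp add: that)

text \<open>The shift preserves null sets, so outside one null set a single return is guaranteed
  from every point of the orbit that satisfies \<open>W\<close>, and returns can be
  iterated.\<close>

lemma AE_returns_infinitely_often:
  assumes "AE \<omega> in P\<mu>. W \<omega> \<longrightarrow> (\<exists>n\<ge>1. W ((path_shift ^^ n) \<omega>))"
  shows "AE \<omega> in P\<mu>. W \<omega> \<longrightarrow> (\<exists>\<^sub>\<infinity>n. W ((path_shift ^^ n) \<omega>))"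
proof -
  have "AE \<omega> in P\<mu>. W ((path_shift ^^ k) \<omega>) \<longrightarrow> (\<exists>n\<ge>1. W ((path_shift ^^ n) ((path_shift ^^ k) \<omega>)))" for k
    by (rule AE_P\<mu>_shift_funpow[OF assms])
  then have "AE \<omega> in P\<mu>. \<forall>k. W ((path_shift ^^ k) \<omega>) \<longrightarrow> (\<exists>n\<ge>1. W ((path_shift ^^ (k + n)) \<omega>))"
    unfolding funpow_funpow_apply by (subst AE_all_countable) auto
  then show ?thesis
  proof eventually_elim
    fix \<omega> :: "nat \<Rightarrow> 'a"
    assume *: "\<forall>k. W ((path_shift ^^ k) \<omega>) \<longrightarrow> (\<exists>n\<ge>1. W ((path_shift ^^ (k + n)) \<omega>))"
    have step: "\<exists>n>k. W ((path_shift ^^ n) \<omega>)" if W: "W ((path_shift ^^ k) \<omega>)" for k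
    proof -
      from * W obtain n where "n \<ge> 1" "W ((path_shift ^^ (k + n)) \<omega>)" by blast
      then show ?thesis by (intro exI[of _ "k + n"]) auto
    qed
    have "\<exists>n>k. W ((path_shift ^^ n) \<omega>)" if "W \<omega>" for k
    proof (induction k)
      case (Suc k)
      then obtain n where "n > k" "W ((path_shift ^^ n) \<omega>)" by auto
      with step[of n] show ?case by (metis Suc_lessI order.strict_trans)
    qed (use step[of 0] that in auto)
    then show "W \<omega> \<longrightarrow> (\<exists>\<^sub>\<infinity>n. W ((path_shift ^^ n) \<omega>))" by (auto simp: INFM_nat)
  qed
qed

lemma AE_visits_infinitely_often:
  assumes B[measurable]: "B \<in> sets X" and fin: "emeasure \<mu> B < \<infinity>"
  shows "AE \<omega> in P\<mu>. \<omega> 0 \<in> B \<longrightarrow> (\<exists>\<^sub>\<infinity>n. \<omega> n \<in> B)"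
proof -
  have "AE x in \<mu>. x \<in> B \<longrightarrow> (AE \<omega> in P x. \<exists>n\<ge>1. \<omega> n \<in> B)"
    using recurrent B fin by (auto simp: recurrent_measure_def)
  then have "AE x in \<mu>. AE \<omega> in P x. \<omega> 0 \<in> B \<longrightarrow> (\<exists>n\<ge>1. \<omega> n \<in> B)"
    using AE_space
  proof eventually_elim
    fix x assume *: "x \<in> B \<longrightarrow> (AE \<omega> in P x. \<exists>n\<ge>1. \<omega> n \<in> B)" and "x \<in> space \<mu>"
    then have x: "x \<in> space X" by (simp add: space_\<mu>)
    show "AE \<omega> in P x. \<omega> 0 \<in> B \<longrightarrow> (\<exists>n\<ge>1. \<omega> n \<in> B)"
    proof (cases "x \<in> B")
      case False
      have "AE \<omega> in P x. \<omega> 0 \<notin> B"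
        by (rule AE_chain_law_start[OF x]) (use False in auto)
      then show ?thesis by eventually_elim simp
    qed (use * in auto)
  qed
  then have "AE \<omega> in P\<mu>. \<omega> 0 \<in> B \<longrightarrow> (\<exists>n\<ge>1. \<omega> n \<in> B)"
    by (subst AE_P\<mu>) measurable
  from AE_returns_infinitely_often[of "\<lambda>\<omega>. \<omega> 0 \<in> B"] this show ?thesis
    by (simp add: path_shift_funpow)
qed

text \<open>
  A function whose potential is finite vanishes, since a recurrent chain returns infinitely often
  to every set where the function is bounded away from zero.
\<close>

lemma AE_eq_0_if_potential_le_1:
  assumes g[measurable]: "g \<in> borel_measurable X"
    and le: "\<And>N. AE x in \<mu>. (\<integral>\<^sup>+\<omega>. (\<Sum>n<N. g (\<omega> n)) \<partial>P x) \<le> 1"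
  shows "AE x in \<mu>. g x = 0"
proof -
  obtain A :: "nat \<Rightarrow> 'a set" where A: "range A \<subseteq> sets \<mu>" "(\<Union>i. A i) = space \<mu>" "\<And>i. emeasure \<mu> (A i) \<noteq> \<infinity>"
    using sigma_finite_measure.sigma_finite[OF sigma_finite] by metis
  then have [measurable]: "A i \<in> sets X" for i by (auto simp: sets_\<mu>)
  \<comment> \<open>The levels bound \<open>g\<close> from below on repeated visits; intersecting
    with \<open>A i\<close> makes the measure finite, as recurrence requires. Their union over
    \<open>i\<close> and \<open>k\<close> is the set where \<open>g\<close> is positive.\<close>
  define B where "B i k = {x \<in> space X. x \<in> A i \<and> ennreal (inverse (real (Suc k))) \<le> g x}" for i k
  have [measurable]: "B i k \<in> sets X" for i k unfolding B_def by measurable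
  have "AE x in \<mu>. \<forall>N. (\<integral>\<^sup>+\<omega>. (\<Sum>n<N. g (\<omega> n)) \<partial>P x) \<le> 1"
    using le by (subst AE_all_countable) auto
  then have total: "AE x in \<mu>. (\<integral>\<^sup>+\<omega>. (\<Sum>n. g (\<omega> n)) \<partial>P x) \<le> 1"
    using AE_space
  proof eventually_elim
    fix x assume *: "\<forall>N. (\<integral>\<^sup>+\<omega>. (\<Sum>n<N. g (\<omega> n)) \<partial>P x) \<le> 1" and "x \<in> space \<mu>"
    then have x: "x \<in> space X" by (simp add: space_\<mu>)
    have "(\<integral>\<^sup>+\<omega>. (\<Sum>n. g (\<omega> n)) \<partial>P x) = (\<Sum>n. \<integral>\<^sup>+\<omega>. g (\<omega> n) \<partial>P x)"
      by (rule nn_integral_suminf) (simp add: x)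
    also have "\<dots> \<le> 1"
    proof (rule suminf_le_const)
      fix N
      have "(\<Sum>n<N. \<integral>\<^sup>+\<omega>. g (\<omega> n) \<partial>P x) = (\<integral>\<^sup>+\<omega>. (\<Sum>n<N. g (\<omega> n)) \<partial>P x)"
        by (rule nn_integral_sum[symmetric]) (simp add: x)
      then show "(\<Sum>n<N. \<integral>\<^sup>+\<omega>. g (\<omega> n) \<partial>P x) \<le> 1" using * by simp
    qed simp
    finally show "(\<integral>\<^sup>+\<omega>. (\<Sum>n. g (\<omega> n)) \<partial>P x) \<le> 1" .
  qed
  have "AE x in \<mu>. x \<notin> B i k" for i k
  proof -
    have "emeasure \<mu> (B i k) \<le> emeasure \<mu> (A i)"
      by (rule emeasure_mono) (auto simp: B_def sets_\<mu>)
    also have "\<dots> < \<infinity>" using A(3)[of i] by (simp add: less_top[symmetric])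
    finally have "emeasure \<mu> (B i k) < \<infinity>" .
    from AE_visits_infinitely_often[OF _ this]
    have "AE \<omega> in P\<mu>. \<omega> 0 \<in> B i k \<longrightarrow> (\<exists>\<^sub>\<infinity>n. \<omega> n \<in> B i k)" by simp
    then have "AE \<omega> in P\<mu>. \<omega> 0 \<in> B i k \<longrightarrow> (\<Sum>n. g (\<omega> n)) = \<infinity>"
    proof eventually_elim
      fix \<omega> :: "nat \<Rightarrow> 'a" assume *: "\<omega> 0 \<in> B i k \<longrightarrow> (\<exists>\<^sub>\<infinity>n. \<omega> n \<in> B i k)"
      show "\<omega> 0 \<in> B i k \<longrightarrow> (\<Sum>n. g (\<omega> n)) = \<infinity>"
      proof
        assume "\<omega> 0 \<in> B i k"
        with * have "\<exists>\<^sub>\<infinity>n. \<omega> n \<in> B i k" by simp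
        then have "\<exists>\<^sub>\<infinity>n. ennreal (inverse (real (Suc k))) \<le> g (\<omega> n)"
          by (rule INFM_mono) (auto simp: B_def)
        then show "(\<Sum>n. g (\<omega> n)) = \<infinity>"
          by (rule suminf_ennreal_infinitely_often) simp
      qed
    qed
    then have "AE x in \<mu>. AE \<omega> in P x. \<omega> 0 \<in> B i k \<longrightarrow> (\<Sum>n. g (\<omega> n)) = \<infinity>"
      by (subst (asm) AE_P\<mu>) measurable
    with total show ?thesis
      using AE_space
    proof eventually_elim
      fix x assume le: "(\<integral>\<^sup>+\<omega>. (\<Sum>n. g (\<omega> n)) \<partial>P x) \<le> 1"
        and inf: "AE \<omega> in P x. \<omega> 0 \<in> B i k \<longrightarrow> (\<Sum>n. g (\<omega> n)) = \<infinity>" and "x \<in> space \<mu>"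
      then have x: "x \<in> space X" by (simp add: space_\<mu>)
      show "x \<notin> B i k"
      proof
        assume xB: "x \<in> B i k"
        \<comment> \<open>Starting in the level set, the sum of \<open>g\<close> along the path is
          almost surely infinite, which contradicts an expectation of at most 1.\<close>
        have "\<infinity> * indicator (B i k) x = (\<integral>\<^sup>+\<omega>. \<infinity> * indicator (B i k) (\<omega> 0) \<partial>P x)"
          by (rule nn_integral_chain_law_0[OF x, symmetric]) measurable
        also have "\<dots> \<le> (\<integral>\<^sup>+\<omega>. (\<Sum>n. g (\<omega> n)) \<partial>P x)"
          by (rule nn_integral_mono_AE) (use inf in eventually_elim, auto simp: indicator_def)
        also have "\<dots> \<le> 1" by (rule le)
        finally show False using xB by (simp add: top_unique)
      qed
    qed
  qed
  then have "AE x in \<mu>. \<forall>i k. x \<notin> B i k"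
    by (simp add: AE_all_countable)
  then show ?thesis
    using AE_space
  proof eventually_elim
    fix x assume *: "\<forall>i k. x \<notin> B i k" and x: "x \<in> space \<mu>"
    from x A(2) obtain i where i: "x \<in> A i" by auto
    have lt: "g x < ennreal (inverse (real (Suc k)))" for k
      using *[rule_format, of i k] i x by (auto simp: B_def space_\<mu>)
    show "g x = 0"
    proof (rule ccontr)
      assume "g x \<noteq> 0"
      with lt[of 0] obtain r where r: "g x = ennreal r" "0 < r"
        by (cases "g x") (auto simp: order_less_le top_unique)
      obtain k where "inverse (real (Suc k)) < r" using reals_Archimedean[OF r(2)] by auto
      with lt[of k] r show False by (simp add: ennreal_less_iff)
    qed
  qed
qed

text \<open>Being in \<open>W\<close> for the last time happens at most once along a path. By the
  Markov property, the probability of this event as a function of the starting state has potential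
  at most 1, so it vanishes almost everywhere. In this way returns to sets of states yield returns
  to path events.\<close>

lemma P\<mu>_conservative:
  assumes W[measurable]: "W \<in> sets \<Omega>"
  shows "AE \<omega> in P\<mu>. \<omega> \<in> W \<longrightarrow> (\<exists>n\<ge>1. (path_shift ^^ n) \<omega> \<in> W)"
proof -
  define V where "V = {\<omega> \<in> space \<Omega>. \<omega> \<in> W \<and> (\<forall>n\<ge>1. (path_shift ^^ n) \<omega> \<notin> W)}"
  have [measurable]: "V \<in> sets \<Omega>" unfolding V_def by measurable
  \<comment> \<open>If two times were in \<open>V\<close>, the later one would be a return to
    \<open>W\<close> that the earlier one excludes.\<close>
  have once: "(\<Sum>n<N. indicator V ((path_shift ^^ n) \<omega>)) \<le> (1::ennreal)" if "\<omega> \<in> space \<Omega>" for \<omega> N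
  proof (cases "\<exists>n<N. (path_shift ^^ n) \<omega> \<in> V")
    case True
    then obtain n where n: "n < N" "(path_shift ^^ n) \<omega> \<in> V" by auto
    have "(path_shift ^^ k) \<omega> \<notin> V" if "k \<noteq> n" for k
    proof (cases "k < n")
      case True
      have "(path_shift ^^ (n - k)) ((path_shift ^^ k) \<omega>) \<in> W" "n - k \<ge> 1"
        using n True by (auto simp: funpow_funpow_apply V_def)
      then show ?thesis unfolding V_def by blast
    next
      case False
      with that have "n < k" by simp
      then have "(path_shift ^^ (k - n)) ((path_shift ^^ n) \<omega>) = (path_shift ^^ k) \<omega>" "k - n \<ge> 1"
        by (auto simp: funpow_funpow_apply)
      then show ?thesis using n(2) unfolding V_def by force
    qed
    then have "(\<Sum>k<N. indicator V ((path_shift ^^ k) \<omega>)) = (\<Sum>k\<in>{n}. indicator V ((path_shift ^^ k) \<omega>) :: ennreal)"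
      using n by (intro sum.mono_neutral_right) (auto simp: indicator_def)
    also have "\<dots> = indicator V ((path_shift ^^ n) \<omega>)" by simp
    finally show ?thesis by (auto simp: indicator_def)
  qed (auto simp: indicator_def)
  have "AE x in \<mu>. emeasure (P x) V = 0"
  proof (rule AE_eq_0_if_potential_le_1)
    fix N
    show "AE x in \<mu>. (\<integral>\<^sup>+\<omega>. (\<Sum>n<N. emeasure (P (\<omega> n)) V) \<partial>P x) \<le> 1"
    proof (rule AE_I2)
      fix x assume "x \<in> space \<mu>"
      then have x: "x \<in> space X" by (simp add: space_\<mu>)
      have "(\<integral>\<^sup>+\<omega>. (\<Sum>n<N. emeasure (P (\<omega> n)) V) \<partial>P x) = (\<Sum>n<N. \<integral>\<^sup>+\<omega>. emeasure (P (\<omega> n)) V \<partial>P x)"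
        by (rule nn_integral_sum) (simp add: x, measurable)
      also have "\<dots> = (\<Sum>n<N. \<integral>\<^sup>+\<omega>. indicator V ((path_shift ^^ n) \<omega>) \<partial>P x)"
      proof (intro sum.cong refl)
        fix n
        have "(\<integral>\<^sup>+\<omega>. indicator V ((path_shift ^^ n) \<omega>) \<partial>P x) = (\<integral>\<^sup>+\<omega>. (\<integral>\<^sup>+\<omega>'. indicator V \<omega>' \<partial>P (\<omega> n)) \<partial>P x)"
          by (rule markov_property_shift[OF x]) measurable
        also have "\<dots> = (\<integral>\<^sup>+\<omega>. emeasure (P (\<omega> n)) V \<partial>P x)"
          by (intro nn_integral_cong_path[OF x] nn_integral_indicator) (simp add: sets_chain_law path_component)
        finally show "(\<integral>\<^sup>+\<omega>. emeasure (P (\<omega> n)) V \<partial>P x) = (\<integral>\<^sup>+\<omega>. indicator V ((path_shift ^^ n) \<omega>) \<partial>P x)" ..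
      qed
      also have "\<dots> = (\<integral>\<^sup>+\<omega>. (\<Sum>n<N. indicator V ((path_shift ^^ n) \<omega>)) \<partial>P x)"
        by (rule nn_integral_sum[symmetric]) (simp add: x)
      also have "\<dots> \<le> (\<integral>\<^sup>+\<omega>. 1 \<partial>P x)"
        by (intro nn_integral_mono) (simp add: once space_chain_law[OF x])
      also have "\<dots> = 1" using emeasure_chain_law_space[OF x] by (simp add: space_chain_law[OF x])
      finally show "(\<integral>\<^sup>+\<omega>. (\<Sum>n<N. emeasure (P (\<omega> n)) V) \<partial>P x) \<le> 1" .
    qed
  qed measurable
  then have "emeasure P\<mu> V = 0"
    by (simp add: emeasure_P\<mu> nn_integral_0_iff_AE)
  then have "V \<in> null_sets P\<mu>" by (simp add: null_sets_def sets_P\<mu>)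
  then show ?thesis
    by (rule AE_I') (auto simp: V_def space_P\<mu>)
qed

end

sublocale recurrent_chain \<subseteq> path: conservative_system "chain_law_init X K \<mu>" path_shift
proof -
  interpret sigma_finite_measure P\<mu> by (rule sigma_finite_P\<mu>)
  show "conservative_system P\<mu> path_shift"
  proof
    show "path_shift \<in> P\<mu> \<rightarrow>\<^sub>M P\<mu>" by measurable
    show "emeasure P\<mu> {\<omega> \<in> space P\<mu>. path_shift \<omega> \<in> B} = emeasure P\<mu> B" if "B \<in> sets P\<mu>" for B
      using emeasure_P\<mu>_shift[of B] that by (simp add: sets_P\<mu> space_P\<mu>)
    show "AE \<omega> in P\<mu>. \<omega> \<in> W \<longrightarrow> (\<exists>n\<ge>1. (path_shift ^^ n) \<omega> \<in> W)" if "W \<in> sets P\<mu>" for W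
      using P\<mu>_conservative[of W] that by (simp add: sets_P\<mu>)
  qed
qed

section \<open>Harmonic functions and ergodicity of the path shift\<close>

context recurrent_chain
begin

text \<open>
  The variance of \<open>f\<close> under \<open>K x\<close> is \<open>v x - \<integral>v \<partial>K x\<close> for \<open>v = 1 - f\<^sup>2\<close>, so its potential is at most \<open>v\<close>.
\<close>

lemma AE_harmonic_constant:
  fixes f :: "'a \<Rightarrow> real"
  assumes f[measurable]: "f \<in> borel_measurable X"
    and bounds: "\<And>x. x \<in> space X \<Longrightarrow> 0 \<le> f x \<and> f x \<le> 1"
    and harmonic: "AE x in \<mu>. f x = (\<integral>y. f y \<partial>K x)"
  shows "AE x in \<mu>. AE y in K x. f y = f x"
proof -
  \<comment> \<open>The constant 1 keeps \<open>v\<close> within the range from 0 to 1: it is a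
    legitimate \<open>ennreal\<close> function, and it supplies the bound demanded of the
    potential.\<close>
  define v where "v x = ennreal (1 - (f x)\<^sup>2)" for x
  define g where "g x = (\<integral>\<^sup>+y. ennreal ((f y - f x)\<^sup>2) \<partial>K x)" for x
  have [measurable]: "v \<in> borel_measurable X" unfolding v_def by measurable
  have [measurable]: "g \<in> borel_measurable X"
    unfolding g_def by (rule nn_integral_measurable_subprob_algebra2[OF _ measurable_kernel]) measurable
  have sq_le: "(f x)\<^sup>2 \<le> 1" if "x \<in> space X" for x
    using bounds[OF that] by (simp add: power_le_one)
  have vg: "AE x in \<mu>. g x + (\<integral>\<^sup>+y. v y \<partial>K x) = v x"
    using harmonic AE_space
  proof eventually_elim
    fix x assume fx: "f x = (\<integral>y. f y \<partial>K x)" and "x \<in> space \<mu>"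
    then have x: "x \<in> space X" by (simp add: space_\<mu>)
    interpret Kx: prob_space "K x" by (rule prob_space_kernel[OF x])
    have int: "integrable (K x) f"
      by (rule Kx.integrable_const_bound[of _ 1]) (use bounds in \<open>auto simp: x space_kernel\<close>)
    have int2: "integrable (K x) (\<lambda>y. (f y)\<^sup>2)"
      by (rule Kx.integrable_const_bound[of _ 1]) (use sq_le in \<open>auto simp: x space_kernel\<close>)
    have sq: "(f y - f x)\<^sup>2 = (f y)\<^sup>2 - 2 * f x * f y + (f x)\<^sup>2" for y
      by (simp add: power2_eq_square algebra_simps)
    have int3: "integrable (K x) (\<lambda>y. (f y - f x)\<^sup>2)"
      unfolding sq using int int2 by auto
    have "(\<integral>y. (f y - f x)\<^sup>2 \<partial>K x) = (\<integral>y. (f y)\<^sup>2 \<partial>K x) - (f x)\<^sup>2"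
    proof -
      have "(\<integral>y. (f y - f x)\<^sup>2 \<partial>K x) = (\<integral>y. (f y)\<^sup>2 \<partial>K x) - 2 * f x * (\<integral>y. f y \<partial>K x) + (f x)\<^sup>2"
        unfolding sq using int int2 Kx.prob_space by simp
      then show ?thesis using fx by (simp add: power2_eq_square)
    qed
    moreover have "(\<integral>y. 1 - (f y)\<^sup>2 \<partial>K x) = 1 - (\<integral>y. (f y)\<^sup>2 \<partial>K x)"
      using int2 Kx.prob_space by simp
    moreover have "g x = ennreal (\<integral>y. (f y - f x)\<^sup>2 \<partial>K x)"
      unfolding g_def by (rule nn_integral_eq_integral[OF int3]) simp
    moreover have "(\<integral>\<^sup>+y. v y \<partial>K x) = ennreal (\<integral>y. 1 - (f y)\<^sup>2 \<partial>K x)"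
      unfolding v_def
      by (rule nn_integral_eq_integral) (use int2 sq_le in \<open>auto simp: space_kernel[OF x]\<close>)
    moreover have "0 \<le> (\<integral>y. (f y - f x)\<^sup>2 \<partial>K x)" "0 \<le> (\<integral>y. 1 - (f y)\<^sup>2 \<partial>K x)"
      using sq_le by (auto intro!: integral_nonneg_AE simp: space_kernel[OF x])
    ultimately show "g x + (\<integral>\<^sup>+y. v y \<partial>K x) = v x"
      unfolding v_def by (simp add: ennreal_plus[symmetric] del: ennreal_plus)
  qed
  have potential: "AE x in \<mu>. (\<integral>\<^sup>+\<omega>. (\<Sum>n<N. g (\<omega> n)) \<partial>P x) \<le> v x" for N
  proof (induction N)
    case (Suc N)
    \<comment> \<open>The induction hypothesis holds only almost everywhere;
      \<open>AE_kernel\<close> makes it available at the state reached after one step. The bound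
      then becomes \<open>g x\<close> plus the integral of \<open>v\<close>, which is
      \<open>v x\<close>.\<close>
    from AE_kernel[OF Suc.IH] vg AE_space show ?case
    proof eventually_elim
      fix x assume IH: "AE y in K x. (\<integral>\<^sup>+\<omega>. (\<Sum>n<N. g (\<omega> n)) \<partial>P y) \<le> v y"
        and v: "g x + (\<integral>\<^sup>+y. v y \<partial>K x) = v x" and "x \<in> space \<mu>"
      then have x: "x \<in> space X" by (simp add: space_\<mu>)
      have "(\<integral>\<^sup>+\<omega>. (\<Sum>n<Suc N. g (\<omega> n)) \<partial>P x) =
          (\<integral>\<^sup>+\<omega>. g (\<omega> 0) \<partial>P x) + (\<integral>\<^sup>+\<omega>. (\<Sum>n<N. g (\<omega> (Suc n))) \<partial>P x)"
        unfolding sum.lessThan_Suc_shift by (rule nn_integral_add) (auto simp: x)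
      also have "(\<integral>\<^sup>+\<omega>. g (\<omega> 0) \<partial>P x) = g x"
        by (rule nn_integral_chain_law_0[OF x]) measurable
      also have "(\<integral>\<^sup>+\<omega>. (\<Sum>n<N. g (\<omega> (Suc n))) \<partial>P x) = (\<integral>\<^sup>+y. \<integral>\<^sup>+\<omega>. (\<Sum>n<N. g (\<omega> n)) \<partial>P y \<partial>K x)"
        by (subst chain_law_first_step[OF x]) auto
      also have "\<dots> \<le> (\<integral>\<^sup>+y. v y \<partial>K x)"
        by (rule nn_integral_mono_AE[OF IH])
      finally show "(\<integral>\<^sup>+\<omega>. (\<Sum>n<Suc N. g (\<omega> n)) \<partial>P x) \<le> v x" using v by (simp add: add_left_mono)
    qed
  qed simp
  have "AE x in \<mu>. g x = 0"
  proof (rule AE_eq_0_if_potential_le_1)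
    fix N
    show "AE x in \<mu>. (\<integral>\<^sup>+\<omega>. (\<Sum>n<N. g (\<omega> n)) \<partial>P x) \<le> 1"
      using potential[of N]
    proof eventually_elim
      fix x assume "(\<integral>\<^sup>+\<omega>. (\<Sum>n<N. g (\<omega> n)) \<partial>P x) \<le> v x"
      also have "v x \<le> 1" by (simp add: v_def)
      finally show "(\<integral>\<^sup>+\<omega>. (\<Sum>n<N. g (\<omega> n)) \<partial>P x) \<le> 1" .
    qed
  qed measurable
  then show ?thesis
    using AE_space
  proof eventually_elim
    fix x assume g: "g x = 0" and "x \<in> space \<mu>"
    then have x: "x \<in> space X" by (simp add: space_\<mu>)
    have "AE y in K x. ennreal ((f y - f x)\<^sup>2) = 0"
      using g unfolding g_def by (subst (asm) nn_integral_0_iff_AE) (auto simp: x)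
    then show "AE y in K x. f y = f x" by eventually_elim simp
  qed
qed

text \<open>Since \<open>f\<close> does not change along a step, each set where \<open>f\<close> is
  at most \<open>q\<close>, and its complement, are left with probability 0. Irreducibility makes
  one of them null, so \<open>f\<close> equals its essential supremum.\<close>

lemma irreducible_AE_constant:
  fixes f :: "'a \<Rightarrow> real"
  assumes irr: "irreducible_measure X K \<mu>" and f[measurable]: "f \<in> borel_measurable X"
    and bounds: "\<And>x. x \<in> space X \<Longrightarrow> 0 \<le> f x \<and> f x \<le> 1"
    and const: "AE x in \<mu>. AE y in K x. f y = f x"
    and nontrivial: "emeasure \<mu> (space \<mu>) \<noteq> 0"
  shows "\<exists>c. AE x in \<mu>. f x = c"
proof -
  have dichotomy: "(AE x in \<mu>. f x > q) \<or> (AE x in \<mu>. f x \<le> q)" for q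
  proof -
    let ?B = "{x \<in> space X. f x \<le> q}"
    have "AE x in \<mu>. emeasure (K x) ?B = indicator ?B x"
      using const AE_space
    proof eventually_elim
      fix x assume c: "AE y in K x. f y = f x" and "x \<in> space \<mu>"
      then have x: "x \<in> space X" by (simp add: space_\<mu>)
      interpret Kx: prob_space "K x" by (rule prob_space_kernel[OF x])
      show "emeasure (K x) ?B = indicator ?B x"
      proof (cases "f x \<le> q")
        case True
        have "emeasure (K x) ?B = emeasure (K x) (space (K x))"
          by (rule emeasure_eq_AE) (use c True in \<open>auto simp: x space_kernel sets_kernel'\<close>)
        then show ?thesis using True x Kx.emeasure_space_1 by simp
      next
        case False
        have "emeasure (K x) ?B = emeasure (K x) {}"
          by (rule emeasure_eq_AE) (use c False in \<open>auto simp: x space_kernel sets_kernel'\<close>)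
        then show ?thesis using False by simp
      qed
    qed
    then have "emeasure \<mu> ?B = 0 \<or> emeasure \<mu> (space X - ?B) = 0"
      using irr by (simp add: irreducible_measure_def)
    then show ?thesis
    proof
      assume "emeasure \<mu> ?B = 0"
      then have "AE x in \<mu>. x \<notin> ?B" by (intro AE_not_in) (simp add: null_sets_def sets_\<mu>)
      then show ?thesis using AE_space by (auto simp: space_\<mu> intro!: disjI1 elim!: eventually_elim2)
    next
      assume "emeasure \<mu> (space X - ?B) = 0"
      then have "AE x in \<mu>. x \<notin> space X - ?B" by (intro AE_not_in) (simp add: null_sets_def sets_\<mu>)
      then show ?thesis using AE_space by (auto simp: space_\<mu> intro!: disjI2 elim!: eventually_elim2)
    qed
  qed
  have False_if: "\<not> (AE x in \<mu>. False)"
    using nontrivial by (auto simp: AE_iff_null null_sets_def)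
  \<comment> \<open>\<open>Inf D\<close> is the essential supremum of \<open>f\<close>.
    Nontriviality of \<mu> bounds \<open>D\<close> from below, since otherwise every real number
    would lie in it.\<close>
  define D where "D = {q. AE x in \<mu>. f x \<le> q}"
  have "1 \<in> D" unfolding D_def using bounds by (auto simp: space_\<mu> intro!: AE_I2)
  have lower: "0 \<le> q" if "q \<in> D" for q
  proof (rule ccontr)
    assume "\<not> 0 \<le> q"
    have "AE x in \<mu>. f x \<le> q" using that by (simp add: D_def)
    then have "AE x in \<mu>. False"
      using AE_space
    proof eventually_elim
      fix x assume "f x \<le> q" "x \<in> space \<mu>"
      then show False using bounds[of x] \<open>\<not> 0 \<le> q\<close> by (auto simp: space_\<mu>)
    qed
    then show False using False_if by simp
  qed
  have bdd: "bdd_below D" by (rule bdd_belowI[OF lower])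
  have up: "AE x in \<mu>. f x \<le> Inf D + inverse (real (Suc n))" for n
  proof -
    have "Inf D < Inf D + inverse (real (Suc n))" by simp
    then obtain q where "q \<in> D" "q < Inf D + inverse (real (Suc n))"
      using cInf_lessD[of D] \<open>1 \<in> D\<close> by blast
    then have "AE x in \<mu>. f x \<le> q" by (simp add: D_def)
    then show ?thesis by eventually_elim (use \<open>q < _\<close> in simp)
  qed
  have down: "AE x in \<mu>. Inf D - inverse (real (Suc n)) < f x" for n
  proof -
    have "Inf D - inverse (real (Suc n)) \<notin> D"
    proof
      assume "Inf D - inverse (real (Suc n)) \<in> D"
      from cInf_lower[OF this bdd] show False by simp
    qed
    then show ?thesis using dichotomy by (auto simp: D_def)
  qed
  have "AE x in \<mu>. \<forall>n. f x \<le> Inf D + inverse (real (Suc n)) \<and> Inf D - inverse (real (Suc n)) < f x"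
    unfolding AE_all_countable using up down by auto
  then have "AE x in \<mu>. f x = Inf D"
  proof eventually_elim
    fix x assume *: "\<forall>n. f x \<le> Inf D + inverse (real (Suc n)) \<and> Inf D - inverse (real (Suc n)) < f x"
    show "f x = Inf D"
    proof (rule ccontr)
      assume "f x \<noteq> Inf D"
      then have "0 < \<bar>f x - Inf D\<bar>" by simp
      then obtain n where "inverse (real (Suc n)) < \<bar>f x - Inf D\<bar>" using reals_Archimedean by blast
      then show False using *[rule_format, of n] by (auto simp: abs_if split: if_splits)
    qed
  qed
  then show ?thesis by blast
qed

lemma measurable_measure_chain_law:
  assumes S: "S \<in> sets \<Omega>"
  shows "(\<lambda>x. measure (P x) S) \<in> borel_measurable X"
  using measurable_compose[OF measurable_chain_law measurable_measure_subprob_algebra[OF S]] .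

lemma emeasure_eq_measure_chain_law: "x \<in> space X \<Longrightarrow> emeasure (P x) S = ennreal (measure (P x) S)"
  using prob_space_chain_law by (simp add: finite_measure.emeasure_eq_measure prob_space_def)

lemma measure_chain_law_bounds: "x \<in> space X \<Longrightarrow> 0 \<le> measure (P x) S \<and> measure (P x) S \<le> 1"
  using prob_space.prob_le_1[OF prob_space_chain_law] by simp

text \<open>Invariance of \<open>S\<close> together with the Markov property at time 1 makes its
  probability a harmonic function of the starting state.\<close>

lemma AE_invariant_event_constant:
  assumes S[measurable]: "S \<in> sets \<Omega>"
    and inv: "AE \<omega> in P\<mu>. path_shift \<omega> \<in> S \<longleftrightarrow> \<omega> \<in> S"
  shows "AE x in \<mu>. AE y in K x. measure (P y) S = measure (P x) S"
proof (rule AE_harmonic_constant[OF measurable_measure_chain_law[OF S] measure_chain_law_bounds])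
  let ?f = "\<lambda>x. measure (P x) S"
  note f[measurable] = measurable_measure_chain_law[OF S]
  note em = emeasure_eq_measure_chain_law[of _ S] and bounds = measure_chain_law_bounds[of _ S]
  have "AE x in \<mu>. AE \<omega> in P x. path_shift \<omega> \<in> S \<longleftrightarrow> \<omega> \<in> S"
    using inv by (subst (asm) AE_P\<mu>) measurable
  then show "AE x in \<mu>. ?f x = (\<integral>y. ?f y \<partial>K x)"
    using AE_space
  proof eventually_elim
    fix x assume i: "AE \<omega> in P x. path_shift \<omega> \<in> S \<longleftrightarrow> \<omega> \<in> S" and "x \<in> space \<mu>"
    then have x: "x \<in> space X" by (simp add: space_\<mu>)
    interpret Kx: prob_space "K x" by (rule prob_space_kernel[OF x])
    have "emeasure (P x) S = (\<integral>\<^sup>+\<omega>. indicator S \<omega> \<partial>P x)"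
      by (rule nn_integral_indicator[symmetric]) (simp add: sets_chain_law x)
    also have "\<dots> = (\<integral>\<^sup>+\<omega>. indicator S (path_shift \<omega>) \<partial>P x)"
      by (rule nn_integral_cong_AE) (use i in eventually_elim, simp add: indicator_def)
    also have "\<dots> = (\<integral>\<^sup>+y. \<integral>\<^sup>+\<omega>. indicator S \<omega> \<partial>P y \<partial>K x)"
      by (subst chain_law_first_step[OF x]) auto
    also have "\<dots> = (\<integral>\<^sup>+y. ennreal (?f y) \<partial>K x)"
      by (rule nn_integral_cong_kernel[OF x]) (simp add: sets_chain_law em[symmetric])
    also have "\<dots> = ennreal (\<integral>y. ?f y \<partial>K x)"
      by (rule nn_integral_eq_integral, rule Kx.integrable_const_bound[of _ 1])
        (use bounds in \<open>auto simp: x space_kernel\<close>)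
    finally have "ennreal (?f x) = ennreal (\<integral>y. ?f y \<partial>K x)" by (simp add: em[OF x])
    moreover have "0 \<le> (\<integral>y. ?f y \<partial>K x)"
      using bounds by (auto simp: space_kernel[OF x] intro!: integral_nonneg_AE)
    ultimately show "?f x = (\<integral>y. ?f y \<partial>K x)" using bounds[OF x] by simp
  qed
qed

text \<open>
  An invariant event has a constant conditional probability \<open>c\<close> given any finite part of the
  path; it is therefore independent of itself, and \<open>c = c\<^sup>2\<close>.
\<close>

lemma irreducible_shift_ergodic:
  assumes irr: "irreducible_measure X K \<mu>" and S[measurable]: "S \<in> sets \<Omega>"
    and inv: "AE \<omega> in P\<mu>. path_shift \<omega> \<in> S \<longleftrightarrow> \<omega> \<in> S"
  shows "(AE \<omega> in P\<mu>. \<omega> \<in> S) \<or> (AE \<omega> in P\<mu>. \<omega> \<notin> S)"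
proof (cases "emeasure \<mu> (space \<mu>) = 0")
  \<comment> \<open>Treated apart because a starting point outside all exceptional null sets is
    chosen below, which a zero measure does not provide.\<close>
  case True
  then have "AE x in \<mu>. False" by (auto simp: AE_iff_null null_sets_def)
  then have "AE x in \<mu>. AE \<omega> in P x. \<omega> \<in> S" by eventually_elim simp
  then show ?thesis by (subst AE_P\<mu>) auto
next
  case nontrivial: False
  define f where "f x = measure (P x) S" for x
  have f[measurable]: "f \<in> borel_measurable X"
    unfolding f_def by (rule measurable_measure_chain_law[OF S])
  have em: "emeasure (P x) S = ennreal (f x)" if "x \<in> space X" for x
    unfolding f_def by (rule emeasure_eq_measure_chain_law[OF that])
  have bounds: "0 \<le> f x \<and> f x \<le> 1" if "x \<in> space X" for x
    unfolding f_def by (rule measure_chain_law_bounds[OF that])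
  obtain c where c: "AE x in \<mu>. f x = c"
    using irreducible_AE_constant[OF irr f bounds _ nontrivial] AE_invariant_event_constant[OF S inv]
    unfolding f_def by blast
  have "AE \<omega> in P\<mu>. f (\<omega> 0) = c"
  proof (subst AE_P\<mu>)
    show "AE x in \<mu>. AE \<omega> in P x. f (\<omega> 0) = c"
      using c AE_space
    proof eventually_elim
      fix x assume fx: "f x = c" and "x \<in> space \<mu>"
      then have x: "x \<in> space X" by (simp add: space_\<mu>)
      show "AE \<omega> in P x. f (\<omega> 0) = c"
        by (rule AE_chain_law_start[OF x]) (use fx in auto)
    qed
  qed measurable
  then have "AE \<omega> in P\<mu>. f ((path_shift ^^ n) \<omega> 0) = c" for n
    by (rule AE_P\<mu>_shift_funpow)
  then have fc: "AE \<omega> in P\<mu>. \<forall>n. f (\<omega> n) = c"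
    by (subst AE_all_countable) (simp add: path_shift_funpow)
  have "AE \<omega> in P\<mu>. \<forall>n. path_shift ((path_shift ^^ n) \<omega>) \<in> S \<longleftrightarrow> (path_shift ^^ n) \<omega> \<in> S"
    unfolding AE_all_countable using AE_P\<mu>_shift_funpow[OF inv] by blast
  then have "AE \<omega> in P\<mu>. \<forall>n. (path_shift ^^ n) \<omega> \<in> S \<longleftrightarrow> \<omega> \<in> S"
  proof eventually_elim
    fix \<omega> :: "nat \<Rightarrow> 'a"
    assume *: "\<forall>n. path_shift ((path_shift ^^ n) \<omega>) \<in> S \<longleftrightarrow> (path_shift ^^ n) \<omega> \<in> S"
    have "(path_shift ^^ n) \<omega> \<in> S \<longleftrightarrow> \<omega> \<in> S" for n
      by (induction n) (use * in auto)
    then show "\<forall>n. (path_shift ^^ n) \<omega> \<in> S \<longleftrightarrow> \<omega> \<in> S" by simp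
  qed
  with fc have "AE \<omega> in P\<mu>. \<forall>n. f (\<omega> n) = c \<and> ((path_shift ^^ n) \<omega> \<in> S \<longleftrightarrow> \<omega> \<in> S)"
    by eventually_elim auto
  then have "AE x in \<mu>. AE \<omega> in P x. \<forall>n. f (\<omega> n) = c \<and> ((path_shift ^^ n) \<omega> \<in> S \<longleftrightarrow> \<omega> \<in> S)"
    by (subst (asm) AE_P\<mu>) measurable
  with c AE_space have good: "AE x in \<mu>. x \<in> space X \<and> f x = c \<and>
      (AE \<omega> in P x. \<forall>n. f (\<omega> n) = c \<and> ((path_shift ^^ n) \<omega> \<in> S \<longleftrightarrow> \<omega> \<in> S))"
    by eventually_elim (simp add: space_\<mu>)
  \<comment> \<open>A single good state \<open>x\<close> suffices to determine \<open>c\<close>; the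
    rest of the argument takes place under the probability \<open>P x\<close>.\<close>
  have "ae_filter \<mu> \<noteq> bot"
    using nontrivial by (auto simp: ae_filter_eq_bot_iff)
  with eventually_happens[OF good] obtain x where x: "x \<in> space X" and fx: "f x = c"
    and AE_x: "AE \<omega> in P x. \<forall>n. f (\<omega> n) = c \<and> ((path_shift ^^ n) \<omega> \<in> S \<longleftrightarrow> \<omega> \<in> S)"
    by blast
  have c01: "0 \<le> c" "c \<le> 1" using bounds[OF x] fx by auto
  have "density (P x) (indicator S) = scale_measure (ennreal c) (P x)"
  proof (rule path_measure_eqI[where X=X])
    show "finite_measure (density (P x) (indicator S))"
    proof
      have "emeasure (density (P x) (indicator S)) (space \<Omega>) =
          (\<integral>\<^sup>+\<omega>. indicator S \<omega> * indicator (space \<Omega>) \<omega> \<partial>P x)"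
        by (rule emeasure_density) (auto simp: x sets_chain_law)
      also have "\<dots> = (\<integral>\<^sup>+\<omega>. indicator S \<omega> \<partial>P x)"
        by (rule nn_integral_cong_path[OF x]) simp
      also have "\<dots> = ennreal (f x)" using em[OF x] by (simp add: sets_chain_law x)
      finally show "emeasure (density (P x) (indicator S)) (space (density (P x) (indicator S))) \<noteq> \<infinity>"
        by (simp add: space_chain_law x)
    qed
    fix n and B :: "nat \<Rightarrow> 'a set" assume B: "\<And>i. B i \<in> sets X"
    have cyl[measurable]: "cylinder X n B \<in> sets \<Omega>" using B by auto
    have "emeasure (density (P x) (indicator S)) (cylinder X n B) =
        (\<integral>\<^sup>+\<omega>. indicator S \<omega> * indicator (cylinder X n B) \<omega> \<partial>P x)"
      by (rule emeasure_density) (auto simp: x sets_chain_law)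
    \<comment> \<open>Invariance moves \<open>S\<close> beyond time \<open>n\<close>, where the
      Markov property replaces it by its probability from the state \<open>\<omega> n\<close>, which
      is \<open>c\<close>.\<close>
    also have "\<dots> = (\<integral>\<^sup>+\<omega>. indicator (cylinder X n B) \<omega> * indicator S ((path_shift ^^ n) \<omega>) \<partial>P x)"
      by (rule nn_integral_cong_AE) (use AE_x in eventually_elim, auto simp: indicator_def)
    also have "\<dots> = (\<integral>\<^sup>+\<omega>. indicator (cylinder X n B) \<omega> * (\<integral>\<^sup>+\<omega>'. indicator S \<omega>' \<partial>P (\<omega> n)) \<partial>P x)"
      by (rule markov_property[OF x _ B]) measurable
    also have "\<dots> = (\<integral>\<^sup>+\<omega>. ennreal c * indicator (cylinder X n B) \<omega> \<partial>P x)"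
    proof (rule nn_integral_cong_AE)
      show "AE \<omega> in P x. indicator (cylinder X n B) \<omega> * (\<integral>\<^sup>+\<omega>'. indicator S \<omega>' \<partial>P (\<omega> n)) =
          ennreal c * indicator (cylinder X n B) \<omega>"
        using AE_x AE_space
        by eventually_elim (simp add: space_chain_law[OF x] sets_chain_law path_component em mult.commute)
    qed
    also have "\<dots> = ennreal c * emeasure (P x) (cylinder X n B)"
      by (simp add: nn_integral_cmult x sets_chain_law)
    finally show "emeasure (density (P x) (indicator S)) (cylinder X n B) =
        emeasure (scale_measure (ennreal c) (P x)) (cylinder X n B)" by simp
  qed (simp_all add: sets_chain_law x)
  \<comment> \<open>Independence of \<open>S\<close> from all cylinders extends to \<open>S\<close>
    itself.\<close>
  then have "emeasure (density (P x) (indicator S)) S = ennreal c * emeasure (P x) S"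
    by simp
  moreover have "emeasure (density (P x) (indicator S)) S = emeasure (P x) S"
    by (subst emeasure_density) (auto simp: x sets_chain_law indicator_inter_arith[symmetric])
  ultimately have "ennreal c = ennreal (c * c)"
    using em[OF x] fx c01 by (simp add: ennreal_mult)
  then have "c = 0 \<or> c = 1" using c01 by simp
  then show ?thesis
  proof
    assume "c = 0"
    have "AE x in \<mu>. AE \<omega> in P x. \<omega> \<notin> S"
      using c AE_space
    proof eventually_elim
      fix y assume "f y = c" "y \<in> space \<mu>"
      then have "emeasure (P y) S = 0" using em[of y] \<open>c = 0\<close> by (simp add: space_\<mu>)
      then show "AE \<omega> in P y. \<omega> \<notin> S"
        using \<open>y \<in> space \<mu>\<close> by (intro AE_not_in) (simp add: null_sets_def sets_chain_law space_\<mu>)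
    qed
    then show ?thesis by (intro disjI2, subst AE_P\<mu>) auto
  next
    assume "c = 1"
    have "AE x in \<mu>. AE \<omega> in P x. \<omega> \<in> S"
      using c AE_space
    proof eventually_elim
      fix y assume fy: "f y = c" and "y \<in> space \<mu>"
      then have y: "y \<in> space X" by (simp add: space_\<mu>)
      interpret prob_space "P y" by (rule prob_space_chain_law[OF y])
      show "AE \<omega> in P y. \<omega> \<in> S"
        using fy \<open>c = 1\<close> by (subst AE_in_set_eq_1) (auto simp: f_def sets_chain_law y)
    qed
    then show ?thesis by (intro disjI1, subst AE_P\<mu>) auto
  qed
qed

end

section \<open>Crossings\<close>

text \<open>A crossing is dated by its exit, one step before the entrance: a first crossing at time
  \<open>n\<close> means a first entrance at \<open>n + 1\<close>. Both chains can then be read from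
  the same event, at coordinates 0 and 1.\<close>

definition crossing :: "'a set \<Rightarrow> (nat \<Rightarrow> 'a) \<Rightarrow> bool" where
  "crossing A \<omega> \<longleftrightarrow> \<omega> 0 \<notin> A \<and> \<omega> 1 \<in> A"

definition crosses :: "'a set \<Rightarrow> (nat \<Rightarrow> 'a) \<Rightarrow> bool" where
  "crosses A \<omega> \<longleftrightarrow> (\<exists>n. crossing A ((path_shift ^^ n) \<omega>))"

text \<open>On paths without a crossing the value is unspecified, so its uses are guarded by
  \<open>crosses\<close>.\<close>

definition first_crossing :: "'a set \<Rightarrow> (nat \<Rightarrow> 'a) \<Rightarrow> nat" where
  "first_crossing A \<omega> = (LEAST n. crossing A ((path_shift ^^ n) \<omega>))"

text \<open>
  The positions at offset \<open>i\<close> from the successive crossings: the entrance chain for \<open>i = 1\<close>, the exit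
  chain for \<open>i = 0\<close>, both without their initial term.
\<close>

primrec crossing_seq :: "'a set \<Rightarrow> nat \<Rightarrow> nat \<Rightarrow> (nat \<Rightarrow> 'a) \<Rightarrow> 'a option" where
  "crossing_seq A i 0 \<omega> =
    (if crosses A \<omega> then Some ((path_shift ^^ first_crossing A \<omega>) \<omega> i) else None)"
| "crossing_seq A i (Suc n) \<omega> =
    (if crosses A \<omega> then crossing_seq A i n ((path_shift ^^ Suc (first_crossing A \<omega>)) \<omega>) else None)"

definition crossings :: "'a set \<Rightarrow> nat \<Rightarrow> (nat \<Rightarrow> 'a) \<Rightarrow> nat \<Rightarrow> 'a option" where
  "crossings A i \<omega> = (\<lambda>n. crossing_seq A i n \<omega>)"

lemma crossing_first_crossing:
  "crosses A \<omega> \<Longrightarrow> crossing A ((path_shift ^^ first_crossing A \<omega>) \<omega>)"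
  unfolding crosses_def first_crossing_def by (rule LeastI_ex)

lemma not_crossing_before: "n < first_crossing A \<omega> \<Longrightarrow> \<not> crossing A ((path_shift ^^ n) \<omega>)"
  unfolding first_crossing_def by (rule not_less_Least)

lemma first_crossing_eqI:
  assumes "\<And>k. k < n \<Longrightarrow> \<not> crossing A ((path_shift ^^ k) \<omega>)" "crossing A ((path_shift ^^ n) \<omega>)"
  shows "first_crossing A \<omega> = n"
  unfolding first_crossing_def by (rule Least_equality) (use assms not_less in auto)

lemma crosses_if_crossing: "crossing A \<omega> \<Longrightarrow> crosses A \<omega>"
  unfolding crosses_def by (rule exI[of _ 0]) simp

lemma first_crossing_0: "crossing A \<omega> \<Longrightarrow> first_crossing A \<omega> = 0"
  by (rule first_crossing_eqI) auto

lemma crosses_shift: "\<not> crossing A \<omega> \<Longrightarrow> crosses A (path_shift \<omega>) \<longleftrightarrow> crosses A \<omega>"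
  unfolding crosses_def funpow_Suc_apply[symmetric] by (metis funpow_0 not0_implies_Suc)

lemma first_crossing_shift:
  assumes "\<not> crossing A \<omega>" "crosses A \<omega>"
  shows "first_crossing A \<omega> = Suc (first_crossing A (path_shift \<omega>))"
proof (rule first_crossing_eqI)
  have c: "crosses A (path_shift \<omega>)" using assms crosses_shift by blast
  show "crossing A ((path_shift ^^ Suc (first_crossing A (path_shift \<omega>))) \<omega>)"
    unfolding funpow_Suc_apply by (rule crossing_first_crossing[OF c])
  fix k assume k: "k < Suc (first_crossing A (path_shift \<omega>))"
  show "\<not> crossing A ((path_shift ^^ k) \<omega>)"
  proof (cases k)
    case (Suc j)
    then show ?thesis using k not_crossing_before[of j A "path_shift \<omega>"]
      by (simp add: funpow_Suc_apply del: funpow.simps)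
  qed (simp add: assms)
qed

lemma crossings_crosses:
  "crosses A \<omega> \<Longrightarrow> crossings A i \<omega> =
    case_nat (Some ((path_shift ^^ first_crossing A \<omega>) \<omega> i))
      (crossings A i (path_shift ((path_shift ^^ first_crossing A \<omega>) \<omega>)))"
  by (auto simp: crossings_def fun_eq_iff split: nat.split)

lemma crossings_not_crosses: "\<not> crosses A \<omega> \<Longrightarrow> crossings A i \<omega> = (\<lambda>_. None)"
proof -
  assume "\<not> crosses A \<omega>"
  then have "crossing_seq A i n \<omega> = None" for n by (cases n) auto
  then show ?thesis by (auto simp: crossings_def)
qed

lemma crossings_crossing:
  "crossing A \<omega> \<Longrightarrow> crossings A i \<omega> = case_nat (Some (\<omega> i)) (crossings A i (path_shift \<omega>))"
  using crossings_crosses[OF crosses_if_crossing, of A \<omega> i] by (simp add: first_crossing_0)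

text \<open>With \<open>crossings_crossing\<close>: a shift of the path advances the sequence of
  marks by one at a crossing and leaves it unchanged elsewhere. Events about the marks are therefore
  compatible with the shift on paths.\<close>

lemma crossings_not_crossing:
  assumes "\<not> crossing A \<omega>" shows "crossings A i (path_shift \<omega>) = crossings A i \<omega>"
proof (cases "crosses A \<omega>")
  case True
  then show ?thesis
    using crosses_shift[OF assms] first_crossing_shift[OF assms]
    by (simp add: crossings_crosses funpow_Suc_apply del: funpow.simps)
next
  case False
  then show ?thesis using crosses_shift[OF assms] by (simp add: crossings_not_crosses)
qed

text \<open>Recurrence of the embedded chain asks only that a mark reappears, so no count of the
  earlier crossings is kept.\<close>

lemma crossing_in_crossings:
  assumes "crossing A ((path_shift ^^ n) \<omega>)"
  shows "\<exists>k. crossings A i \<omega> k = Some ((path_shift ^^ n) \<omega> i)"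
  using assms
proof (induction n arbitrary: \<omega>)
  case 0
  then show ?case by (auto simp: crossings_crossing intro!: exI[of _ 0])
next
  case (Suc n)
  from Suc.prems have "crossing A ((path_shift ^^ n) (path_shift \<omega>))"
    by (simp add: funpow_Suc_apply del: funpow.simps)
  from Suc.IH[OF this] obtain k where
    k: "crossings A i (path_shift \<omega>) k = Some ((path_shift ^^ Suc n) \<omega> i)"
    by (auto simp: funpow_Suc_apply simp del: funpow.simps)
  show ?case
  proof (cases "crossing A \<omega>")
    case True
    then show ?thesis using k by (intro exI[of _ "Suc k"]) (simp add: crossings_crossing)
  next
    case False
    then show ?thesis using k crossings_not_crossing[OF False, of i] by auto
  qed
qed

section \<open>Entrance times expressed through crossings\<close>

lemma Inf_enat_le_iff: "Inf {enat k | k. Q k} \<le> enat m \<longleftrightarrow> (\<exists>k\<le>m. Q k)"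
proof
  assume le: "Inf {enat k | k. Q k} \<le> enat m"
  then have "{enat k | k. Q k} \<noteq> {}" by (auto simp: Inf_enat_def split: if_splits)
  then have "Inf {enat k | k. Q k} \<in> {enat k | k. Q k}"
    by (auto simp: Inf_enat_def intro: LeastI)
  with le show "\<exists>k\<le>m. Q k" by auto
next
  assume "\<exists>k\<le>m. Q k"
  then obtain k where "k \<le> m" "Q k" by auto
  then have "Inf {enat k | k. Q k} \<le> enat k" by (auto intro: Inf_lower)
  with \<open>k \<le> m\<close> show "Inf {enat k | k. Q k} \<le> enat m" by (meson enat_ord_simps(1) order_trans)
qed

lemma enat_eqI: "(\<And>m. a \<le> enat m \<longleftrightarrow> b \<le> enat m) \<Longrightarrow> a = b"
  by (metis enat.exhaust enat_ord_simps(3) nle_le order_refl)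

lemma entr_time_Suc_le_iff: "entr_time A (Suc n) \<omega> \<le> enat m \<longleftrightarrow>
    (\<exists>k\<le>m. entr_time A n \<omega> < enat k \<and> crossing A ((path_shift ^^ (k - 1)) \<omega>))"
proof -
  \<comment> \<open>For \<open>k = 0\<close>, where \<open>k - 1\<close> would be truncated, the
    strict inequality fails and both sides are false.\<close>
  have *: "entr_time A n \<omega> < enat k \<and> \<omega> (k - 1) \<notin> A \<and> \<omega> k \<in> A \<longleftrightarrow>
      entr_time A n \<omega> < enat k \<and> crossing A ((path_shift ^^ (k - 1)) \<omega>)" for k
    by (cases k) (auto simp: crossing_def path_shift_funpow zero_enat_def[symmetric])
  show ?thesis unfolding entr_time.simps Inf_enat_le_iff * ..
qed

text \<open>The definition finds each entrance from the previous one; here the first entrance is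
  split off and the path restarts there, which is the recursion of \<open>crossing_seq\<close>.
  Times are compared through their finite upper bounds, so infinite times need no separate
  treatment.\<close>

lemma entr_time_Suc:
  "entr_time A (Suc n) \<omega> = (if crosses A \<omega>
    then enat (Suc (first_crossing A \<omega>)) + entr_time A n ((path_shift ^^ Suc (first_crossing A \<omega>)) \<omega>)
    else \<infinity>)"
proof (cases "crosses A \<omega>")
  case False
  have "\<not> entr_time A (Suc n) \<omega> \<le> enat m" for m
    using False unfolding entr_time_Suc_le_iff crosses_def by blast
  then show ?thesis using False by (metis enat.exhaust order_refl)
next
  case True
  let ?J = "first_crossing A \<omega>"
  let ?\<omega> = "(path_shift ^^ Suc ?J) \<omega>"
  \<comment> \<open>Positivity of \<open>k\<close> prevents truncation in \<open>k - 1\<close>. It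
    is at hand below because a strict bound below \<open>enat l\<close> excludes
    \<open>l = 0\<close>.\<close>
  have cr: "crossing A ((path_shift ^^ (Suc ?J + k - 1)) \<omega>) \<longleftrightarrow> crossing A ((path_shift ^^ (k - 1)) ?\<omega>)"
    if "0 < k" for k
    using that by (simp add: funpow_funpow_apply del: funpow.simps) 
  have less: "enat (Suc ?J) + t < enat k \<longleftrightarrow> (\<exists>l. k = Suc ?J + l \<and> t < enat l)" for k t
    by (cases t) (auto intro!: exI[of _ "k - Suc ?J"])
  have le: "enat (Suc ?J) + t \<le> enat m \<longleftrightarrow> Suc ?J \<le> m \<and> t \<le> enat (m - Suc ?J)" for t m
    by (cases t) auto
  have "entr_time A (Suc n) \<omega> = enat (Suc ?J) + entr_time A n ?\<omega>"
  proof (induction n)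
    case 0
    show ?case
    proof (rule enat_eqI)
      fix m
      have "entr_time A (Suc 0) \<omega> \<le> enat m \<longleftrightarrow> (\<exists>k. Suc k \<le> m \<and> crossing A ((path_shift ^^ k) \<omega>))"
        unfolding entr_time_Suc_le_iff
        by (auto simp: zero_enat_def gr0_conv_Suc)
      also have "\<dots> \<longleftrightarrow> Suc ?J \<le> m"
        using crossing_first_crossing[OF True] not_crossing_before[of _ A \<omega>]
        by (metis Suc_le_mono le_trans not_le)
      finally show "entr_time A (Suc 0) \<omega> \<le> enat m \<longleftrightarrow> enat (Suc ?J) + entr_time A 0 ?\<omega> \<le> enat m"
        by simp
    qed
  next
    case (Suc n)
    show ?case
    proof (rule enat_eqI)
      fix m
      have "entr_time A (Suc (Suc n)) \<omega> \<le> enat m \<longleftrightarrow> (\<exists>k\<le>m. enat (Suc ?J) + entr_time A n ?\<omega> < enat k \<and>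
          crossing A ((path_shift ^^ (k - 1)) \<omega>))"
        unfolding entr_time_Suc_le_iff[of A "Suc n"] Suc.IH ..
      also have "\<dots> \<longleftrightarrow> (\<exists>l. Suc ?J + l \<le> m \<and> entr_time A n ?\<omega> < enat l \<and>
          crossing A ((path_shift ^^ (Suc ?J + l - 1)) \<omega>))"
        unfolding less by blast
      also have "\<dots> \<longleftrightarrow> (\<exists>l. Suc ?J + l \<le> m \<and> entr_time A n ?\<omega> < enat l \<and>
          crossing A ((path_shift ^^ (l - 1)) ?\<omega>))"
        using cr by (metis gr_zeroI not_less_zero zero_enat_def)
      also have "\<dots> \<longleftrightarrow> Suc ?J \<le> m \<and> entr_time A (Suc n) ?\<omega> \<le> enat (m - Suc ?J)"
        unfolding entr_time_Suc_le_iff by (auto simp: le_diff_conv2 add.commute)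
      finally show "entr_time A (Suc (Suc n)) \<omega> \<le> enat m \<longleftrightarrow>
          enat (Suc ?J) + entr_time A (Suc n) ?\<omega> \<le> enat m"
        unfolding le .
    qed
  qed
  then show ?thesis using True by simp
qed

lemma path_at_shift: "path_at \<omega> (enat n + t) = path_at ((path_shift ^^ n) \<omega>) t"
  by (cases t) (auto simp: path_at_def path_shift_funpow)

text \<open>The index is shifted because term 0 of the chain is the initial state, which need not be
  an entrance; \<open>crossings\<close> lists genuine entrances only.\<close>

lemma entr_chain_Suc: "entr_chain A (Suc n) \<omega> = crossings A 1 \<omega> n"
proof (induction n arbitrary: \<omega>)
  case 0
  then show ?case
    unfolding crossings_def entr_chain_def entr_time_Suc
    by (auto simp: path_at_shift path_at_def path_shift_funpow crossing_seq.simps entr_time.simps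
        zero_enat_def simp del: funpow.simps)
next
  case (Suc n)
  have "entr_chain A (Suc (Suc n)) \<omega> = (if crosses A \<omega>
      then entr_chain A (Suc n) ((path_shift ^^ Suc (first_crossing A \<omega>)) \<omega>) else None)"
    unfolding entr_chain_def entr_time_Suc[of A "Suc n" \<omega>]
    by (auto simp: path_at_shift simp del: funpow.simps entr_time.simps) (simp add: path_at_def)
  then show ?case using Suc.IH by (simp add: crossings_def)
qed

lemma exit_chain_Suc: "exit_chain A (Suc n) \<omega> = crossings A 0 \<omega> n"
proof (induction n arbitrary: \<omega>)
  case 0
  then show ?case
    unfolding crossings_def exit_chain_def entr_time_Suc
    by (auto simp: path_at_def path_shift_funpow one_enat_def zero_enat_def simp del: funpow.simps)
next
  case (Suc n)
  \<comment> \<open>Subtracting 1 commutes with the restart only if the remaining time is positive,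
    which holds for every entrance time of positive index.\<close>
  have minus: "enat k + t - 1 = enat k + (t - 1)" if "1 \<le> t" for k t
    using that by (cases t) (auto simp: one_enat_def)
  have "enat (Suc 0) \<le> enat (Suc k) + t" for k t by (cases t) auto
  then have "1 \<le> entr_time A (Suc n) \<omega>" for \<omega>
    unfolding entr_time_Suc by (simp add: one_enat_def)
  then have "exit_chain A (Suc (Suc n)) \<omega> = (if crosses A \<omega>
      then exit_chain A (Suc n) ((path_shift ^^ Suc (first_crossing A \<omega>)) \<omega>) else None)"
    unfolding exit_chain_def entr_time_Suc[of A "Suc n" \<omega>]
    by (auto simp: minus path_at_shift simp del: funpow.simps entr_time.simps) (simp add: path_at_def)
  then show ?case using Suc.IH by (simp add: crossings_def)
qed

text \<open>Rewrites the range of summation in the occupation formula as the avoidance condition of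
  Kac's excursions.\<close>

lemma less_entr_time_1_iff:
  "enat k < entr_time A 1 \<omega> \<longleftrightarrow> (\<forall>j<k. \<not> crossing A ((path_shift ^^ j) \<omega>))"
proof (cases "crosses A \<omega>")
  case True
  have "enat k < entr_time A 1 \<omega> \<longleftrightarrow> k \<le> first_crossing A \<omega>"
    using True entr_time_Suc[of A 0 \<omega>] by (auto simp: zero_enat_def[symmetric])
  also have "\<dots> \<longleftrightarrow> (\<forall>j<k. \<not> crossing A ((path_shift ^^ j) \<omega>))"
    using crossing_first_crossing[OF True] not_crossing_before[of _ A \<omega>] by (meson leI order_less_le_trans)
  finally show ?thesis .
next
  case False
  then show ?thesis using entr_time_Suc[of A 0 \<omega>] by (auto simp: crosses_def)
qed

lemma measurable_crossing [measurable]: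
  assumes [measurable]: "A \<in> sets X"
  shows "Measurable.pred (path_space X) (crossing A)"
  unfolding crossing_def by measurable

lemma measurable_crossing_funpow [measurable]:
  assumes [measurable]: "A \<in> sets X"
  shows "Measurable.pred (path_space X) (\<lambda>\<omega>. crossing A ((path_shift ^^ n) \<omega>))"
  by measurable

lemma measurable_crosses [measurable]:
  assumes [measurable]: "A \<in> sets X"
  shows "Measurable.pred (path_space X) (crosses A)"
  unfolding crosses_def by measurable

lemma measurable_first_crossing [measurable]:
  assumes [measurable]: "A \<in> sets X"
  shows "first_crossing A \<in> path_space X \<rightarrow>\<^sub>M count_space UNIV"
  unfolding first_crossing_def by measurable

section \<open>Cemetery spaces and measurability of the sequence of marks\<close>

lemma space_cemetery: "space (cemetery_space M) = insert None (Some ` space M)"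
  unfolding cemetery_space_def by (rule space_measure_of) (auto dest: sets.sets_into_space)

lemma sets_cemetery: "sets (cemetery_space M) =
    sigma_sets (insert None (Some ` space M)) (insert {None} ((`) Some ` sets M))"
  unfolding cemetery_space_def by (rule sets_measure_of) (auto dest: sets.sets_into_space)

lemma cemetery_cong: "sets M = sets N \<Longrightarrow> cemetery_space M = cemetery_space N"
  unfolding cemetery_space_def using sets_eq_imp_space_eq[of M N] by simp

lemma measurable_Some [measurable]: "Some \<in> M \<rightarrow>\<^sub>M cemetery_space M"
proof (rule measurable_sigma_sets[OF sets_cemetery])
  show "insert {None} ((`) Some ` sets M) \<subseteq> Pow (insert None (Some ` space M))"
    by (auto dest: sets.sets_into_space)
  fix B assume "B \<in> insert {None} ((`) Some ` sets M)"
  then consider "B = {None}" | C where "C \<in> sets M" "B = Some ` C" by auto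
  then show "Some -` B \<inter> space M \<in> sets M"
  proof cases
    case 1
    then have "Some -` B \<inter> space M = {}" by auto
    then show ?thesis by simp
  next
    case 2
    then have "Some -` B \<inter> space M = C" using sets.sets_into_space by auto
    then show ?thesis using 2 by simp
  qed
qed auto

lemma measurable_cemetery:
  assumes f: "(\<lambda>x. f (Some x)) \<in> M \<rightarrow>\<^sub>M N" and None: "f None \<in> space N"
  shows "f \<in> cemetery_space M \<rightarrow>\<^sub>M N"
proof (rule measurableI)
  show "f z \<in> space N" if "z \<in> space (cemetery_space M)" for z
    using that None measurable_space[OF f] by (auto simp: space_cemetery)
  fix B assume B: "B \<in> sets N"
  have "f -` B \<inter> space (cemetery_space M) =
      Some ` ((\<lambda>x. f (Some x)) -` B \<inter> space M) \<union> (if f None \<in> B then {None} else {})"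
    by (auto simp: space_cemetery)
  also have "\<dots> \<in> sets (cemetery_space M)"
  proof (rule sets.Un)
    show "Some ` ((\<lambda>x. f (Some x)) -` B \<inter> space M) \<in> sets (cemetery_space M)"
      unfolding sets_cemetery using measurable_sets[OF f B] by (intro sigma_sets.Basic) blast
    have "{None} \<in> sets (cemetery_space M)"
      unfolding sets_cemetery by (intro sigma_sets.Basic) blast
    then show "(if f None \<in> B then {None} else {}) \<in> sets (cemetery_space M)" by simp
  qed
  finally show "f -` B \<inter> space (cemetery_space M) \<in> sets (cemetery_space M)" .
qed

lemma measurable_cemetery_If:
  assumes [measurable]: "Measurable.pred N Q" "h \<in> N \<rightarrow>\<^sub>M X" and D: "D \<in> sets X"
    and hD: "\<And>\<omega>. \<omega> \<in> space N \<Longrightarrow> Q \<omega> \<Longrightarrow> h \<omega> \<in> D"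
  shows "(\<lambda>\<omega>. if Q \<omega> then Some (h \<omega>) else None) \<in> N \<rightarrow>\<^sub>M cemetery_space (restrict_space X D)"
proof (rule measurable_sigma_sets[OF sets_cemetery])
  let ?X = "restrict_space X D"
  have sp: "space ?X = D" using sets.sets_into_space[OF D] by (auto simp: space_restrict_space)
  show "insert {None} ((`) Some ` sets ?X) \<subseteq> Pow (insert None (Some ` space ?X))"
    by (auto dest: sets.sets_into_space)
  show "(\<lambda>\<omega>. if Q \<omega> then Some (h \<omega>) else None) \<in> space N \<rightarrow> insert None (Some ` space ?X)"
    using hD by (auto simp: sp)
  fix B assume "B \<in> insert {None} ((`) Some ` sets ?X)"
  then consider "B = {None}" | C where "C \<in> sets ?X" "B = Some ` C" by auto
  then show "(\<lambda>\<omega>. if Q \<omega> then Some (h \<omega>) else None) -` B \<inter> space N \<in> sets N"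
  proof cases
    case 1
    then have "(\<lambda>\<omega>. if Q \<omega> then Some (h \<omega>) else None) -` B \<inter> space N = {\<omega> \<in> space N. \<not> Q \<omega>}"
      by (auto split: if_splits)
    then show ?thesis by simp
  next
    case 2
    then have [measurable]: "C \<in> sets X" using D by (auto simp: sets_restrict_space_iff)
    have "(\<lambda>\<omega>. if Q \<omega> then Some (h \<omega>) else None) -` B \<inter> space N = {\<omega> \<in> space N. Q \<omega> \<and> h \<omega> \<in> C}"
      using 2 by (auto split: if_splits)
    then show ?thesis by simp
  qed
qed

lemma measurable_crossing_seq:
  assumes [measurable]: "A \<in> sets X" and D: "D \<in> sets X"
    and mark: "\<And>\<omega>. \<omega> \<in> space (path_space X) \<Longrightarrow> crossing A \<omega> \<Longrightarrow> \<omega> i \<in> D"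
  shows "crossing_seq A i n \<in> path_space X \<rightarrow>\<^sub>M cemetery_space (restrict_space X D)"
proof (induction n)
  case 0
  have "(\<lambda>\<omega>. if crosses A \<omega> then Some ((path_shift ^^ first_crossing A \<omega>) \<omega> i) else None)
      \<in> path_space X \<rightarrow>\<^sub>M cemetery_space (restrict_space X D)"
  proof (rule measurable_cemetery_If[OF _ _ D])
    fix \<omega> assume "\<omega> \<in> space (path_space X)" "crosses A \<omega>"
    then show "(path_shift ^^ first_crossing A \<omega>) \<omega> i \<in> D"
      by (intro mark crossing_first_crossing measurable_space[OF measurable_path_shift_funpow])
  qed measurable
  then show ?case by (simp add: fun_eq_iff cong: measurable_cong)
next
  case (Suc n)
  note [measurable] = Suc.IH
  \<comment> \<open>The shift by a random amount is glued from countably many fixed shifts, one for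
    each value of \<open>first_crossing\<close>.\<close>
  have [measurable]: "(\<lambda>\<omega>. crossing_seq A i n ((path_shift ^^ Suc (first_crossing A \<omega>)) \<omega>))
      \<in> path_space X \<rightarrow>\<^sub>M cemetery_space (restrict_space X D)"
    by (rule measurable_compose_countable[where g="first_crossing A"]) measurable
  have "(\<lambda>\<omega>. if crosses A \<omega> then crossing_seq A i n ((path_shift ^^ Suc (first_crossing A \<omega>)) \<omega>) else None)
      \<in> path_space X \<rightarrow>\<^sub>M cemetery_space (restrict_space X D)"
    by (intro measurable_If) (auto simp: space_cemetery)
  then show ?case by (simp del: funpow.simps cong: measurable_cong)
qed

lemma measurable_crossings:
  assumes "A \<in> sets X" "D \<in> sets X"
    and "\<And>\<omega>. \<omega> \<in> space (path_space X) \<Longrightarrow> crossing A \<omega> \<Longrightarrow> \<omega> i \<in> D"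
  shows "crossings A i \<in> path_space X \<rightarrow>\<^sub>M path_space (cemetery_space (restrict_space X D))"
  unfolding crossings_def by (intro measurable_abs_UNIV measurable_crossing_seq assms)

section \<open>Chains embedded at crossings\<close>

text \<open>Fixing the time \<open>n\<close> allows induction along first steps and a countable
  decomposition of the random time.\<close>

definition first_crossing_at :: "'a set \<Rightarrow> nat \<Rightarrow> (nat \<Rightarrow> 'a) \<Rightarrow> bool" where
  "first_crossing_at A n \<omega> \<longleftrightarrow>
    (\<forall>k<n. \<not> crossing A ((path_shift ^^ k) \<omega>)) \<and> crossing A ((path_shift ^^ n) \<omega>)"

lemma first_crossing_at_0: "first_crossing_at A 0 \<omega> \<longleftrightarrow> crossing A \<omega>"
  by (simp add: first_crossing_at_def)

lemma first_crossing_at_Suc: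
  "first_crossing_at A (Suc n) \<omega> \<longleftrightarrow> \<not> crossing A \<omega> \<and> first_crossing_at A n (path_shift \<omega>)"
  unfolding first_crossing_at_def funpow_Suc_apply by (auto simp: less_Suc_eq_0_disj funpow_swap1)

lemma first_crossing_at_iff:
  "first_crossing_at A n \<omega> \<longleftrightarrow> crosses A \<omega> \<and> n = first_crossing A \<omega>"
  using crossing_first_crossing not_crossing_before first_crossing_eqI
  unfolding first_crossing_at_def crosses_def by metis

lemma measurable_first_crossing_at [measurable]:
  assumes [measurable]: "A \<in> sets X"
  shows "Measurable.pred (path_space X) (first_crossing_at A n)"
  unfolding first_crossing_at_def by measurable

lemma crossing_case_nat: "crossing A (case_nat x \<omega>) \<longleftrightarrow> x \<notin> A \<and> \<omega> 0 \<in> A"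
  by (simp add: crossing_def)

context markov_kernel
begin

text \<open>The first-step formula replaces the path by one prefixed with \<open>x\<close>, so
  coordinate 0 may be frozen even where \<open>G\<close> also depends on the whole path.\<close>

lemma nn_integral_chain_law_start:
  assumes x: "x \<in> space X" and G[measurable]: "(\<lambda>(y, \<omega>). G y \<omega>) \<in> borel_measurable (X \<Otimes>\<^sub>M \<Omega>)"
  shows "(\<integral>\<^sup>+\<omega>. G (\<omega> 0) \<omega> \<partial>P x) = (\<integral>\<^sup>+\<omega>. G x \<omega> \<partial>P x)"
proof -
  have [measurable]: "G x \<in> borel_measurable \<Omega>"
    using x by measurable
  have "(\<integral>\<^sup>+\<omega>. G (\<omega> 0) \<omega> \<partial>P x) = (\<integral>\<^sup>+y. \<integral>\<^sup>+\<omega>. G x (case_nat x \<omega>) \<partial>P y \<partial>K x)"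
    by (subst chain_law_first_step[OF x]) auto
  also have "\<dots> = (\<integral>\<^sup>+\<omega>. G x \<omega> \<partial>P x)"
    by (rule chain_law_first_step[OF x, symmetric]) measurable
  finally show ?thesis .
qed

text \<open>After one step, a first crossing at \<open>n + 1\<close> becomes one at
  \<open>n\<close>. Whether the first step itself crosses depends only on \<open>x\<close> and the
  next state, so it leaves the inner integral and the replacement of \<open>H\<close> propagates
  backwards.\<close>

lemma nn_integral_first_crossing_at_cong:
  assumes A[measurable]: "A \<in> sets X"
    and H[measurable]: "H \<in> borel_measurable \<Omega>" "H' \<in> borel_measurable \<Omega>"
    and eq: "\<And>y. y \<in> space X \<Longrightarrow> (\<integral>\<^sup>+\<omega>. (if crossing A \<omega> then H \<omega> else 0) \<partial>P y) =
      (\<integral>\<^sup>+\<omega>. (if crossing A \<omega> then H' \<omega> else 0) \<partial>P y)"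
    and x: "x \<in> space X"
  shows "(\<integral>\<^sup>+\<omega>. (if first_crossing_at A n \<omega> then H ((path_shift ^^ n) \<omega>) else 0) \<partial>P x) =
    (\<integral>\<^sup>+\<omega>. (if first_crossing_at A n \<omega> then H' ((path_shift ^^ n) \<omega>) else 0) \<partial>P x)"
  using x
proof (induction n arbitrary: x)
  case 0
  then show ?case using eq by (simp add: first_crossing_at_0 cong: if_cong)
next
  case (Suc n)
  note x = Suc.prems
  have first: "(\<integral>\<^sup>+\<omega>. (if first_crossing_at A (Suc n) \<omega> then F ((path_shift ^^ Suc n) \<omega>) else 0) \<partial>P x) =
      (\<integral>\<^sup>+y. (if x \<notin> A \<and> y \<in> A then 0 else
        \<integral>\<^sup>+\<omega>. (if first_crossing_at A n \<omega> then F ((path_shift ^^ n) \<omega>) else 0) \<partial>P y) \<partial>K x)"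
    if [measurable]: "F \<in> borel_measurable \<Omega>" for F :: "_ \<Rightarrow> ennreal"
  proof -
    have "(\<integral>\<^sup>+\<omega>. (if first_crossing_at A (Suc n) \<omega> then F ((path_shift ^^ Suc n) \<omega>) else 0) \<partial>P x) =
      (\<integral>\<^sup>+y. \<integral>\<^sup>+\<omega>. (if \<not> (x \<notin> A \<and> \<omega> 0 \<in> A) \<and> first_crossing_at A n \<omega>
        then F ((path_shift ^^ n) \<omega>) else 0) \<partial>P y \<partial>K x)"
      by (subst chain_law_first_step[OF x])
        (measurable, simp add: first_crossing_at_Suc crossing_case_nat funpow_Suc_apply
          del: funpow.simps cong: if_cong)
    also have "\<dots> = (\<integral>\<^sup>+y. (if x \<notin> A \<and> y \<in> A then 0 else
        \<integral>\<^sup>+\<omega>. (if first_crossing_at A n \<omega> then F ((path_shift ^^ n) \<omega>) else 0) \<partial>P y) \<partial>K x)"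
    proof (rule nn_integral_cong_kernel[OF x])
      fix y assume y: "y \<in> space X"
      have "AE \<omega> in P y. \<omega> 0 \<in> A \<longleftrightarrow> y \<in> A"
        by (rule AE_chain_law_start[OF y]) auto
      then have "(\<integral>\<^sup>+\<omega>. (if \<not> (x \<notin> A \<and> \<omega> 0 \<in> A) \<and> first_crossing_at A n \<omega>
          then F ((path_shift ^^ n) \<omega>) else 0) \<partial>P y) =
        (\<integral>\<^sup>+\<omega>. (if \<not> (x \<notin> A \<and> y \<in> A) \<and> first_crossing_at A n \<omega>
          then F ((path_shift ^^ n) \<omega>) else 0) \<partial>P y)"
        by (intro nn_integral_cong_AE) auto
      then show "(\<integral>\<^sup>+\<omega>. (if \<not> (x \<notin> A \<and> \<omega> 0 \<in> A) \<and> first_crossing_at A n \<omega>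
          then F ((path_shift ^^ n) \<omega>) else 0) \<partial>P y) = (if x \<notin> A \<and> y \<in> A then 0 else
        \<integral>\<^sup>+\<omega>. (if first_crossing_at A n \<omega> then F ((path_shift ^^ n) \<omega>) else 0) \<partial>P y)"
        by auto
    qed
    finally show ?thesis .
  qed
  show ?case
    unfolding first[OF H(1)] first[OF H(2)]
    by (rule nn_integral_cong_kernel[OF x]) (simp add: Suc.IH)
qed

text \<open>
  The strong Markov property at the first crossing. Since \<open>T - 1\<close> is not a stopping time, it is
  phrased as the replacement of \<open>H\<close> by \<open>H'\<close> rather than as conditioning.
\<close>

lemma nn_integral_first_crossing_cong:
  assumes A[measurable]: "A \<in> sets X"
    and H[measurable]: "H \<in> borel_measurable \<Omega>" "H' \<in> borel_measurable \<Omega>"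
    and eq: "\<And>y. y \<in> space X \<Longrightarrow> (\<integral>\<^sup>+\<omega>. (if crossing A \<omega> then H \<omega> else 0) \<partial>P y) =
      (\<integral>\<^sup>+\<omega>. (if crossing A \<omega> then H' \<omega> else 0) \<partial>P y)"
    and x: "x \<in> space X"
  shows "(\<integral>\<^sup>+\<omega>. (if crosses A \<omega> then H ((path_shift ^^ first_crossing A \<omega>) \<omega>) else c) \<partial>P x) =
    (\<integral>\<^sup>+\<omega>. (if crosses A \<omega> then H' ((path_shift ^^ first_crossing A \<omega>) \<omega>) else c) \<partial>P x)"
proof -
  \<comment> \<open>At most one term of the series is nonzero, the one at the actual first crossing;
    the value \<open>c\<close> on paths without crossing is the same on both sides.\<close>
  have split: "(\<integral>\<^sup>+\<omega>. (if crosses A \<omega> then F ((path_shift ^^ first_crossing A \<omega>) \<omega>) else c) \<partial>P x) =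
      (\<Sum>n. \<integral>\<^sup>+\<omega>. (if first_crossing_at A n \<omega> then F ((path_shift ^^ n) \<omega>) else 0) \<partial>P x) +
      (\<integral>\<^sup>+\<omega>. (if crosses A \<omega> then 0 else c) \<partial>P x)"
    if [measurable]: "F \<in> borel_measurable \<Omega>" for F :: "_ \<Rightarrow> ennreal"
  proof -
    have "(if crosses A \<omega> then F ((path_shift ^^ first_crossing A \<omega>) \<omega>) else c) =
      (\<Sum>n. if first_crossing_at A n \<omega> then F ((path_shift ^^ n) \<omega>) else 0) +
      (if crosses A \<omega> then 0 else c)" for \<omega>
    proof (cases "crosses A \<omega>")
      case True
      have "(\<lambda>n. if n = first_crossing A \<omega> then F ((path_shift ^^ n) \<omega>) else 0) sums
          F ((path_shift ^^ first_crossing A \<omega>) \<omega>)"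
        by (rule sums_single)
      then show ?thesis using True by (simp add: first_crossing_at_iff sums_unique[symmetric])
    qed (simp add: first_crossing_at_iff)
    then have "(\<integral>\<^sup>+\<omega>. (if crosses A \<omega> then F ((path_shift ^^ first_crossing A \<omega>) \<omega>) else c) \<partial>P x) =
      (\<integral>\<^sup>+\<omega>. (\<Sum>n. if first_crossing_at A n \<omega> then F ((path_shift ^^ n) \<omega>) else 0) +
        (if crosses A \<omega> then 0 else c) \<partial>P x)" by simp
    also have "\<dots> = (\<integral>\<^sup>+\<omega>. (\<Sum>n. if first_crossing_at A n \<omega> then F ((path_shift ^^ n) \<omega>) else 0) \<partial>P x) +
        (\<integral>\<^sup>+\<omega>. (if crosses A \<omega> then 0 else c) \<partial>P x)"
      by (rule nn_integral_add) (simp_all add: x)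
    also have "(\<integral>\<^sup>+\<omega>. (\<Sum>n. if first_crossing_at A n \<omega> then F ((path_shift ^^ n) \<omega>) else 0) \<partial>P x) =
        (\<Sum>n. \<integral>\<^sup>+\<omega>. (if first_crossing_at A n \<omega> then F ((path_shift ^^ n) \<omega>) else 0) \<partial>P x)"
      by (rule nn_integral_suminf) (simp add: x)
    finally show ?thesis .
  qed
  show ?thesis
    unfolding split[OF H(1)] split[OF H(2)]
    using nn_integral_first_crossing_at_cong[OF A H eq x] by simp
qed

end

text \<open>
  Common setting for the entrance chain (\<open>i = 1\<close>, \<open>D = L = A\<close>, \<open>U x\<close> the Dirac measure) and the exit
  chain (\<open>i = 0\<close>, \<open>D = A\<^sup>c\<close>, \<open>L\<close> the exit set, \<open>U x = P\<^sub>x(Y\<^sub>1 \<in> \<cdot> | Y\<^sub>1 \<in> A)\<close>): given the mark \<open>\<omega> i\<close> of a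
  crossing, the path after it has law \<open>U (\<omega> i) \<bind> P\<close>. States outside \<open>L\<close> are sent to the cemetery.
\<close>

locale marked_crossings = markov_kernel X K
  for X :: "'a measure" and K :: "'a \<Rightarrow> 'a measure" +
  fixes A :: "'a set" and i :: nat and D L :: "'a set" and U :: "'a \<Rightarrow> 'a measure"
    and \<kappa> :: "'a option \<Rightarrow> 'a option measure"
  assumes A [measurable]: "A \<in> sets X" and D [measurable]: "D \<in> sets X" and L [measurable]: "L \<in> sets X"
    and L_subset: "L \<subseteq> D"
    and mark: "\<And>\<omega>. \<omega> \<in> space (path_space X) \<Longrightarrow> crossing A \<omega> \<Longrightarrow> \<omega> i \<in> D"
    and U: "U \<in> X \<rightarrow>\<^sub>M prob_algebra X"
    and live: "\<And>y. y \<in> space X \<Longrightarrow> AE \<omega> in chain_law X K y. crossing A \<omega> \<longrightarrow> \<omega> i \<in> L"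
    and after_crossing: "\<And>y G. y \<in> space X \<Longrightarrow> (\<lambda>(x, \<omega>). G x \<omega>) \<in> borel_measurable (X \<Otimes>\<^sub>M path_space X) \<Longrightarrow>
      (\<integral>\<^sup>+\<omega>. (if crossing A \<omega> then G (\<omega> i) (path_shift \<omega>) else 0) \<partial>chain_law X K y) =
      (\<integral>\<^sup>+\<omega>. (if crossing A \<omega> then \<integral>\<^sup>+\<omega>'. G (\<omega> i) \<omega>' \<partial>(U (\<omega> i) \<bind> chain_law X K) else 0) \<partial>chain_law X K y)"
    and \<kappa>_None: "\<kappa> None = return (cemetery_space (restrict_space X D)) None"
    and \<kappa>_live: "\<And>y. y \<in> L \<Longrightarrow> \<kappa> (Some y) =
      distr (U y \<bind> chain_law X K) (cemetery_space (restrict_space X D)) (\<lambda>\<omega>. crossings A i \<omega> 0)"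
    and \<kappa>_dead: "\<And>y. y \<in> D \<Longrightarrow> y \<notin> L \<Longrightarrow> \<kappa> (Some y) = return (cemetery_space (restrict_space X D)) None"
begin

abbreviation "E \<equiv> cemetery_space (restrict_space X D)"
abbreviation "\<Omega>E \<equiv> path_space (cemetery_space (restrict_space X D))"
abbreviation "V \<equiv> crossings A i"
abbreviation "R y \<equiv> U y \<bind> P"

text \<open>A measurable map on all of \<open>X\<close> that agrees with \<open>Some\<close> on
  \<open>D\<close>. Marks of crossings lie in \<open>D\<close>, so it can stand in for
  \<open>Some\<close> wherever measurability on the full path space is required.\<close>

definition mark_state :: "'a \<Rightarrow> 'a option" where
  "mark_state y = (if y \<in> D then Some y else None)"

lemma D_subset: "D \<subseteq> space X"
  by (rule sets.sets_into_space[OF D])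

lemma space_restrict_D: "space (restrict_space X D) = D"
  using D_subset by (auto simp: space_restrict_space)

lemma space_E: "space E = insert None (Some ` D)"
  by (simp add: space_cemetery space_restrict_D)

lemma measurable_V [measurable]: "V \<in> \<Omega> \<rightarrow>\<^sub>M \<Omega>E"
  by (rule measurable_crossings[OF A D mark])

lemma measurable_mark_state [measurable]: "mark_state \<in> X \<rightarrow>\<^sub>M E"
  unfolding mark_state_def by (rule measurable_cemetery_If[OF _ _ D]) auto

lemma None_path: "(\<lambda>_. None) \<in> space \<Omega>E"
  by (auto simp: space_PiM space_E)

lemma R_prob_algebra: "R \<in> X \<rightarrow>\<^sub>M prob_algebra \<Omega>"
  by (rule measurable_bind_prob_space[OF U chain_law_measurable])

lemma measurable_R [measurable]: "R \<in> X \<rightarrow>\<^sub>M subprob_algebra \<Omega>"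
  by (rule measurable_prob_algebraD[OF R_prob_algebra])

lemma prob_space_R: "y \<in> space X \<Longrightarrow> prob_space (R y)"
  and sets_R: "y \<in> space X \<Longrightarrow> sets (R y) = sets \<Omega>"
  using measurable_space[OF R_prob_algebra] by (auto simp: space_prob_algebra)

lemma measurable_R_cong [simp]: "y \<in> space X \<Longrightarrow> measurable (R y) N = measurable \<Omega> N"
  by (rule measurable_cong_sets) (simp_all add: sets_R)

lemma space_R: "y \<in> space X \<Longrightarrow> space (R y) = space \<Omega>"
  by (rule sets_eq_imp_space_eq[OF sets_R])

lemma sets_U: "y \<in> space X \<Longrightarrow> sets (U y) = sets X"
  using measurable_space[OF U] by (auto simp: space_prob_algebra)

lemma nn_integral_R:
  assumes y: "y \<in> space X" and F: "F \<in> borel_measurable \<Omega>"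
  shows "(\<integral>\<^sup>+\<omega>. F \<omega> \<partial>R y) = (\<integral>\<^sup>+z. \<integral>\<^sup>+\<omega>. F \<omega> \<partial>P z \<partial>U y)"
  by (rule nn_integral_bind[OF F]) (simp add: measurable_cong_sets[OF sets_U[OF y] refl] measurable_chain_law)

lemma nn_integral_R_cong:
  assumes y: "y \<in> space X" and F: "F \<in> borel_measurable \<Omega>" "G \<in> borel_measurable \<Omega>"
    and eq: "\<And>x. x \<in> space X \<Longrightarrow> (\<integral>\<^sup>+\<omega>. F \<omega> \<partial>P x) = (\<integral>\<^sup>+\<omega>. G \<omega> \<partial>P x)"
  shows "(\<integral>\<^sup>+\<omega>. F \<omega> \<partial>R y) = (\<integral>\<^sup>+\<omega>. G \<omega> \<partial>R y)"
  unfolding nn_integral_R[OF y F(1)] nn_integral_R[OF y F(2)]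
  by (intro nn_integral_cong eq) (simp add: sets_eq_imp_space_eq[OF sets_U[OF y]])

text \<open>The intended path law of the embedded chain: the current mark, followed by the marks of
  a fresh path drawn from the law that follows a crossing with this mark.\<close>

definition Q :: "'a option \<Rightarrow> (nat \<Rightarrow> 'a option) measure" where
  "Q z = (case z of None \<Rightarrow> return \<Omega>E (\<lambda>_. None)
    | Some y \<Rightarrow> if y \<in> L then distr (R y) \<Omega>E (\<lambda>\<omega>. case_nat (Some y) (V \<omega>))
        else return \<Omega>E (case_nat (Some y) (\<lambda>_. None)))"

lemma L_space: "y \<in> L \<Longrightarrow> y \<in> space X" and D_space: "y \<in> D \<Longrightarrow> y \<in> space X"
  using L_subset D_subset by auto

lemma Some_E: "y \<in> D \<Longrightarrow> Some y \<in> space E" and None_E: "None \<in> space E"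
  by (auto simp: space_E)

lemma measurable_case_nat_V [measurable]:
  "z \<in> space E \<Longrightarrow> (\<lambda>\<omega>. case_nat z (V \<omega>)) \<in> \<Omega> \<rightarrow>\<^sub>M \<Omega>E"
  by measurable

lemma path_case_nat_None: "z \<in> space E \<Longrightarrow> case_nat z (\<lambda>_. None) \<in> space \<Omega>E"
  by (auto simp: space_PiM space_E PiE_iff split: nat.split)

lemma Q_prob_space: "z \<in> space E \<Longrightarrow> prob_space (Q z)"
  using L_subset prob_space_R
  by (auto simp: space_E Q_def None_path path_case_nat_None Some_E L_space
      intro!: prob_space_return prob_space.prob_space_distr measurable_case_nat_V
      split: option.split)

lemma sets_Q: "sets (Q z) = sets \<Omega>E"
  by (auto simp: Q_def split: option.split)

lemma nn_integral_Q_live: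
  assumes y: "y \<in> L" and F[measurable]: "F \<in> borel_measurable \<Omega>E"
  shows "(\<integral>\<^sup>+s. F s \<partial>Q (Some y)) = (\<integral>\<^sup>+\<omega>. F (case_nat (Some y) (V \<omega>)) \<partial>R y)"
proof -
  have "Some y \<in> space E" using y L_subset Some_E by auto
  then show ?thesis
    using y by (simp add: Q_def nn_integral_distr L_space)
qed

lemma kernel_\<kappa>: "\<kappa> \<in> E \<rightarrow>\<^sub>M prob_algebra E"
proof (rule measurable_cemetery)
  have "(\<lambda>y. if y \<in> L then distr (R y) E (\<lambda>\<omega>. V \<omega> 0) else return E None) \<in> X \<rightarrow>\<^sub>M prob_algebra E"
  proof (rule measurable_If)
    show "(\<lambda>y. distr (R y) E (\<lambda>\<omega>. V \<omega> 0)) \<in> X \<rightarrow>\<^sub>M prob_algebra E"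
      by (rule measurable_compose[OF R_prob_algebra measurable_distr_prob_space]) measurable
    show "(\<lambda>y. return E None) \<in> X \<rightarrow>\<^sub>M prob_algebra E"
      using None_E by (auto simp: space_prob_algebra prob_space_return)
  qed measurable
  then have "(\<lambda>y. if y \<in> L then distr (R y) E (\<lambda>\<omega>. V \<omega> 0) else return E None)
      \<in> restrict_space X D \<rightarrow>\<^sub>M prob_algebra E"
    by (rule measurable_restrict_space1)
  then show "(\<lambda>y. \<kappa> (Some y)) \<in> restrict_space X D \<rightarrow>\<^sub>M prob_algebra E"
    by (rule measurable_cong[THEN iffD1, rotated]) (auto simp: space_restrict_D \<kappa>_live \<kappa>_dead)
  show "\<kappa> None \<in> space (prob_algebra E)"
    using None_E by (auto simp: \<kappa>_None space_prob_algebra prob_space_return)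
qed

lemma measurable_Q: "Q \<in> E \<rightarrow>\<^sub>M prob_algebra \<Omega>E"
proof (rule measurable_cemetery)
  have "(\<lambda>y. if y \<in> L then distr (R y) \<Omega>E (\<lambda>\<omega>. case_nat (mark_state y) (V \<omega>))
      else return \<Omega>E (case_nat (mark_state y) (\<lambda>_. None))) \<in> X \<rightarrow>\<^sub>M prob_algebra \<Omega>E"
  proof (rule measurable_If)
    show "(\<lambda>y. distr (R y) \<Omega>E (\<lambda>\<omega>. case_nat (mark_state y) (V \<omega>))) \<in> X \<rightarrow>\<^sub>M prob_algebra \<Omega>E"
      by (rule measurable_distr_prob_space2[OF R_prob_algebra]) measurable
    have "(\<lambda>y. case_nat (mark_state y) (\<lambda>_. None)) \<in> X \<rightarrow>\<^sub>M \<Omega>E"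
      using None_path by measurable
    then show "(\<lambda>y. return \<Omega>E (case_nat (mark_state y) (\<lambda>_. None))) \<in> X \<rightarrow>\<^sub>M prob_algebra \<Omega>E"
      by (rule measurable_compose[OF _ measurable_return_prob_space])
  qed measurable
  then have "(\<lambda>y. if y \<in> L then distr (R y) \<Omega>E (\<lambda>\<omega>. case_nat (mark_state y) (V \<omega>))
      else return \<Omega>E (case_nat (mark_state y) (\<lambda>_. None))) \<in> restrict_space X D \<rightarrow>\<^sub>M prob_algebra \<Omega>E"
    by (rule measurable_restrict_space1)
  then show "(\<lambda>y. Q (Some y)) \<in> restrict_space X D \<rightarrow>\<^sub>M prob_algebra \<Omega>E"
    by (rule measurable_cong[THEN iffD1, rotated]) (simp add: space_restrict_D Q_def mark_state_def)
  show "Q None \<in> space (prob_algebra \<Omega>E)"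
    using Q_prob_space[OF None_E] by (simp add: space_prob_algebra sets_Q)
qed

lemma measurable_nn_integral_Q [measurable]:
  assumes F: "F \<in> borel_measurable \<Omega>E"
  shows "(\<lambda>z. \<integral>\<^sup>+s. F s \<partial>Q z) \<in> borel_measurable E"
  by (rule nn_integral_measurable_subprob_algebra2[OF _ measurable_prob_algebraD[OF measurable_Q]])
    (use F in measurable)

text \<open>At a crossing with a known mark, the continuation may be resampled from
  \<open>R\<close>, which turns the remaining marks into a path of law \<open>Q\<close>. Marks
  outside \<open>L\<close> occur with probability 0.\<close>

lemma nn_integral_after_mark:
  assumes [measurable]: "F \<in> borel_measurable \<Omega>E" and y: "y \<in> space X"
  shows "(\<integral>\<^sup>+\<omega>. (if crossing A \<omega> then F (case_nat (Some (\<omega> i)) (V (path_shift \<omega>))) else 0) \<partial>P y) =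
    (\<integral>\<^sup>+\<omega>. (if crossing A \<omega> then \<integral>\<^sup>+s. F s \<partial>Q (Some (\<omega> i)) else 0) \<partial>P y)"
proof -
  have "(\<integral>\<^sup>+\<omega>. (if crossing A \<omega> then F (case_nat (Some (\<omega> i)) (V (path_shift \<omega>))) else 0) \<partial>P y) =
      (\<integral>\<^sup>+\<omega>. (if crossing A \<omega> then F (case_nat (mark_state (\<omega> i)) (V (path_shift \<omega>))) else 0) \<partial>P y)"
    by (rule nn_integral_cong_path[OF y]) (simp add: mark_state_def mark)
  also have "\<dots> = (\<integral>\<^sup>+\<omega>. (if crossing A \<omega> then \<integral>\<^sup>+\<omega>'. F (case_nat (mark_state (\<omega> i)) (V \<omega>')) \<partial>R (\<omega> i) else 0) \<partial>P y)"
    by (rule after_crossing[OF y]) measurable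
  also have "\<dots> = (\<integral>\<^sup>+\<omega>. (if crossing A \<omega> then \<integral>\<^sup>+s. F s \<partial>Q (Some (\<omega> i)) else 0) \<partial>P y)"
  proof (rule nn_integral_cong_AE)
    show "AE \<omega> in P y. (if crossing A \<omega> then \<integral>\<^sup>+\<omega>'. F (case_nat (mark_state (\<omega> i)) (V \<omega>')) \<partial>R (\<omega> i) else 0) =
        (if crossing A \<omega> then \<integral>\<^sup>+s. F s \<partial>Q (Some (\<omega> i)) else 0)"
      using live[OF y]
    proof eventually_elim
      fix \<omega> :: "nat \<Rightarrow> 'a" assume "crossing A \<omega> \<longrightarrow> \<omega> i \<in> L"
      then show "(if crossing A \<omega> then \<integral>\<^sup>+\<omega>'. F (case_nat (mark_state (\<omega> i)) (V \<omega>')) \<partial>R (\<omega> i) else 0) =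
        (if crossing A \<omega> then \<integral>\<^sup>+s. F s \<partial>Q (Some (\<omega> i)) else 0)"
        using L_subset by (auto simp: nn_integral_Q_live mark_state_def)
    qed
  qed
  finally show ?thesis .
qed

text \<open>Resampling at the first crossing: given its first term, the sequence of marks has law
  \<open>Q\<close>. A path without crossings fits in, since its sequence is constantly
  \<open>None\<close>, as under \<open>Q None\<close>.\<close>

lemma nn_integral_V_step:
  assumes [measurable]: "F \<in> borel_measurable \<Omega>E" and x: "x \<in> space X"
  shows "(\<integral>\<^sup>+\<omega>. F (V \<omega>) \<partial>P x) = (\<integral>\<^sup>+\<omega>. (\<integral>\<^sup>+s. F s \<partial>Q (V \<omega> 0)) \<partial>P x)"
proof -
  let ?H = "\<lambda>\<omega>. F (case_nat (mark_state (\<omega> i)) (V (path_shift \<omega>)))"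
  let ?H' = "\<lambda>\<omega>. \<integral>\<^sup>+s. F s \<partial>Q (mark_state (\<omega> i))"
  let ?c = "F (\<lambda>_. None)"
  have H'[measurable]: "?H' \<in> borel_measurable \<Omega>"
    by (rule measurable_compose[OF _ measurable_nn_integral_Q]) measurable
  have mark': "mark_state ((path_shift ^^ first_crossing A \<omega>) \<omega> i) = Some ((path_shift ^^ first_crossing A \<omega>) \<omega> i)"
    if "\<omega> \<in> space \<Omega>" "crosses A \<omega>" for \<omega>
    using mark[OF shift_path[OF that(1)] crossing_first_crossing[OF that(2)]] by (simp add: mark_state_def)
  have "(\<integral>\<^sup>+\<omega>. F (V \<omega>) \<partial>P x) =
      (\<integral>\<^sup>+\<omega>. (if crosses A \<omega> then ?H ((path_shift ^^ first_crossing A \<omega>) \<omega>) else ?c) \<partial>P x)"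
    by (rule nn_integral_cong_path[OF x]) (auto simp: crossings_crosses crossings_not_crosses mark')
  also have "\<dots> = (\<integral>\<^sup>+\<omega>. (if crosses A \<omega> then ?H' ((path_shift ^^ first_crossing A \<omega>) \<omega>) else ?c) \<partial>P x)"
  proof (rule nn_integral_first_crossing_cong[OF A _ H' _ x])
    fix y assume y: "y \<in> space X"
    have "(\<integral>\<^sup>+\<omega>. (if crossing A \<omega> then ?H \<omega> else 0) \<partial>P y) =
        (\<integral>\<^sup>+\<omega>. (if crossing A \<omega> then F (case_nat (Some (\<omega> i)) (V (path_shift \<omega>))) else 0) \<partial>P y)"
      by (rule nn_integral_cong_path[OF y]) (simp add: mark_state_def mark)
    also have "\<dots> = (\<integral>\<^sup>+\<omega>. (if crossing A \<omega> then \<integral>\<^sup>+s. F s \<partial>Q (Some (\<omega> i)) else 0) \<partial>P y)"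
      by (rule nn_integral_after_mark[OF _ y]) measurable
    also have "\<dots> = (\<integral>\<^sup>+\<omega>. (if crossing A \<omega> then ?H' \<omega> else 0) \<partial>P y)"
      by (rule nn_integral_cong_path[OF y]) (simp add: mark_state_def mark)
    finally show "(\<integral>\<^sup>+\<omega>. (if crossing A \<omega> then ?H \<omega> else 0) \<partial>P y) =
        (\<integral>\<^sup>+\<omega>. (if crossing A \<omega> then ?H' \<omega> else 0) \<partial>P y)" .
  qed measurable
  also have "\<dots> = (\<integral>\<^sup>+\<omega>. (\<integral>\<^sup>+s. F s \<partial>Q (V \<omega> 0)) \<partial>P x)"
    by (rule nn_integral_cong_path[OF x])
      (auto simp: crossings_crosses crossings_not_crosses mark' Q_def nn_integral_return None_path)
  finally show ?thesis .
qed

sublocale marks: markov_kernel E \<kappa>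
  by unfold_locales (rule kernel_\<kappa>)

text \<open>\<open>Q\<close> satisfies the first-step equation of \<kappa>, so
  \<open>chain_law_unique\<close> applies. From the cemetery and from states outside
  \<open>L\<close> both sides are deterministic.\<close>

lemma chain_law_marks:
  assumes z: "z \<in> space E"
  shows "chain_law E \<kappa> z = Q z"
proof (rule marks.chain_law_unique[symmetric, OF Q_prob_space sets_Q _ z])
  fix x and B :: "(nat \<Rightarrow> 'a option) set"
  assume x: "x \<in> space E" and B[measurable]: "B \<in> sets \<Omega>E"
  define B' where "B' = {s \<in> space \<Omega>E. case_nat x s \<in> B}"
  have B'[measurable]: "B' \<in> sets \<Omega>E" unfolding B'_def using x by measurable
  have case_nat_None: "case_nat (None :: 'a option) (\<lambda>_. None) = (\<lambda>_. None)"
    by (auto split: nat.split)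
  have meas: "(\<lambda>z. emeasure (Q z) B') \<in> borel_measurable E"
    using measurable_emeasure_subprob_algebra[OF B'] measurable_prob_algebraD[OF measurable_Q]
    by (rule measurable_compose[rotated])
  have dead: "(\<integral>\<^sup>+w. emeasure (Q w) B' \<partial>return E None) = indicator B' (\<lambda>_. None)"
    using nn_integral_return[OF None_E meas] by (simp add: Q_def)
  show "emeasure (Q x) B = (\<integral>\<^sup>+w. emeasure (Q w) {s \<in> space \<Omega>E. case_nat x s \<in> B} \<partial>\<kappa> x)"
  proof (cases x)
    case None
    have "emeasure (Q x) B = indicator B' (\<lambda>_. None)"
      using None_path by (simp add: Q_def None B'_def case_nat_None indicator_def)
    then show ?thesis
      unfolding B'_def[symmetric] unfolding None \<kappa>_None dead .
  next
    case (Some y)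
    then have yD: "y \<in> D" using x by (auto simp: space_E)
    show ?thesis
    proof (cases "y \<in> L")
      case False
      have "emeasure (Q x) B = indicator B' (\<lambda>_. None)"
        using None_path False by (simp add: Q_def B'_def Some indicator_def)
      then show ?thesis
        unfolding B'_def[symmetric] unfolding Some \<kappa>_dead[OF yD False] dead .
    next
      case True
      have "emeasure (Q x) B = (\<integral>\<^sup>+s. indicator B s \<partial>Q (Some y))"
        by (simp add: Some sets_Q)
      also have "\<dots> = (\<integral>\<^sup>+\<omega>. indicator B (case_nat (Some y) (V \<omega>)) \<partial>R y)"
        by (rule nn_integral_Q_live[OF True]) measurable
      also have "\<dots> = (\<integral>\<^sup>+\<omega>. indicator B' (V \<omega>) \<partial>R y)"
        using measurable_space[OF measurable_V]
        by (intro nn_integral_cong) (auto simp: B'_def Some indicator_def space_R L_space True)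
      \<comment> \<open>\<open>R y\<close> is a mixture of the laws \<open>P x\<close>, so the
        decomposition at the first mark holds under it too; that mark has the law \<kappa>
        prescribes.\<close>
      also have "\<dots> = (\<integral>\<^sup>+\<omega>. (\<integral>\<^sup>+s. indicator B' s \<partial>Q (V \<omega> 0)) \<partial>R y)"
        by (rule nn_integral_R_cong[OF L_space[OF True]])
          (auto intro!: nn_integral_V_step measurable_compose[OF _ measurable_nn_integral_Q])
      also have "\<dots> = (\<integral>\<^sup>+\<omega>. emeasure (Q (V \<omega> 0)) B' \<partial>R y)"
        by (simp add: sets_Q)
      also have "\<dots> = (\<integral>\<^sup>+w. emeasure (Q w) B' \<partial>\<kappa> x)"
        unfolding Some \<kappa>_live[OF True]
        by (rule nn_integral_distr[symmetric]) (use meas in \<open>auto simp: L_space True\<close>)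
      finally show ?thesis unfolding B'_def .
    qed
  qed
qed

end

section \<open>Invariance, recurrence and ergodicity of embedded chains\<close>

context recurrent_chain
begin

lemma AE_crossing_infinitely_often:
  assumes [measurable]: "A \<in> sets X"
  shows "AE \<omega> in P\<mu>. crossing A \<omega> \<longrightarrow> (\<exists>\<^sub>\<infinity>n. crossing A ((path_shift ^^ n) \<omega>))"
proof (rule AE_returns_infinitely_often)
  let ?C = "{\<omega> \<in> space \<Omega>. crossing A \<omega>}"
  have "AE \<omega> in P\<mu>. \<omega> \<in> ?C \<longrightarrow> (\<exists>n\<ge>1. (path_shift ^^ n) \<omega> \<in> ?C)"
    by (rule P\<mu>_conservative) measurable
  then show "AE \<omega> in P\<mu>. crossing A \<omega> \<longrightarrow> (\<exists>n\<ge>1. crossing A ((path_shift ^^ n) \<omega>))"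
    using AE_space by eventually_elim (auto simp: space_P\<mu>)
qed

end

locale marked_measure = marked_crossings X K A i D L U \<kappa> + recurrent_chain X K \<mu>
  for X :: "'a measure" and K A i D L U \<kappa> \<mu> +
  fixes \<nu> :: "'a measure"
  assumes sets_\<nu>: "sets \<nu> = sets (restrict_space X D)"
    and nn_integral_\<nu>: "\<And>f. f \<in> borel_measurable X \<Longrightarrow> (\<integral>\<^sup>+x. f x \<partial>\<nu>) =
      (\<integral>\<^sup>+\<omega>. (if crossing A \<omega> then f (\<omega> i) else 0) \<partial>chain_law_init X K \<mu>)"
begin

abbreviation "\<nu>E \<equiv> with_cemetery \<nu>"
abbreviation "Law \<equiv> chain_law_init E \<kappa> \<nu>E"

lemma with_cemetery_\<nu>: "\<nu>E = distr \<nu> E Some"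
  unfolding with_cemetery_def using cemetery_cong[OF sets_\<nu>] by simp

lemma sets_\<nu>E [measurable_cong]: "sets \<nu>E = sets E"
  by (simp add: with_cemetery_\<nu>)

lemma space_\<nu>E: "space \<nu>E = space E"
  by (rule sets_eq_imp_space_eq[OF sets_\<nu>E])

lemma space_\<nu>: "space \<nu> = D"
  using sets_eq_imp_space_eq[OF sets_\<nu>] by (simp add: space_restrict_D)

lemma inclusion_\<nu>E: "(\<lambda>x. x) \<in> \<nu>E \<rightarrow>\<^sub>M E"
  by (rule measurable_ident_sets[OF sets_\<nu>E])

lemma sets_Law [measurable_cong]: "sets Law = sets \<Omega>E"
  by (rule marks.sets_chain_law_init[OF inclusion_\<nu>E]) (use None_E in \<open>auto simp: space_\<nu>E\<close>)

lemma space_Law: "space Law = space \<Omega>E"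
  by (rule sets_eq_imp_space_eq[OF sets_Law])

lemma measurable_Some_\<nu>: "Some \<in> \<nu> \<rightarrow>\<^sub>M E"
  using measurable_Some[of "restrict_space X D"] by (simp add: measurable_cong_sets[OF sets_\<nu> refl])

lemma nn_integral_\<nu>E:
  assumes [measurable]: "f \<in> borel_measurable E"
  shows "(\<integral>\<^sup>+z. f z \<partial>\<nu>E) = (\<integral>\<^sup>+\<omega>. (if crossing A \<omega> then f (Some (\<omega> i)) else 0) \<partial>P\<mu>)"
proof -
  have "(\<integral>\<^sup>+z. f z \<partial>\<nu>E) = (\<integral>\<^sup>+x. f (Some x) \<partial>\<nu>)"
    unfolding with_cemetery_\<nu> by (rule nn_integral_distr[OF measurable_Some_\<nu>]) simp
  also have "\<dots> = (\<integral>\<^sup>+x. f (mark_state x) \<partial>\<nu>)"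
    by (intro nn_integral_cong) (simp add: space_\<nu> mark_state_def)
  also have "\<dots> = (\<integral>\<^sup>+\<omega>. (if crossing A \<omega> then f (mark_state (\<omega> i)) else 0) \<partial>P\<mu>)"
    by (rule nn_integral_\<nu>) measurable
  also have "\<dots> = (\<integral>\<^sup>+\<omega>. (if crossing A \<omega> then f (Some (\<omega> i)) else 0) \<partial>P\<mu>)"
    by (intro nn_integral_cong) (simp add: space_P\<mu> mark_state_def mark)
  finally show ?thesis .
qed

lemma nn_integral_Law:
  assumes F[measurable]: "F \<in> borel_measurable \<Omega>E"
  shows "(\<integral>\<^sup>+s. F s \<partial>Law) = (\<integral>\<^sup>+\<omega>. (if crossing A \<omega> then F (V \<omega>) else 0) \<partial>P\<mu>)"
proof -
  have [measurable]: "(\<lambda>\<omega>. if crossing A \<omega> then \<integral>\<^sup>+s. F s \<partial>Q (mark_state (\<omega> i)) else 0) \<in> borel_measurable \<Omega>"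
    using measurable_compose[OF _ measurable_nn_integral_Q[OF F], of "\<lambda>\<omega>. mark_state (\<omega> i)"] by measurable
  have "(\<integral>\<^sup>+s. F s \<partial>Law) = (\<integral>\<^sup>+z. \<integral>\<^sup>+s. F s \<partial>chain_law E \<kappa> z \<partial>\<nu>E)"
    by (rule marks.nn_integral_chain_law_init[OF inclusion_\<nu>E F])
  also have "\<dots> = (\<integral>\<^sup>+z. \<integral>\<^sup>+s. F s \<partial>Q z \<partial>\<nu>E)"
    by (intro nn_integral_cong) (simp add: chain_law_marks space_\<nu>E)
  also have "\<dots> = (\<integral>\<^sup>+\<omega>. (if crossing A \<omega> then \<integral>\<^sup>+s. F s \<partial>Q (Some (\<omega> i)) else 0) \<partial>P\<mu>)"
    by (rule nn_integral_\<nu>E) measurable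
  \<comment> \<open>\<open>mark_state\<close> replaces \<open>Some\<close> to make the integrand
    measurable on the whole path space, which the passage to \<open>P x\<close> below uses.\<close>
  also have "\<dots> = (\<integral>\<^sup>+\<omega>. (if crossing A \<omega> then \<integral>\<^sup>+s. F s \<partial>Q (mark_state (\<omega> i)) else 0) \<partial>P\<mu>)"
    by (intro nn_integral_cong) (simp add: space_P\<mu> mark_state_def mark)
  also have "\<dots> = (\<integral>\<^sup>+x. \<integral>\<^sup>+\<omega>. (if crossing A \<omega> then \<integral>\<^sup>+s. F s \<partial>Q (mark_state (\<omega> i)) else 0) \<partial>P x \<partial>\<mu>)"
    by (rule nn_integral_P\<mu>) measurable
  also have "\<dots> = (\<integral>\<^sup>+x. \<integral>\<^sup>+\<omega>. (if crossing A \<omega> then F (V \<omega>) else 0) \<partial>P x \<partial>\<mu>)"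
  proof (rule nn_integral_cong)
    fix x assume "x \<in> space \<mu>"
    then have x: "x \<in> space X" by (simp add: space_\<mu>)
    have "(\<integral>\<^sup>+\<omega>. (if crossing A \<omega> then \<integral>\<^sup>+s. F s \<partial>Q (mark_state (\<omega> i)) else 0) \<partial>P x) =
        (\<integral>\<^sup>+\<omega>. (if crossing A \<omega> then \<integral>\<^sup>+s. F s \<partial>Q (Some (\<omega> i)) else 0) \<partial>P x)"
      by (rule nn_integral_cong_path[OF x]) (simp add: mark_state_def mark)
    also have "\<dots> = (\<integral>\<^sup>+\<omega>. (if crossing A \<omega> then F (case_nat (Some (\<omega> i)) (V (path_shift \<omega>))) else 0) \<partial>P x)"
      by (rule nn_integral_after_mark[OF F x, symmetric])
    also have "\<dots> = (\<integral>\<^sup>+\<omega>. (if crossing A \<omega> then F (V \<omega>) else 0) \<partial>P x)"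
      by (intro nn_integral_cong) (simp add: crossings_crossing)
    finally show "(\<integral>\<^sup>+\<omega>. (if crossing A \<omega> then \<integral>\<^sup>+s. F s \<partial>Q (mark_state (\<omega> i)) else 0) \<partial>P x) =
        (\<integral>\<^sup>+\<omega>. (if crossing A \<omega> then F (V \<omega>) else 0) \<partial>P x)" .
  qed
  also have "\<dots> = (\<integral>\<^sup>+\<omega>. (if crossing A \<omega> then F (V \<omega>) else 0) \<partial>P\<mu>)"
    by (rule nn_integral_P\<mu>[symmetric]) measurable
  finally show ?thesis .
qed

lemma AE_Law_iff:
  assumes q[measurable]: "Measurable.pred \<Omega>E q"
  shows "(AE s in Law. q s) \<longleftrightarrow> (AE \<omega> in P\<mu>. crossing A \<omega> \<longrightarrow> q (V \<omega>))"
proof -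
  have "(AE s in Law. q s) \<longleftrightarrow> (\<integral>\<^sup>+s. (if q s then 0 else 1) \<partial>Law) = 0"
    by (subst nn_integral_0_iff_AE) (auto intro!: arg_cong[where f="\<lambda>P. eventually P _"])
  also have "\<dots> \<longleftrightarrow> (\<integral>\<^sup>+\<omega>. (if crossing A \<omega> then (if q (V \<omega>) then 0 else 1) else 0) \<partial>P\<mu>) = 0"
    by (subst nn_integral_Law) auto
  also have "\<dots> \<longleftrightarrow> (AE \<omega> in P\<mu>. crossing A \<omega> \<longrightarrow> q (V \<omega>))"
    by (subst nn_integral_0_iff_AE) (auto intro!: arg_cong[where f="\<lambda>P. eventually P _"] simp: fun_eq_iff)
  finally show ?thesis .
qed

lemma AE_crosses_again: "AE \<omega> in P\<mu>. crossing A \<omega> \<longrightarrow> crosses A (path_shift \<omega>)"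
  using AE_crossing_infinitely_often[OF A]
proof eventually_elim
  fix \<omega> :: "nat \<Rightarrow> 'a" assume *: "crossing A \<omega> \<longrightarrow> (\<exists>\<^sub>\<infinity>n. crossing A ((path_shift ^^ n) \<omega>))"
  show "crossing A \<omega> \<longrightarrow> crosses A (path_shift \<omega>)"
  proof
    assume "crossing A \<omega>"
    with * obtain n where "n > 0" "crossing A ((path_shift ^^ n) \<omega>)" by (auto simp: INFM_nat)
    then show "crosses A (path_shift \<omega>)"
      unfolding crosses_def by (cases n) (auto simp: funpow_swap1)
  qed
qed

text \<open>The mark after one step of the embedded chain is the mark at the next crossing.
  Decomposing by the time of that crossing gives Kac's series for the crossings with mark in
  \<open>B\<close>; these are visits to the crossing set at time 0, so the hitting hypothesis is
  trivial.\<close>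

lemma invariant_marks: "invariant_measure E \<kappa> \<nu>E"
  unfolding invariant_measure_def
proof (intro conjI ballI)
  fix B assume B[measurable]: "B \<in> sets E"
  let ?C = "{\<omega> \<in> space \<Omega>. crossing A \<omega>}"
  let ?D = "{\<omega> \<in> space \<Omega>. crossing A \<omega> \<and> mark_state (\<omega> i) \<in> B}"
  let ?Z = "{\<omega> \<in> space \<Omega>. crossing A \<omega> \<and> V (path_shift \<omega>) 0 \<in> B}"
  let ?R = "\<lambda>n. {\<omega> \<in> space P\<mu>. \<omega> \<in> ?C \<and> (\<forall>k<n. (path_shift ^^ k) (path_shift \<omega>) \<notin> ?C) \<and>
    (path_shift ^^ n) (path_shift \<omega>) \<in> ?D}"
  have sets_D: "?D \<in> sets P\<mu>" and sets_C: "?C \<in> sets P\<mu>" and sets_Z: "?Z \<in> sets P\<mu>"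
    unfolding sets_P\<mu> by measurable
  have "(\<integral>\<^sup>+z. emeasure (\<kappa> z) B \<partial>\<nu>E) = (\<integral>\<^sup>+z. \<integral>\<^sup>+s. indicator B (s 1) \<partial>chain_law E \<kappa> z \<partial>\<nu>E)"
  proof (intro nn_integral_cong)
    fix z assume "z \<in> space \<nu>E"
    then have z: "z \<in> space E" by (simp add: space_\<nu>E)
    have "(\<integral>\<^sup>+s. indicator B (s 1) \<partial>chain_law E \<kappa> z) = (\<integral>\<^sup>+w. \<integral>\<^sup>+s. indicator B (s 0) \<partial>chain_law E \<kappa> w \<partial>\<kappa> z)"
      by (subst marks.chain_law_first_step[OF z]) auto
    also have "\<dots> = (\<integral>\<^sup>+w. indicator B w \<partial>\<kappa> z)"
      by (rule marks.nn_integral_cong_kernel[OF z], rule marks.nn_integral_chain_law_0) auto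
    also have "\<dots> = emeasure (\<kappa> z) B" by (simp add: marks.sets_kernel'[OF z])
    finally show "emeasure (\<kappa> z) B = (\<integral>\<^sup>+s. indicator B (s 1) \<partial>chain_law E \<kappa> z)" ..
  qed
  also have "\<dots> = (\<integral>\<^sup>+s. indicator B (s 1) \<partial>Law)"
    by (rule marks.nn_integral_chain_law_init[OF inclusion_\<nu>E, symmetric]) measurable
  also have "\<dots> = (\<integral>\<^sup>+\<omega>. (if crossing A \<omega> then indicator B (V \<omega> 1) else 0) \<partial>P\<mu>)"
    by (rule nn_integral_Law) measurable
  also have "\<dots> = (\<integral>\<^sup>+\<omega>. indicator ?Z \<omega> \<partial>P\<mu>)"
    by (intro nn_integral_cong) (auto simp: crossings_crossing space_P\<mu> indicator_def)
  also have "\<dots> = emeasure P\<mu> ?Z" by (rule nn_integral_indicator[OF sets_Z])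
  \<comment> \<open>Without a further crossing the next mark is \<open>None\<close>, which may
    belong to \<open>B\<close> but to no \<open>?R n\<close>. Almost every crossing is followed by
    another one, so the difference is null.\<close>
  also have "\<dots> = emeasure P\<mu> (\<Union>n. ?R n)"
  proof (rule emeasure_eq_AE)
    show "AE \<omega> in P\<mu>. \<omega> \<in> ?Z \<longleftrightarrow> \<omega> \<in> (\<Union>n. ?R n)"
      using AE_crosses_again AE_space
    proof eventually_elim
      fix \<omega> assume again: "crossing A \<omega> \<longrightarrow> crosses A (path_shift \<omega>)" and "\<omega> \<in> space P\<mu>"
      then have \<omega>: "\<omega> \<in> space \<Omega>" by (simp add: space_P\<mu>)
      have \<omega>': "(path_shift ^^ n) (path_shift \<omega>) \<in> space \<Omega>" for n
        using shift_path[OF \<omega>, of "Suc n"] by (simp add: funpow_swap1)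
      have R: "\<omega> \<in> ?R n \<longleftrightarrow> crossing A \<omega> \<and> first_crossing_at A n (path_shift \<omega>) \<and>
          Some ((path_shift ^^ n) (path_shift \<omega>) i) \<in> B" for n
        using \<omega> \<omega>' mark[OF \<omega>'[of n]] by (auto simp: space_P\<mu> first_crossing_at_def mark_state_def split: if_splits)
      show "\<omega> \<in> ?Z \<longleftrightarrow> \<omega> \<in> (\<Union>n. ?R n)"
      proof (cases "crossing A \<omega>")
        case True
        with again have c: "crosses A (path_shift \<omega>)" by simp
        have "\<omega> \<in> (\<Union>n. ?R n) \<longleftrightarrow>
            Some ((path_shift ^^ first_crossing A (path_shift \<omega>)) (path_shift \<omega>) i) \<in> B"
          unfolding UN_iff R first_crossing_at_iff using True c by blast
        also have "\<dots> \<longleftrightarrow> \<omega> \<in> ?Z"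
          using True c \<omega> by (simp add: crossings_crosses)
        finally show ?thesis by simp
      qed (simp add: R)
    qed
  next
    show "(\<Union>n. ?R n) \<in> sets P\<mu>" unfolding sets_P\<mu> space_P\<mu> by measurable
  qed (rule sets_Z)
  also have "\<dots> = (\<Sum>n. path.excursion ?C n ?D)"
    unfolding path.excursion_def
  proof (rule suminf_emeasure[symmetric])
    show "range ?R \<subseteq> sets P\<mu>" unfolding sets_P\<mu> space_P\<mu> by (auto, measurable)
    show "disjoint_family ?R"
      unfolding disjoint_family_on_def
    proof (intro ballI impI)
      fix m n :: nat assume "m \<noteq> n"
      then have "m < n \<or> n < m" by auto
      then show "?R m \<inter> ?R n = {}" by blast
    qed
  qed
  also have "\<dots> = emeasure P\<mu> ?D"
  proof (rule path.kac[symmetric, OF sets_C sets_D])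
    show "AE \<omega> in P\<mu>. \<omega> \<in> ?D \<longrightarrow> (\<exists>n. (path_shift ^^ n) \<omega> \<in> ?C)"
      by (rule AE_I2) (auto intro!: exI[of _ 0])
  qed
  also have "\<dots> = (\<integral>\<^sup>+\<omega>. indicator ?D \<omega> \<partial>P\<mu>)" by (rule nn_integral_indicator[symmetric, OF sets_D])
  also have "\<dots> = (\<integral>\<^sup>+\<omega>. (if crossing A \<omega> then indicator B (Some (\<omega> i)) else 0) \<partial>P\<mu>)"
    by (intro nn_integral_cong) (auto simp: space_P\<mu> indicator_def mark_state_def mark)
  also have "\<dots> = (\<integral>\<^sup>+z. indicator B z \<partial>\<nu>E)"
    by (rule nn_integral_\<nu>E[symmetric]) measurable
  also have "\<dots> = emeasure \<nu>E B" by (simp add: sets_\<nu>E)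
  finally show "(\<integral>\<^sup>+z. emeasure (\<kappa> z) B \<partial>\<nu>E) = emeasure \<nu>E B" .
qed (rule sets_\<nu>E)

text \<open>Conservativity brings the path back to a crossing with mark in \<open>B\<close>, and
  every crossing shows up in the sequence of marks. As it applies to all events, finiteness of the
  measure of \<open>B\<close> does not enter.\<close>

lemma recurrent_marks: "recurrent_measure E \<kappa> \<nu>E"
  unfolding recurrent_measure_def
proof (intro ballI impI)
  fix B assume B[measurable]: "B \<in> sets E"
  let ?W = "{\<omega> \<in> space \<Omega>. crossing A \<omega> \<and> mark_state (\<omega> i) \<in> B}"
  have "AE \<omega> in P\<mu>. \<omega> \<in> ?W \<longrightarrow> (\<exists>n\<ge>1. (path_shift ^^ n) \<omega> \<in> ?W)"
    by (rule P\<mu>_conservative) measurable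
  then have "AE \<omega> in P\<mu>. crossing A \<omega> \<longrightarrow> V \<omega> 0 \<in> B \<longrightarrow> (\<exists>n\<ge>1. V \<omega> n \<in> B)"
    using AE_space
  proof (eventually_elim, intro impI)
    fix \<omega> assume *: "\<omega> \<in> ?W \<longrightarrow> (\<exists>n\<ge>1. (path_shift ^^ n) \<omega> \<in> ?W)" and "\<omega> \<in> space P\<mu>"
      and c: "crossing A \<omega>" and "V \<omega> 0 \<in> B"
    then have "\<omega> \<in> ?W" using mark[of \<omega>] by (simp add: space_P\<mu> crossings_crossing mark_state_def)
    with * obtain n where n: "n \<ge> 1" "(path_shift ^^ n) \<omega> \<in> ?W" by auto
    then obtain m where m: "n = Suc m" by (cases n) auto
    \<comment> \<open>The return is viewed from the path shifted by one step, so its position in the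
      full sequence of marks is at least 1.\<close>
    have "crossing A ((path_shift ^^ m) (path_shift \<omega>))"
      using n(2) by (simp add: m funpow_swap1)
    from crossing_in_crossings[OF this, of i] obtain k where
      k: "V (path_shift \<omega>) k = Some ((path_shift ^^ n) \<omega> i)" by (auto simp: m funpow_swap1)
    also have "\<dots> \<in> B" using n(2) mark[of "(path_shift ^^ n) \<omega>"] by (auto simp: mark_state_def split: if_splits)
    finally show "\<exists>n\<ge>1. V \<omega> n \<in> B"
      using c by (intro exI[of _ "Suc k"]) (simp add: crossings_crossing)
  qed
  then have "AE s in Law. s 0 \<in> B \<longrightarrow> (\<exists>n\<ge>1. s n \<in> B)"
    by (subst AE_Law_iff) auto
  then have "AE z in \<nu>E. AE s in chain_law E \<kappa> z. s 0 \<in> B \<longrightarrow> (\<exists>n\<ge>1. s n \<in> B)"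
    by (subst (asm) marks.AE_chain_law_init[OF inclusion_\<nu>E]) auto
  then show "AE z in \<nu>E. z \<in> B \<longrightarrow> (AE s in chain_law E \<kappa> z. \<exists>n\<ge>1. s n \<in> B)"
    using AE_space
  proof (eventually_elim, intro impI)
    fix z assume *: "AE s in chain_law E \<kappa> z. s 0 \<in> B \<longrightarrow> (\<exists>n\<ge>1. s n \<in> B)"
      and "z \<in> space \<nu>E" and zB: "z \<in> B"
    then have z: "z \<in> space E" by (simp add: space_\<nu>E)
    have "AE s in chain_law E \<kappa> z. s 0 \<in> B"
      by (rule marks.AE_chain_law_start[OF z]) (use zB in auto)
    with * show "AE s in chain_law E \<kappa> z. \<exists>n\<ge>1. s n \<in> B" by eventually_elim simp
  qed
qed

text \<open>The paths whose marks form a sequence in \<open>S\<close> are invariant under the path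
  shift: at a crossing by invariance of \<open>S\<close>, elsewhere because the marks do not change.
  Ergodicity of the path shift then decides \<open>S\<close>.\<close>

lemma ergodic_marks:
  assumes irr: "irreducible_measure X K \<mu>"
  shows "ergodic_measure E \<kappa> \<nu>E"
  unfolding ergodic_measure_def
proof (intro ballI impI)
  fix S assume S[measurable]: "S \<in> sets \<Omega>E"
    and inv: "emeasure Law (sym_diff (path_shift -` S \<inter> space \<Omega>E) S) = 0"
  have "path_shift -` S \<inter> space \<Omega>E \<in> sets \<Omega>E"
    using measurable_sets[OF measurable_path_shift S] .
  then have "sym_diff (path_shift -` S \<inter> space \<Omega>E) S \<in> null_sets Law"
    using inv by (auto simp: null_sets_def sets_Law)
  then have "AE s in Law. s \<notin> sym_diff (path_shift -` S \<inter> space \<Omega>E) S"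
    by (rule AE_not_in)
  then have "AE s in Law. path_shift s \<in> S \<longleftrightarrow> s \<in> S"
    using AE_space by eventually_elim (auto simp: space_Law)
  then have "AE \<omega> in P\<mu>. crossing A \<omega> \<longrightarrow> (path_shift (V \<omega>) \<in> S \<longleftrightarrow> V \<omega> \<in> S)"
    by (subst (asm) AE_Law_iff) auto
  then have "AE \<omega> in P\<mu>. V (path_shift \<omega>) \<in> S \<longleftrightarrow> V \<omega> \<in> S"
  proof eventually_elim
    fix \<omega> :: "nat \<Rightarrow> 'a" assume *: "crossing A \<omega> \<longrightarrow> (path_shift (V \<omega>) \<in> S \<longleftrightarrow> V \<omega> \<in> S)"
    show "V (path_shift \<omega>) \<in> S \<longleftrightarrow> V \<omega> \<in> S"
    proof (cases "crossing A \<omega>")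
      case True
      then have "path_shift (V \<omega>) = V (path_shift \<omega>)" by (simp add: crossings_crossing)
      then show ?thesis using * True by simp
    qed (simp add: crossings_not_crossing)
  qed
  then have "AE \<omega> in P\<mu>. path_shift \<omega> \<in> {\<omega> \<in> space \<Omega>. V \<omega> \<in> S} \<longleftrightarrow> \<omega> \<in> {\<omega> \<in> space \<Omega>. V \<omega> \<in> S}"
    using AE_space
    by eventually_elim (auto simp: space_P\<mu> intro: measurable_space[OF measurable_path_shift])
  from irreducible_shift_ergodic[OF irr _ this]
  consider "AE \<omega> in P\<mu>. \<omega> \<in> {\<omega> \<in> space \<Omega>. V \<omega> \<in> S}" | "AE \<omega> in P\<mu>. \<omega> \<notin> {\<omega> \<in> space \<Omega>. V \<omega> \<in> S}"
    by fastforce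
  then show "emeasure Law S = 0 \<or> emeasure Law (space \<Omega>E - S) = 0"
  proof cases
    case 1
    then have "AE \<omega> in P\<mu>. crossing A \<omega> \<longrightarrow> V \<omega> \<in> S" by eventually_elim simp
    then have "AE s in Law. s \<in> S" by (subst AE_Law_iff) auto
    then have "AE s in Law. s \<notin> space \<Omega>E - S" by eventually_elim simp
    then have "space \<Omega>E - S \<in> null_sets Law"
      by (rule AE_iff_null_sets[THEN iffD2, rotated]) (simp add: sets_Law)
    then show ?thesis by (simp add: null_sets_def)
  next
    case 2
    then have "AE \<omega> in P\<mu>. crossing A \<omega> \<longrightarrow> V \<omega> \<notin> S"
      using AE_space by eventually_elim (simp add: space_P\<mu>)
    then have "AE s in Law. s \<notin> S" by (subst AE_Law_iff) auto
    then have "S \<in> null_sets Law"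
      by (rule AE_iff_null_sets[THEN iffD2, rotated]) (simp add: sets_Law)
    then show ?thesis by (simp add: null_sets_def)
  qed
qed

end

section \<open>The entrance and exit chains\<close>

context markov_kernel
begin

text \<open>The common computation for both chains: a crossing at time 0 is a transition from
  outside \<open>A\<close> into \<open>A\<close>, and the path from the entrance on has law
  \<open>P y\<close>.\<close>

lemma nn_integral_crossing:
  assumes x: "x \<in> space X" and [measurable]: "A \<in> sets X"
    and G[measurable]: "(\<lambda>(y, \<omega>). G y \<omega>) \<in> borel_measurable (X \<Otimes>\<^sub>M \<Omega>)"
  shows "(\<integral>\<^sup>+\<omega>. (if crossing A \<omega> then G (\<omega> 1) (path_shift \<omega>) else 0) \<partial>P x) =
    (\<integral>\<^sup>+y. (if x \<notin> A \<and> y \<in> A then \<integral>\<^sup>+\<omega>. G y \<omega> \<partial>P y else 0) \<partial>K x)"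
proof -
  have "(\<integral>\<^sup>+\<omega>. (if crossing A \<omega> then G (\<omega> 1) (path_shift \<omega>) else 0) \<partial>P x) =
      (\<integral>\<^sup>+y. \<integral>\<^sup>+\<omega>. (if x \<notin> A \<and> \<omega> 0 \<in> A then G (\<omega> 0) \<omega> else 0) \<partial>P y \<partial>K x)"
    by (subst chain_law_first_step[OF x]) (auto simp: crossing_case_nat cong: if_cong)
  also have "\<dots> = (\<integral>\<^sup>+y. (if x \<notin> A \<and> y \<in> A then \<integral>\<^sup>+\<omega>. G y \<omega> \<partial>P y else 0) \<partial>K x)"
  proof (rule nn_integral_cong_kernel[OF x])
    fix y assume y: "y \<in> space X"
    show "(\<integral>\<^sup>+\<omega>. (if x \<notin> A \<and> \<omega> 0 \<in> A then G (\<omega> 0) \<omega> else 0) \<partial>P y) =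
        (if x \<notin> A \<and> y \<in> A then \<integral>\<^sup>+\<omega>. G y \<omega> \<partial>P y else 0)"
      by (subst nn_integral_chain_law_start[OF y, of "\<lambda>z \<omega>. if x \<notin> A \<and> z \<in> A then G z \<omega> else 0"]) auto
  qed
  finally show ?thesis .
qed

lemma sets_exit_set [measurable]:
  assumes [measurable]: "A \<in> sets X"
  shows "exit_set X K A \<in> sets X"
  unfolding exit_set_def by measurable

lemma AE_crossing_exit_set:
  assumes x: "x \<in> space X" and A[measurable]: "A \<in> sets X"
  shows "AE \<omega> in P x. crossing A \<omega> \<longrightarrow> \<omega> 0 \<in> exit_set X K A"
proof (cases "x \<in> exit_set X K A \<or> x \<in> A")
  case True
  have "AE \<omega> in P x. \<omega> 0 \<in> exit_set X K A \<or> \<omega> 0 \<in> A"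
    by (rule AE_chain_law_start[OF x]) (use True in auto)
  then show ?thesis by eventually_elim (auto simp: crossing_def)
next
  case False
  then have K0: "emeasure (K x) A = 0" using x by (auto simp: exit_set_def)
  have "(\<integral>\<^sup>+\<omega>. (if crossing A \<omega> then 1 else 0) \<partial>P x) =
      (\<integral>\<^sup>+y. (if x \<notin> A \<and> y \<in> A then \<integral>\<^sup>+\<omega>. 1 \<partial>P y else 0) \<partial>K x)"
    by (rule nn_integral_crossing[OF x A, of "\<lambda>_ _. 1"]) measurable
  also have "\<dots> \<le> (\<integral>\<^sup>+y. indicator A y \<partial>K x)"
    by (rule nn_integral_mono) (auto simp: indicator_def space_kernel[OF x] space_chain_law emeasure_chain_law_space)
  also have "\<dots> = 0" using K0 by (simp add: sets_kernel'[OF x])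
  finally have "(\<integral>\<^sup>+\<omega>. (if crossing A \<omega> then 1 else 0 :: ennreal) \<partial>P x) = 0" by simp
  then have "AE \<omega> in P x. (if crossing A \<omega> then 1 else 0 :: ennreal) = 0"
    by (subst (asm) nn_integral_0_iff_AE) (auto simp: x)
  then show ?thesis by eventually_elim (auto split: if_splits)
qed

text \<open>Here the mark already is the first state of the continuation, so nothing has to be
  resampled between them and \<open>R y\<close> reduces to \<open>P y\<close>.\<close>

lemma entrance_marked_crossings:
  assumes A[measurable]: "A \<in> sets X"
  shows "marked_crossings X K A 1 A A (return X) (entr_kernel X K A)"
proof (unfold_locales)
  show "return X \<in> X \<rightarrow>\<^sub>M prob_algebra X" by measurable
  show "AE \<omega> in P y. crossing A \<omega> \<longrightarrow> \<omega> 1 \<in> A" for y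
    by (simp add: crossing_def)
  have R: "return X y \<bind> P = P y" if "y \<in> space X" for y
    by (rule bind_return[OF measurable_chain_law that])
  show "(\<integral>\<^sup>+\<omega>. (if crossing A \<omega> then G (\<omega> 1) (path_shift \<omega>) else 0) \<partial>P y) =
      (\<integral>\<^sup>+\<omega>. (if crossing A \<omega> then \<integral>\<^sup>+\<omega>'. G (\<omega> 1) \<omega>' \<partial>(return X (\<omega> 1) \<bind> P) else 0) \<partial>P y)"
    if y: "y \<in> space X" and G[measurable]: "(\<lambda>(x, \<omega>). G x \<omega>) \<in> borel_measurable (X \<Otimes>\<^sub>M \<Omega>)" for y G
  proof -
    have [measurable]: "(\<lambda>x. \<integral>\<^sup>+\<omega>. G x \<omega> \<partial>P x) \<in> borel_measurable X"
      by (rule measurable_path_integral[OF G])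
    have [measurable]: "(\<lambda>(x, \<omega>). \<integral>\<^sup>+\<omega>'. G x \<omega>' \<partial>P x) \<in> borel_measurable (X \<Otimes>\<^sub>M \<Omega>)"
      unfolding split_beta by (rule measurable_compose[OF measurable_fst]) measurable
    have "(\<integral>\<^sup>+\<omega>. (if crossing A \<omega> then \<integral>\<^sup>+\<omega>'. G (\<omega> 1) \<omega>' \<partial>(return X (\<omega> 1) \<bind> P) else 0) \<partial>P y) =
        (\<integral>\<^sup>+\<omega>. (if crossing A \<omega> then \<integral>\<^sup>+\<omega>'. G (\<omega> 1) \<omega>' \<partial>P (\<omega> 1) else 0) \<partial>P y)"
      by (rule nn_integral_cong_path[OF y]) (simp add: R path_component)
    also have "\<dots> = (\<integral>\<^sup>+z. (if y \<notin> A \<and> z \<in> A then \<integral>\<^sup>+\<omega>. (\<integral>\<^sup>+\<omega>'. G z \<omega>' \<partial>P z) \<partial>P z else 0) \<partial>K y)"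
      by (rule nn_integral_crossing[OF y A]) measurable
    also have "\<dots> = (\<integral>\<^sup>+z. (if y \<notin> A \<and> z \<in> A then \<integral>\<^sup>+\<omega>. G z \<omega> \<partial>P z else 0) \<partial>K y)"
      by (rule nn_integral_cong_kernel[OF y]) (simp add: space_chain_law emeasure_chain_law_space)
    also have "\<dots> = (\<integral>\<^sup>+\<omega>. (if crossing A \<omega> then G (\<omega> 1) (path_shift \<omega>) else 0) \<partial>P y)"
      by (rule nn_integral_crossing[OF y A G, symmetric])
    finally show ?thesis ..
  qed
  show "entr_kernel X K A None = return (cemetery_space (restrict_space X A)) None"
    by (simp add: entr_kernel_def entr_space_def)
  show "entr_kernel X K A (Some y) =
      distr (return X y \<bind> P) (cemetery_space (restrict_space X A)) (\<lambda>\<omega>. crossings A 1 \<omega> 0)" if "y \<in> A" for y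
  proof -
    have "y \<in> space X" using that sets.sets_into_space[OF A] by auto
    moreover have "entr_chain A 1 = (\<lambda>\<omega>. crossings A 1 \<omega> 0)"
      using entr_chain_Suc[of A 0] by auto
    ultimately show ?thesis by (simp add: entr_kernel_def entr_space_def R)
  qed
qed (auto simp: crossing_def)

lemma measurable_exit_transition:
  assumes A[measurable]: "A \<in> sets X"
  shows "(\<lambda>y. if y \<in> exit_set X K A then uniform_measure (K y) A else K y) \<in> X \<rightarrow>\<^sub>M prob_algebra X"
proof (rule measurable_prob_algebraI)
  let ?U = "\<lambda>y. if y \<in> exit_set X K A then uniform_measure (K y) A else K y"
  show prob: "prob_space (?U y)" if "y \<in> space X" for y
  proof (cases "y \<in> exit_set X K A")
    case True
    interpret prob_space "K y" by (rule prob_space_kernel[OF that])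
    have "emeasure (K y) A \<noteq> 0" "emeasure (K y) A \<noteq> \<infinity>" using True by (auto simp: exit_set_def)
    then show ?thesis using True by (simp add: prob_space_uniform_measure)
  qed (simp add: prob_space_kernel that)
  show "?U \<in> X \<rightarrow>\<^sub>M subprob_algebra X"
  proof (rule measurable_subprob_algebra)
    show "subprob_space (?U y)" if "y \<in> space X" for y
      by (rule prob_space_imp_subprob_space[OF prob[OF that]])
    show "sets (?U y) = sets X" if "y \<in> space X" for y
      by (simp add: sets_kernel' that)
    fix B assume B[measurable]: "B \<in> sets X"
    have "(\<lambda>y. if y \<in> exit_set X K A then emeasure (K y) (A \<inter> B) / emeasure (K y) A else emeasure (K y) B)
        \<in> borel_measurable X" by measurable
    then show "(\<lambda>y. emeasure (?U y) B) \<in> borel_measurable X"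
      by (rule measurable_cong[THEN iffD1, rotated])
        (auto simp: emeasure_uniform_measure sets_kernel')
  qed
qed

lemma exit_marked_crossings:
  assumes A[measurable]: "A \<in> sets X"
  shows "marked_crossings X K A 0 (space X - A) (exit_set X K A)
    (\<lambda>y. if y \<in> exit_set X K A then uniform_measure (K y) A else K y) (exit_kernel X K A)"
    (is "marked_crossings X K A 0 ?D ?L ?U _")
proof (unfold_locales)
  show U: "?U \<in> X \<rightarrow>\<^sub>M prob_algebra X" by (rule measurable_exit_transition[OF A])
  show "?L \<subseteq> ?D" by (auto simp: exit_set_def)
  show "AE \<omega> in P y. crossing A \<omega> \<longrightarrow> \<omega> 0 \<in> ?L" if "y \<in> space X" for y
    by (rule AE_crossing_exit_set[OF that A])
  show "exit_kernel X K A None = return (cemetery_space (restrict_space X ?D)) None"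
    by (simp add: exit_kernel_def exit_space_def)
  show "exit_kernel X K A (Some y) = return (cemetery_space (restrict_space X ?D)) None"
    if "y \<notin> ?L" for y
    using that by (simp add: exit_kernel_def exit_space_def)
  have sets_U: "sets (?U y) = sets X" and prob_U: "prob_space (?U y)" if "y \<in> space X" for y
    using measurable_space[OF U that] by (simp_all add: space_prob_algebra)
  have P_U: "P \<in> ?U y \<rightarrow>\<^sub>M subprob_algebra \<Omega>" if "y \<in> space X" for y
    using measurable_chain_law by (simp only: measurable_cong_sets[OF sets_U[OF that] refl])
  show "exit_kernel X K A (Some y) = distr (?U y \<bind> P)
      (cemetery_space (restrict_space X ?D)) (\<lambda>\<omega>. crossings A 0 \<omega> 0)" if yL: "y \<in> ?L" for y
  proof -
    have y: "y \<in> space X" using yL by (auto simp: exit_set_def)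
    have V: "(\<lambda>\<omega>. crossings A 0 \<omega> 0) \<in> \<Omega> \<rightarrow>\<^sub>M cemetery_space (restrict_space X ?D)"
      using measurable_crossing_seq[OF A, of ?D 0 0]
      by (simp add: crossings_def crossing_def path_component del: crossing_seq.simps)
    have "exit_chain A 1 = (\<lambda>\<omega>. crossings A 0 \<omega> 0)"
      using exit_chain_Suc[of A 0] by auto
    then show ?thesis
      using distr_bind[OF P_U[OF y] prob_space.not_empty[OF prob_U[OF y]] V] yL
      by (simp add: exit_kernel_def exit_space_def)
  qed
  show "(\<integral>\<^sup>+\<omega>. (if crossing A \<omega> then G (\<omega> 0) (path_shift \<omega>) else 0) \<partial>P y) =
      (\<integral>\<^sup>+\<omega>. (if crossing A \<omega> then \<integral>\<^sup>+\<omega>'. G (\<omega> 0) \<omega>' \<partial>(?U (\<omega> 0) \<bind> P) else 0) \<partial>P y)"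
    if y: "y \<in> space X" and G[measurable]: "(\<lambda>(x, \<omega>). G x \<omega>) \<in> borel_measurable (X \<Otimes>\<^sub>M \<Omega>)" for y G
  proof -
    \<comment> \<open>The mark of the exit chain is the starting state, so under \<open>P y\<close>
      it is the constant \<open>y\<close> and can be frozen before the first step is
      integrated.\<close>
    have swap: "(\<integral>\<^sup>+\<omega>. (if crossing A \<omega> then F (\<omega> 0) (path_shift \<omega>) else 0) \<partial>P y) =
        (\<integral>\<^sup>+z. (if y \<notin> A \<and> z \<in> A then \<integral>\<^sup>+\<omega>. F y \<omega> \<partial>P z else 0) \<partial>K y)"
      if F[measurable]: "(\<lambda>(x, \<omega>). F x \<omega>) \<in> borel_measurable (X \<Otimes>\<^sub>M \<Omega>)" for F :: "_ \<Rightarrow> _ \<Rightarrow> ennreal"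
    proof -
      have Fy[measurable]: "F y \<in> borel_measurable \<Omega>" using y by measurable
      have "(\<integral>\<^sup>+\<omega>. (if crossing A \<omega> then F (\<omega> 0) (path_shift \<omega>) else 0) \<partial>P y) =
          (\<integral>\<^sup>+\<omega>. (if crossing A \<omega> then F y (path_shift \<omega>) else 0) \<partial>P y)"
        by (rule nn_integral_chain_law_start[OF y, of "\<lambda>x \<omega>. if crossing A \<omega> then F x (path_shift \<omega>) else 0"])
          measurable
      also have "\<dots> = (\<integral>\<^sup>+z. (if y \<notin> A \<and> z \<in> A then \<integral>\<^sup>+\<omega>. F y \<omega> \<partial>P z else 0) \<partial>K y)"
        by (rule nn_integral_crossing[OF y A, of "\<lambda>_. F y"]) measurable
      finally show ?thesis .
    qed
    have [measurable]: "(\<lambda>x. ?U x \<bind> P) \<in> X \<rightarrow>\<^sub>M subprob_algebra \<Omega>"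
      by (intro measurable_prob_algebraD measurable_bind_prob_space[OF U chain_law_measurable])
    have h: "(\<lambda>x. \<integral>\<^sup>+\<omega>. G x \<omega> \<partial>(?U x \<bind> P)) \<in> borel_measurable X"
      by (rule nn_integral_measurable_subprob_algebra2[OF G]) measurable
    have h2: "(\<lambda>(x, \<omega>). \<integral>\<^sup>+\<omega>'. G x \<omega>' \<partial>(?U x \<bind> P)) \<in> borel_measurable (X \<Otimes>\<^sub>M \<Omega>)"
      unfolding split_beta by (rule measurable_compose[OF measurable_fst h])
    have Gy[measurable]: "G y \<in> borel_measurable \<Omega>" using y by measurable
    let ?g = "\<lambda>z. \<integral>\<^sup>+\<omega>. G y \<omega> \<partial>P z"
    have RHS: "(\<integral>\<^sup>+\<omega>. (if crossing A \<omega> then \<integral>\<^sup>+\<omega>'. G (\<omega> 0) \<omega>' \<partial>(?U (\<omega> 0) \<bind> P) else 0) \<partial>P y) =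
        (\<integral>\<^sup>+z. (if y \<notin> A \<and> z \<in> A then \<integral>\<^sup>+\<omega>. (\<integral>\<^sup>+\<omega>'. G y \<omega>' \<partial>(?U y \<bind> P)) \<partial>P z else 0) \<partial>K y)"
      by (rule swap[OF h2])
    also have "\<dots> = (\<integral>\<^sup>+z. (if y \<notin> A then (\<integral>\<^sup>+\<omega>'. G y \<omega>' \<partial>(?U y \<bind> P)) * indicator A z else 0) \<partial>K y)"
      by (rule nn_integral_cong_kernel[OF y]) (simp add: space_chain_law emeasure_chain_law_space)
    also have "\<dots> = (if y \<notin> A then (\<integral>\<^sup>+\<omega>'. G y \<omega>' \<partial>(?U y \<bind> P)) * emeasure (K y) A else 0)"
      by (simp add: nn_integral_cmult y sets_kernel')
    also have "\<dots> = (if y \<notin> A then (\<integral>\<^sup>+z. ?g z \<partial>?U y) * emeasure (K y) A else 0)"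
      using nn_integral_bind[OF Gy P_U[OF y]] by simp
    \<comment> \<open>Multiplying by the probability of entering \<open>A\<close> undoes the
      normalisation of the conditional law. Where this probability is 0, both sides vanish.\<close>
    also have "\<dots> = (if y \<notin> A then (\<integral>\<^sup>+z. ?g z * indicator A z \<partial>K y) else 0)"
    proof (cases "y \<in> ?L")
      case True
      then have nz: "emeasure (K y) A \<noteq> 0" by (auto simp: exit_set_def)
      have fin: "emeasure (K y) A \<noteq> \<infinity>"
        using finite_measure.emeasure_finite[of "K y" A] prob_space_kernel[OF y] by (simp add: prob_space_def)
      have "(\<integral>\<^sup>+z. ?g z \<partial>?U y) = (\<integral>\<^sup>+z. ?g z * indicator A z \<partial>K y) / emeasure (K y) A"
        using True y by (simp add: nn_integral_uniform_measure sets_kernel')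
      then show ?thesis using nz fin by (simp add: ennreal_divide_times ennreal_divide_self less_top)
    next
      case False
      have "(\<integral>\<^sup>+z. ?g z * indicator A z \<partial>K y) = 0" "emeasure (K y) A = 0" if "y \<notin> A"
      proof -
        show K0: "emeasure (K y) A = 0" using False that y by (auto simp: exit_set_def)
        then have "AE z in K y. z \<notin> A" by (intro AE_not_in) (simp add: null_sets_def sets_kernel' y)
        then have "AE z in K y. ?g z * indicator A z = 0" by eventually_elim simp
        then show "(\<integral>\<^sup>+z. ?g z * indicator A z \<partial>K y) = 0"
          by (subst nn_integral_0_iff_AE) (auto simp: y)
      qed
      then show ?thesis by simp
    qed
    also have "\<dots> = (\<integral>\<^sup>+z. (if y \<notin> A \<and> z \<in> A then ?g z else 0) \<partial>K y)"
      by (auto intro!: nn_integral_cong simp: indicator_def)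
    also have "\<dots> = (\<integral>\<^sup>+\<omega>. (if crossing A \<omega> then G (\<omega> 0) (path_shift \<omega>) else 0) \<partial>P y)"
      by (rule swap[OF G, symmetric])
    finally show ?thesis ..
  qed
qed (auto simp: crossing_def path_component)

end

lemma hit_time_eq_infinity_iff: "hit_time B \<omega> = \<infinity> \<longleftrightarrow> (\<forall>n\<ge>1. \<omega> n \<notin> B)"
proof
  assume "hit_time B \<omega> = \<infinity>"
  then have "\<not> hit_time B \<omega> \<le> enat m" for m by simp
  then show "\<forall>n\<ge>1. \<omega> n \<notin> B" unfolding hit_time_def Inf_enat_le_iff by blast
next
  assume "\<forall>n\<ge>1. \<omega> n \<notin> B"
  then have "\<not> hit_time B \<omega> \<le> enat m" for m unfolding hit_time_def Inf_enat_le_iff by blast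
  then show "hit_time B \<omega> = \<infinity>" by (cases "hit_time B \<omega>") auto
qed

lemma crossing_between:
  assumes "\<omega> n \<notin> A" "\<omega> m \<in> A" "n < m"
  shows "\<exists>k. crossing A ((path_shift ^^ k) \<omega>)"
proof -
  \<comment> \<open>The first visit to \<open>A\<close> after time \<open>n\<close>; the time just
    before it is either \<open>n\<close> or a time without visit, hence outside
    \<open>A\<close>.\<close>
  define l where "l = (LEAST l. n < l \<and> \<omega> l \<in> A)"
  have l: "n < l" "\<omega> l \<in> A" using LeastI[of "\<lambda>l. n < l \<and> \<omega> l \<in> A" m] assms by (auto simp: l_def)
  then obtain k where k: "l = Suc k" by (cases l) auto
  have "\<omega> k \<notin> A"
  proof
    assume "\<omega> k \<in> A"
    with assms l k have "n < k" by (metis less_Suc_eq)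
    with \<open>\<omega> k \<in> A\<close> have "l \<le> k" unfolding l_def by (intro Least_le) auto
    then show False using k by simp
  qed
  then show ?thesis using l k by (intro exI[of _ k]) (simp add: crossing_def path_shift_funpow)
qed

section \<open>Entrance and exit measures as laws of the marks of a crossing\<close>

context recurrent_chain
begin

context
  fixes A assumes A [measurable]: "A \<in> sets X"
begin

lemma sets_exit_measure: "sets (exit_measure X K A \<mu>) = sets (restrict_space X (space X - A))"
  by (simp add: exit_measure_def sets_restrict_space sets_\<mu>)

lemma nn_integral_exit_measure_kernel:
  assumes f[measurable]: "f \<in> borel_measurable X"
  shows "(\<integral>\<^sup>+x. f x \<partial>exit_measure X K A \<mu>) =
    (\<integral>\<^sup>+x. emeasure (K x) A * f x * indicator (space X - A) x \<partial>\<mu>)"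
proof -
  have "(\<integral>\<^sup>+x. f x \<partial>exit_measure X K A \<mu>) =
      (\<integral>\<^sup>+x. emeasure (K x) A * f x \<partial>restrict_space \<mu> (space X - A))"
    unfolding exit_measure_def
    by (rule nn_integral_density) (auto intro!: measurable_restrict_space1 simp: measurable_cong_sets[OF sets_\<mu> refl])
  then show ?thesis
    by (subst (asm) nn_integral_restrict_space) (simp_all add: space_\<mu> sets_\<mu>)
qed

lemma nn_integral_exit_measure:
  assumes f[measurable]: "f \<in> borel_measurable X"
  shows "(\<integral>\<^sup>+x. f x \<partial>exit_measure X K A \<mu>) = (\<integral>\<^sup>+\<omega>. (if crossing A \<omega> then f (\<omega> 0) else 0) \<partial>P\<mu>)"
proof -
  have "(\<integral>\<^sup>+x. f x \<partial>exit_measure X K A \<mu>) =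
      (\<integral>\<^sup>+x. \<integral>\<^sup>+\<omega>. (if crossing A \<omega> then f (\<omega> 0) else 0) \<partial>P x \<partial>\<mu>)"
    unfolding nn_integral_exit_measure_kernel[OF f]
  proof (rule nn_integral_cong)
    fix x assume "x \<in> space \<mu>"
    then have x: "x \<in> space X" by (simp add: space_\<mu>)
    have "(\<integral>\<^sup>+\<omega>. (if crossing A \<omega> then f (\<omega> 0) else 0) \<partial>P x) =
        (\<integral>\<^sup>+\<omega>. (if crossing A \<omega> then f x else 0) \<partial>P x)"
      by (rule nn_integral_chain_law_start[OF x, of "\<lambda>y \<omega>. if crossing A \<omega> then f y else 0"]) measurable
    also have "\<dots> = (\<integral>\<^sup>+y. (if x \<notin> A \<and> y \<in> A then \<integral>\<^sup>+\<omega>. f x \<partial>P y else 0) \<partial>K x)"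
      by (rule nn_integral_crossing[OF x A, of "\<lambda>_ _. f x"]) measurable
    also have "\<dots> = (\<integral>\<^sup>+y. (if x \<notin> A then f x * indicator A y else 0) \<partial>K x)"
      by (rule nn_integral_cong_kernel[OF x]) (simp add: space_chain_law emeasure_chain_law_space)
    finally show "emeasure (K x) A * f x * indicator (space X - A) x =
        (\<integral>\<^sup>+\<omega>. (if crossing A \<omega> then f (\<omega> 0) else 0) \<partial>P x)"
      using x by (cases "x \<in> A") (simp_all add: nn_integral_cmult sets_kernel' mult.commute)
  qed
  also have "\<dots> = (\<integral>\<^sup>+\<omega>. (if crossing A \<omega> then f (\<omega> 0) else 0) \<partial>P\<mu>)"
    by (rule nn_integral_P\<mu>[symmetric]) measurable
  finally show ?thesis .
qed

lemma exit_marked_measure: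
  "marked_measure X K A 0 (space X - A) (exit_set X K A)
    (\<lambda>y. if y \<in> exit_set X K A then uniform_measure (K y) A else K y) (exit_kernel X K A) \<mu>
    (exit_measure X K A \<mu>)"
  by (intro marked_measure.intro marked_measure_axioms.intro exit_marked_crossings A
      recurrent_chain_axioms sets_exit_measure nn_integral_exit_measure)

end

context
  fixes A assumes A [measurable]: "A \<in> sets X" and cross: "emeasure P\<mu> {\<omega> \<in> space \<Omega>. crossing A \<omega>} > 0"
begin

text \<open>Ensures that the measures restricted to \<open>A\<close> and to its complement have
  nonempty spaces, so that binding them to a kernel is meaningful.\<close>

lemma A_nonempty: "A \<noteq> {}" "space X - A \<noteq> {}"
proof -
  have "{\<omega> \<in> space \<Omega>. crossing A \<omega>} \<noteq> {}" using cross by (metis emeasure_empty less_irrefl)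
  then obtain \<omega> where "\<omega> \<in> space \<Omega>" "\<omega> 0 \<notin> A" "\<omega> 1 \<in> A" by (auto simp: crossing_def)
  then show "A \<noteq> {}" "space X - A \<noteq> {}" using path_component by blast+
qed

lemma A_subset: "A \<subseteq> space X"
  by (rule sets.sets_into_space[OF A])

lemma sets_entr_measure: "sets (entr_measure X K A \<mu>) = sets (restrict_space X A)"
  and nn_integral_entr_measure: "f \<in> borel_measurable X \<Longrightarrow> (\<integral>\<^sup>+x. f x \<partial>entr_measure X K A \<mu>) =
    (\<integral>\<^sup>+\<omega>. (if crossing A \<omega> then f (\<omega> 1) else 0) \<partial>P\<mu>)"
proof -
  let ?\<mu> = "restrict_space \<mu> (space X - A)"
  have K: "K \<in> ?\<mu> \<rightarrow>\<^sub>M subprob_algebra X"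
    by (rule measurable_restrict_space1) measurable
  have ne: "space ?\<mu> \<noteq> {}" using A_nonempty by (auto simp: space_restrict_space space_\<mu>)
  have sets: "sets (?\<mu> \<bind> K) = sets X"
    by (rule sets_bind[OF _ ne]) (simp add: space_restrict_space space_\<mu> sets_kernel')
  show "sets (entr_measure X K A \<mu>) = sets (restrict_space X A)"
    unfolding entr_measure_def by (simp add: sets_restrict_space sets)
  assume f[measurable]: "f \<in> borel_measurable X"
  have "(\<integral>\<^sup>+x. f x \<partial>entr_measure X K A \<mu>) = (\<integral>\<^sup>+x. f x * indicator A x \<partial>(?\<mu> \<bind> K))"
    unfolding entr_measure_def using A_subset
    by (intro nn_integral_restrict_space) (simp add: sets sets_eq_imp_space_eq[OF sets] Int_absorb2)
  also have "\<dots> = (\<integral>\<^sup>+x. \<integral>\<^sup>+y. f y * indicator A y \<partial>K x \<partial>?\<mu>)"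
    by (rule nn_integral_bind[OF _ K]) measurable
  also have "\<dots> = (\<integral>\<^sup>+x. (\<integral>\<^sup>+y. f y * indicator A y \<partial>K x) * indicator (space X - A) x \<partial>\<mu>)"
    by (rule nn_integral_restrict_space) (simp add: space_\<mu> sets_\<mu>)
  also have "\<dots> = (\<integral>\<^sup>+x. \<integral>\<^sup>+\<omega>. (if crossing A \<omega> then f (\<omega> 1) else 0) \<partial>P x \<partial>\<mu>)"
  proof (rule nn_integral_cong)
    fix x assume "x \<in> space \<mu>"
    then have x: "x \<in> space X" by (simp add: space_\<mu>)
    have "(\<integral>\<^sup>+\<omega>. (if crossing A \<omega> then f (\<omega> 1) else 0) \<partial>P x) =
        (\<integral>\<^sup>+y. (if x \<notin> A \<and> y \<in> A then \<integral>\<^sup>+\<omega>. f y \<partial>P y else 0) \<partial>K x)"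
      by (rule nn_integral_crossing[OF x A, of "\<lambda>y _. f y"]) measurable
    also have "\<dots> = (\<integral>\<^sup>+y. (if x \<notin> A then f y * indicator A y else 0) \<partial>K x)"
      by (rule nn_integral_cong_kernel[OF x]) (simp add: space_chain_law emeasure_chain_law_space)
    finally show "(\<integral>\<^sup>+y. f y * indicator A y \<partial>K x) * indicator (space X - A) x =
        (\<integral>\<^sup>+\<omega>. (if crossing A \<omega> then f (\<omega> 1) else 0) \<partial>P x)"
      using x by (simp add: indicator_def)
  qed
  also have "\<dots> = (\<integral>\<^sup>+\<omega>. (if crossing A \<omega> then f (\<omega> 1) else 0) \<partial>P\<mu>)"
    by (rule nn_integral_P\<mu>[symmetric]) measurable
  finally show "(\<integral>\<^sup>+x. f x \<partial>entr_measure X K A \<mu>) =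
    (\<integral>\<^sup>+\<omega>. (if crossing A \<omega> then f (\<omega> 1) else 0) \<partial>P\<mu>)" .
qed

lemma entrance_marked_measure:
  "marked_measure X K A 1 A A (return X) (entr_kernel X K A) \<mu> (entr_measure X K A \<mu>)"
  by (intro marked_measure.intro marked_measure_axioms.intro entrance_marked_crossings A
      recurrent_chain_axioms sets_entr_measure nn_integral_entr_measure)

end

end

section \<open>Properness and the occupation formula\<close>

lemma crossing_infinitely_often_shift:
  "(\<exists>\<^sub>\<infinity>n. crossing A ((path_shift ^^ n) (path_shift \<omega>))) \<longleftrightarrow> (\<exists>\<^sub>\<infinity>n. crossing A ((path_shift ^^ n) \<omega>))"
  using eventually_sequentially_Suc[of "\<lambda>n. \<not> crossing A ((path_shift ^^ n) \<omega>)"]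
  by (simp add: frequently_def cofinite_eq_sequentially funpow_swap1)

lemma measurable_crossing_infinitely_often [measurable]:
  assumes [measurable]: "A \<in> sets X"
  shows "Measurable.pred (path_space X) (\<lambda>\<omega>. \<exists>\<^sub>\<infinity>n. crossing A ((path_shift ^^ n) \<omega>))"
  unfolding INFM_nat by measurable

lemma crossing_infinitely_often_alternating:
  assumes \<omega>: "\<omega> \<in> space (path_space X)" and io: "\<exists>\<^sub>\<infinity>n. crossing A ((path_shift ^^ n) \<omega>)"
  shows "(\<exists>\<^sub>\<infinity>k. \<omega> k \<in> A) \<and> (\<exists>\<^sub>\<infinity>k. \<omega> k \<in> space X - A)"
proof
  show "\<exists>\<^sub>\<infinity>k. \<omega> k \<in> space X - A"
    using io by (rule INFM_mono) (use \<omega> in \<open>auto simp: crossing_def path_shift_funpow space_PiM PiE_iff\<close>)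
  have "\<exists>\<^sub>\<infinity>k. \<omega> (Suc k) \<in> A"
    using io by (rule INFM_mono) (auto simp: crossing_def path_shift_funpow)
  then show "\<exists>\<^sub>\<infinity>k. \<omega> k \<in> A"
    using eventually_sequentially_Suc[of "\<lambda>k. \<omega> k \<notin> A"]
    by (simp add: frequently_def cofinite_eq_sequentially)
qed

context recurrent_chain
begin

context
  fixes A assumes A [measurable]: "A \<in> sets X"
begin

abbreviation "IO \<equiv> {\<omega> \<in> space \<Omega>. \<exists>\<^sub>\<infinity>n. crossing A ((path_shift ^^ n) \<omega>)}"

lemma alternating_setI:
  assumes x: "x \<in> space X" and 1: "measure (P x) IO = 1"
  shows "x \<in> alternating_set X K A"
proof -
  interpret prob_space "P x" by (rule prob_space_chain_law[OF x])
  let ?alt = "{\<omega> \<in> space \<Omega>. (\<exists>\<^sub>\<infinity>k. \<omega> k \<in> A) \<and> (\<exists>\<^sub>\<infinity>k. \<omega> k \<in> space X - A)}"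
  have alt: "?alt \<in> sets (P x)" unfolding INFM_nat sets_chain_law[OF x] by measurable
  have sub: "IO \<subseteq> ?alt" using crossing_infinitely_often_alternating[of _ X A] by auto
  have "1 = emeasure (P x) IO" using 1 by (simp add: emeasure_eq_measure)
  also have "\<dots> \<le> emeasure (P x) ?alt" by (rule emeasure_mono[OF sub alt])
  finally have "emeasure (P x) ?alt = 1"
    using emeasure_le_1[of ?alt] by (rule antisym[rotated])
  then show ?thesis using x by (simp add: alternating_set_def)
qed

text \<open>Almost every crossing is followed by infinitely many. Integrating out the first
  transition turns this statement about paths into one about the state just after the
  entrance.\<close>

lemma AE_after_crossing_IO:
  "AE x in \<mu>. AE y in K x. x \<notin> A \<and> y \<in> A \<longrightarrow> measure (P y) IO = 1"
proof -
  have [measurable]: "IO \<in> sets \<Omega>" by measurable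
  have "AE \<omega> in P\<mu>. crossing A \<omega> \<longrightarrow> path_shift \<omega> \<in> IO"
    using AE_crossing_infinitely_often[OF A] AE_space
    by eventually_elim (auto simp: crossing_infinitely_often_shift space_P\<mu> intro: measurable_space[OF measurable_path_shift])
  then have "AE x in \<mu>. AE \<omega> in P x. crossing A \<omega> \<longrightarrow> path_shift \<omega> \<in> IO"
    by (subst (asm) AE_P\<mu>) measurable
  then show ?thesis
    using AE_space
  proof eventually_elim
    fix x assume io: "AE \<omega> in P x. crossing A \<omega> \<longrightarrow> path_shift \<omega> \<in> IO" and "x \<in> space \<mu>"
    then have x: "x \<in> space X" by (simp add: space_\<mu>)
    let ?f = "\<lambda>y. \<integral>\<^sup>+\<omega>. (if \<omega> \<in> IO then 0 else 1) \<partial>P y"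
    have "(\<integral>\<^sup>+y. (if x \<notin> A \<and> y \<in> A then ?f y else 0) \<partial>K x) =
        (\<integral>\<^sup>+\<omega>. (if crossing A \<omega> then if path_shift \<omega> \<in> IO then 0 else 1 else 0) \<partial>P x)"
      by (rule nn_integral_crossing[OF x A, of "\<lambda>_ \<omega>. if \<omega> \<in> IO then 0 else 1", symmetric]) measurable
    also have "\<dots> = (\<integral>\<^sup>+\<omega>. 0 \<partial>P x)"
      by (rule nn_integral_cong_AE) (use io in eventually_elim, simp)
    also have "\<dots> = 0" by simp
    finally have "AE y in K x. (if x \<notin> A \<and> y \<in> A then ?f y else 0) = 0"
      by (subst (asm) nn_integral_0_iff_AE) (auto simp: x)
    then show "AE y in K x. x \<notin> A \<and> y \<in> A \<longrightarrow> measure (P y) IO = 1"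
      using AE_space
    proof (eventually_elim, intro impI)
      fix y assume 0: "(if x \<notin> A \<and> y \<in> A then ?f y else 0) = 0" and "y \<in> space (K x)" "x \<notin> A \<and> y \<in> A"
      then have y: "y \<in> space X" and f0: "?f y = 0" by (auto simp: space_kernel[OF x])
      interpret prob_space "P y" by (rule prob_space_chain_law[OF y])
      have "AE \<omega> in P y. (if \<omega> \<in> IO then 0 else 1 :: ennreal) = 0"
        using f0 by (subst (asm) nn_integral_0_iff_AE) (auto simp: y)
      then have "AE \<omega> in P y. \<omega> \<in> IO" by eventually_elim (simp split: if_splits)
      then show "measure (P y) IO = 1"
        by (subst (asm) AE_in_set_eq_1) (auto simp: sets_chain_law[OF y])
    qed
  qed
qed

text \<open>From an exit state the next step is a crossing only with positive probability, so
  returns after crossings control just part of the paths. Harmonicity supplies the rest: the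
  probability of \<open>IO\<close> is the same at \<open>x\<close> and after almost every step, and
  some of these steps enter \<open>A\<close>, where it is 1.\<close>

lemma AE_exit_set_IO: "AE x in \<mu>. x \<in> exit_set X K A \<longrightarrow> measure (P x) IO = 1"
proof -
  have "AE x in \<mu>. AE y in K x. measure (P y) IO = measure (P x) IO"
  proof (rule AE_invariant_event_constant)
    show "AE \<omega> in P\<mu>. path_shift \<omega> \<in> IO \<longleftrightarrow> \<omega> \<in> IO"
      using AE_space
      by eventually_elim (auto simp: crossing_infinitely_often_shift space_P\<mu> intro: measurable_space[OF measurable_path_shift])
  qed measurable
  with AE_after_crossing_IO AE_space show ?thesis
  proof (eventually_elim, intro impI)
    fix x assume 1: "AE y in K x. x \<notin> A \<and> y \<in> A \<longrightarrow> measure (P y) IO = 1"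
      and const: "AE y in K x. measure (P y) IO = measure (P x) IO"
      and "x \<in> space \<mu>" and ex: "x \<in> exit_set X K A"
    then have x: "x \<in> space X" by (simp add: space_\<mu>)
    show "measure (P x) IO = 1"
    proof (rule ccontr)
      assume ne: "measure (P x) IO \<noteq> 1"
      from 1 const have "AE y in K x. y \<notin> A"
        by eventually_elim (use ne ex in \<open>auto simp: exit_set_def\<close>)
      then have "A \<in> null_sets (K x)"
        by (rule AE_iff_null_sets[THEN iffD2, rotated]) (simp add: sets_kernel' x)
      then show False using ex by (auto simp: exit_set_def null_sets_def)
    qed
  qed
qed

lemma proper_exit_measure: "proper_exit X K A (exit_measure X K A \<mu>)"
proof -
  let ?IO = "{\<omega> \<in> space \<Omega>. \<exists>\<^sub>\<infinity>n. crossing A ((path_shift ^^ n) \<omega>)}"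
  \<comment> \<open>A measurable set containing all exceptional states. It admits every state
    outside the exit set, where the density of the exit measure is 0 anyway.\<close>
  let ?N = "{y \<in> space X. y \<notin> A \<and> (y \<in> exit_set X K A \<longrightarrow> measure (P y) ?IO \<noteq> 1)}"
  have IO: "?IO \<in> sets \<Omega>" by measurable
  note [measurable] = measurable_measure_chain_law[OF IO]
  have N[measurable]: "?N \<in> sets X" by measurable
  have N': "?N \<in> sets (exit_measure X K A \<mu>)"
    unfolding sets_exit_measure[OF A] using N by (subst sets_restrict_space_iff) auto
  have "emeasure (exit_measure X K A \<mu>) ?N = (\<integral>\<^sup>+y. indicator ?N y \<partial>exit_measure X K A \<mu>)"
    using N' by simp
  also have "\<dots> = (\<integral>\<^sup>+x. emeasure (K x) A * indicator ?N x * indicator (space X - A) x \<partial>\<mu>)"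
    by (rule nn_integral_exit_measure_kernel[OF A]) measurable
  also have "\<dots> = (\<integral>\<^sup>+x. 0 \<partial>\<mu>)"
    by (rule nn_integral_cong_AE)
      (use AE_exit_set_IO in eventually_elim, auto simp: indicator_def exit_set_def)
  finally have 0: "emeasure (exit_measure X K A \<mu>) ?N = 0" by simp
  have "(space X - A) - (exit_set X K A \<inter> alternating_set X K A) \<subseteq> ?N"
    using alternating_setI by auto
  from emeasure_mono[OF this N'] 0 show ?thesis by (simp add: proper_exit_def)
qed

end

text \<open>Moves a hitting statement from the law with restricted initial measure to the path
  system of \<mu>, where it can be shifted in time.\<close>

lemma AE_hits_from:
  assumes D[measurable]: "D \<in> sets X" "B \<in> sets X" and ne: "D \<noteq> {}"
    and 0: "emeasure (chain_law_init X K (restrict_space \<mu> D)) {\<omega> \<in> space \<Omega>. hit_time B \<omega> = \<infinity>} = 0"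
  shows "AE \<omega> in P\<mu>. \<omega> 0 \<in> D \<longrightarrow> (\<exists>n\<ge>1. \<omega> n \<in> B)"
proof -
  let ?\<mu> = "restrict_space \<mu> D"
  have D_sub: "D \<subseteq> space X" by (rule sets.sets_into_space[OF D(1)])
  have inc: "(\<lambda>x. x) \<in> ?\<mu> \<rightarrow>\<^sub>M X"
    by (rule measurable_restrict_space1[OF inclusion_\<mu>])
  have sets: "sets (chain_law_init X K ?\<mu>) = sets \<Omega>"
    by (rule sets_chain_law_init[OF inc]) (use ne D_sub in \<open>auto simp: space_restrict_space space_\<mu>\<close>)
  have eq: "{\<omega> \<in> space \<Omega>. hit_time B \<omega> = \<infinity>} = {\<omega> \<in> space \<Omega>. \<forall>n\<ge>1. \<omega> n \<notin> B}"
    by (simp add: hit_time_eq_infinity_iff)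
  have "{\<omega> \<in> space \<Omega>. \<forall>n\<ge>1. \<omega> n \<notin> B} \<in> null_sets (chain_law_init X K ?\<mu>)"
    using 0 unfolding eq by (simp add: null_sets_def sets)
  from AE_not_in[OF this] AE_space have "AE \<omega> in chain_law_init X K ?\<mu>. \<exists>n\<ge>1. \<omega> n \<in> B"
    by eventually_elim (auto simp: sets_eq_imp_space_eq[OF sets])
  then have "AE x in ?\<mu>. AE \<omega> in P x. \<exists>n\<ge>1. \<omega> n \<in> B"
    by (subst (asm) AE_chain_law_init[OF inc]) measurable
  then have "AE x in \<mu>. x \<in> D \<longrightarrow> (AE \<omega> in P x. \<exists>n\<ge>1. \<omega> n \<in> B)"
    by (subst (asm) AE_restrict_space_iff) (use D_sub in \<open>auto simp: sets_\<mu> space_\<mu>\<close>)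
  then have "AE x in \<mu>. AE \<omega> in P x. \<omega> 0 \<in> D \<longrightarrow> (\<exists>n\<ge>1. \<omega> n \<in> B)"
    using AE_space
  proof eventually_elim
    fix x assume *: "x \<in> D \<longrightarrow> (AE \<omega> in P x. \<exists>n\<ge>1. \<omega> n \<in> B)" and "x \<in> space \<mu>"
    then have x: "x \<in> space X" by (simp add: space_\<mu>)
    show "AE \<omega> in P x. \<omega> 0 \<in> D \<longrightarrow> (\<exists>n\<ge>1. \<omega> n \<in> B)"
    proof (cases "x \<in> D")
      case False
      have "AE \<omega> in P x. \<omega> 0 \<notin> D"
        by (rule AE_chain_law_start[OF x]) (use False in auto)
      then show ?thesis by eventually_elim simp
    qed (use * in auto)
  qed
  then show ?thesis by (subst AE_P\<mu>) measurable
qed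

context
  fixes A assumes A [measurable]: "A \<in> sets X" and cross: "emeasure P\<mu> {\<omega> \<in> space \<Omega>. crossing A \<omega>} > 0"
begin

text \<open>Entrance states are reached by a crossing, so the returns known after a crossing suffice
  here, without harmonicity.\<close>

lemma proper_entr_measure: "proper_entr X K A (entr_measure X K A \<mu>)"
proof -
  let ?IO = "{\<omega> \<in> space \<Omega>. \<exists>\<^sub>\<infinity>n. crossing A ((path_shift ^^ n) \<omega>)}"
  let ?N = "{y \<in> space X. y \<in> A \<and> measure (P y) ?IO \<noteq> 1}"
  have IO: "?IO \<in> sets \<Omega>" by measurable
  note [measurable] = measurable_measure_chain_law[OF IO]
  have N[measurable]: "?N \<in> sets X" by measurable
  have N': "?N \<in> sets (entr_measure X K A \<mu>)"
    unfolding sets_entr_measure[OF A cross] using N by (subst sets_restrict_space_iff) auto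
  have "emeasure (entr_measure X K A \<mu>) ?N = (\<integral>\<^sup>+y. indicator ?N y \<partial>entr_measure X K A \<mu>)"
    using N' by simp
  also have "\<dots> = (\<integral>\<^sup>+\<omega>. (if crossing A \<omega> then indicator ?N (\<omega> 1) else 0) \<partial>P\<mu>)"
    by (rule nn_integral_entr_measure[OF A cross]) measurable
  also have "\<dots> = (\<integral>\<^sup>+x. \<integral>\<^sup>+\<omega>. (if crossing A \<omega> then indicator ?N (\<omega> 1) else 0) \<partial>P x \<partial>\<mu>)"
    by (rule nn_integral_P\<mu>) measurable
  also have "\<dots> = (\<integral>\<^sup>+x. 0 \<partial>\<mu>)"
  proof (rule nn_integral_cong_AE)
    show "AE x in \<mu>. (\<integral>\<^sup>+\<omega>. (if crossing A \<omega> then indicator ?N (\<omega> 1) else 0) \<partial>P x) = (0::ennreal)"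
      using AE_after_crossing_IO[OF A] AE_space
    proof eventually_elim
      fix x assume 1: "AE y in K x. x \<notin> A \<and> y \<in> A \<longrightarrow> measure (P y) ?IO = 1" and "x \<in> space \<mu>"
      then have x: "x \<in> space X" by (simp add: space_\<mu>)
      have "(\<integral>\<^sup>+\<omega>. (if crossing A \<omega> then indicator ?N (\<omega> 1) else 0) \<partial>P x) =
          (\<integral>\<^sup>+y. (if x \<notin> A \<and> y \<in> A then \<integral>\<^sup>+\<omega>. indicator ?N y \<partial>P y else 0) \<partial>K x)"
        by (rule nn_integral_crossing[OF x A, of "\<lambda>y _. indicator ?N y"]) measurable
      also have "\<dots> = (\<integral>\<^sup>+y. 0 \<partial>K x)"
        by (rule nn_integral_cong_AE) (use 1 in eventually_elim, auto)
      finally show "(\<integral>\<^sup>+\<omega>. (if crossing A \<omega> then indicator ?N (\<omega> 1) else 0) \<partial>P x) = (0::ennreal)" by simp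
    qed
  qed
  finally have 0: "emeasure (entr_measure X K A \<mu>) ?N = 0" by simp
  have "A - alternating_set X K A \<subseteq> ?N"
    using alternating_setI[OF A] sets.sets_into_space[OF A] by auto
  from emeasure_mono[OF this N'] 0 show ?thesis by (simp add: proper_entr_def)
qed

text \<open>The visits to \<open>B\<close> at the \<open>k\<close>-th step after an entrance are the
  excursions of index \<open>k\<close> into the paths that start in \<open>B\<close>. Summing over
  \<open>k\<close> gives Kac's series, and almost sure crossing is its hitting hypothesis.\<close>

lemma occupation_before_entr_eq:
  assumes hits: "AE \<omega> in P\<mu>. crosses A \<omega>" and B[measurable]: "B \<in> sets X"
  shows "emeasure \<mu> B = occupation_before_entr X K A (entr_measure X K A \<mu>) B"
proof -
  let ?\<nu> = "entr_measure X K A \<mu>"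
  let ?C = "{\<omega> \<in> space \<Omega>. crossing A \<omega>}" and ?B = "{\<omega> \<in> space \<Omega>. \<omega> 0 \<in> B}"
  \<comment> \<open>Here \<open>k\<close> counts steps from the entrance, hence one fewer than from
    the crossing; this is the offset in \<open>excursion\<close>, which tests avoidance only after
    its first step.\<close>
  define g where "g k \<omega> = (if \<forall>j<k. \<not> crossing A ((path_shift ^^ j) \<omega>) then indicator B (\<omega> k) else 0 :: ennreal)"
    for k and \<omega> :: "nat \<Rightarrow> 'a"
  have [measurable]: "g k \<in> borel_measurable \<Omega>" for k unfolding g_def by measurable
  let ?G = "\<lambda>\<omega>. \<Sum>k. g k \<omega>"
  have inc: "(\<lambda>x. x) \<in> ?\<nu> \<rightarrow>\<^sub>M X"
    unfolding measurable_cong_sets[OF sets_entr_measure[OF A cross] refl] by (rule measurable_restrict_space1) simp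
  have C: "?C \<in> sets P\<mu>" and B': "?B \<in> sets P\<mu>" unfolding sets_P\<mu> by measurable
  have "occupation_before_entr X K A ?\<nu> B = (\<integral>\<^sup>+\<omega>. ?G \<omega> \<partial>chain_law_init X K ?\<nu>)"
    unfolding occupation_before_entr_def less_entr_time_1_iff g_def ..
  also have "\<dots> = (\<integral>\<^sup>+x. \<integral>\<^sup>+\<omega>. ?G \<omega> \<partial>P x \<partial>?\<nu>)"
    by (rule nn_integral_chain_law_init[OF inc]) measurable
  also have "\<dots> = (\<integral>\<^sup>+\<omega>. (if crossing A \<omega> then \<integral>\<^sup>+\<omega>'. ?G \<omega>' \<partial>P (\<omega> 1) else 0) \<partial>P\<mu>)"
    by (rule nn_integral_entr_measure[OF A cross]) measurable
  also have "\<dots> = (\<integral>\<^sup>+x. \<integral>\<^sup>+\<omega>. (if crossing A \<omega> then \<integral>\<^sup>+\<omega>'. ?G \<omega>' \<partial>P (\<omega> 1) else 0) \<partial>P x \<partial>\<mu>)"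
    by (rule nn_integral_P\<mu>) (intro measurable_If measurable_path_integral_at, measurable)
  \<comment> \<open>The fresh path started at the entrance state is replaced by the actual
    continuation, so that everything refers to one path under \<mu>.\<close>
  also have "\<dots> = (\<integral>\<^sup>+x. \<integral>\<^sup>+\<omega>. (if crossing A \<omega> then ?G (path_shift \<omega>) else 0) \<partial>P x \<partial>\<mu>)"
  proof (rule nn_integral_cong)
    fix x assume "x \<in> space \<mu>"
    then have x: "x \<in> space X" by (simp add: space_\<mu>)
    have m: "(\<lambda>(y, \<omega>). \<integral>\<^sup>+\<omega>'. ?G \<omega>' \<partial>P y) \<in> borel_measurable (X \<Otimes>\<^sub>M \<Omega>)"
      unfolding split_beta by (rule measurable_compose[OF measurable_fst measurable_path_integral_const]) measurable
    have "(\<integral>\<^sup>+\<omega>. (if crossing A \<omega> then \<integral>\<^sup>+\<omega>'. ?G \<omega>' \<partial>P (\<omega> 1) else 0) \<partial>P x) =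
        (\<integral>\<^sup>+y. (if x \<notin> A \<and> y \<in> A then \<integral>\<^sup>+\<omega>. (\<integral>\<^sup>+\<omega>'. ?G \<omega>' \<partial>P y) \<partial>P y else 0) \<partial>K x)"
      by (rule nn_integral_crossing[OF x A m])
    also have "\<dots> = (\<integral>\<^sup>+y. (if x \<notin> A \<and> y \<in> A then \<integral>\<^sup>+\<omega>. ?G \<omega> \<partial>P y else 0) \<partial>K x)"
      by (rule nn_integral_cong_kernel[OF x]) (simp add: space_chain_law emeasure_chain_law_space)
    also have "\<dots> = (\<integral>\<^sup>+\<omega>. (if crossing A \<omega> then ?G (path_shift \<omega>) else 0) \<partial>P x)"
      by (rule nn_integral_crossing[OF x A, of "\<lambda>_. ?G", symmetric]) measurable
    finally show "(\<integral>\<^sup>+\<omega>. (if crossing A \<omega> then \<integral>\<^sup>+\<omega>'. ?G \<omega>' \<partial>P (\<omega> 1) else 0) \<partial>P x) =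
        (\<integral>\<^sup>+\<omega>. (if crossing A \<omega> then ?G (path_shift \<omega>) else 0) \<partial>P x)" .
  qed
  also have "\<dots> = (\<integral>\<^sup>+\<omega>. (if crossing A \<omega> then ?G (path_shift \<omega>) else 0) \<partial>P\<mu>)"
    by (rule nn_integral_P\<mu>[symmetric]) measurable
  also have "\<dots> = (\<integral>\<^sup>+\<omega>. (\<Sum>k. if crossing A \<omega> then g k (path_shift \<omega>) else 0) \<partial>P\<mu>)"
    by (intro nn_integral_cong) auto
  also have "\<dots> = (\<Sum>k. \<integral>\<^sup>+\<omega>. (if crossing A \<omega> then g k (path_shift \<omega>) else 0) \<partial>P\<mu>)"
    by (rule nn_integral_suminf) measurable
  also have "\<dots> = (\<Sum>k. path.excursion ?C k ?B)"
  proof (rule suminf_cong)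
    fix k
    let ?R = "{\<omega> \<in> space P\<mu>. \<omega> \<in> ?C \<and> (\<forall>j<k. (path_shift ^^ j) (path_shift \<omega>) \<notin> ?C) \<and>
      (path_shift ^^ k) (path_shift \<omega>) \<in> ?B}"
    have "?R \<in> sets P\<mu>" unfolding sets_P\<mu> space_P\<mu> by measurable
    then have "path.excursion ?C k ?B = (\<integral>\<^sup>+\<omega>. indicator ?R \<omega> \<partial>P\<mu>)"
      unfolding path.excursion_def by (rule nn_integral_indicator[symmetric])
    also have "\<dots> = (\<integral>\<^sup>+\<omega>. (if crossing A \<omega> then g k (path_shift \<omega>) else 0) \<partial>P\<mu>)"
    proof (intro nn_integral_cong)
      fix \<omega> assume "\<omega> \<in> space P\<mu>"
      then have \<omega>: "\<omega> \<in> space \<Omega>" by (simp add: space_P\<mu>)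
      have "(path_shift ^^ n) (path_shift \<omega>) \<in> space \<Omega>" for n
        using shift_path[OF \<omega>, of "Suc n"] by (simp add: funpow_swap1)
      moreover have "(path_shift ^^ k) (path_shift \<omega>) 0 = path_shift \<omega> k"
        by (simp add: path_shift_funpow)
      ultimately show "indicator ?R \<omega> = (if crossing A \<omega> then g k (path_shift \<omega>) else 0)"
        using \<omega> by (auto simp: g_def indicator_def space_P\<mu>)
    qed
    finally show "(\<integral>\<^sup>+\<omega>. (if crossing A \<omega> then g k (path_shift \<omega>) else 0) \<partial>P\<mu>) = path.excursion ?C k ?B" ..
  qed
  also have "\<dots> = emeasure P\<mu> ?B"
  proof (rule path.kac[symmetric, OF C B'])
    show "AE \<omega> in P\<mu>. \<omega> \<in> ?B \<longrightarrow> (\<exists>n. (path_shift ^^ n) \<omega> \<in> ?C)"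
      using hits AE_space
      by eventually_elim (auto simp: crosses_def space_P\<mu> shift_path)
  qed
  also have "\<dots> = (\<integral>\<^sup>+\<omega>. indicator ?B \<omega> \<partial>P\<mu>)"
    by (rule nn_integral_indicator[symmetric, OF B'])
  also have "\<dots> = (\<integral>\<^sup>+\<omega>. indicator B (\<omega> 0) \<partial>P\<mu>)"
    by (intro nn_integral_cong) (auto simp: space_P\<mu> indicator_def)
  also have "\<dots> = emeasure \<mu> B"
    by (subst nn_integral_P\<mu>_0) (auto simp: sets_\<mu>)
  finally show ?thesis ..
qed

text \<open>Infinitely many crossings form a shift-invariant event, hence null or of null
  complement. It contains almost every path that crosses at time 0, and these have positive
  measure.\<close>

lemma irreducible_AE_crosses:
  assumes irr: "irreducible_measure X K \<mu>"
  shows "AE \<omega> in P\<mu>. crosses A \<omega>"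
proof -
  let ?IO = "{\<omega> \<in> space \<Omega>. \<exists>\<^sub>\<infinity>n. crossing A ((path_shift ^^ n) \<omega>)}"
  have "(AE \<omega> in P\<mu>. \<omega> \<in> ?IO) \<or> (AE \<omega> in P\<mu>. \<omega> \<notin> ?IO)"
  proof (rule irreducible_shift_ergodic[OF irr])
    show "AE \<omega> in P\<mu>. path_shift \<omega> \<in> ?IO \<longleftrightarrow> \<omega> \<in> ?IO"
      using AE_space
      by eventually_elim (auto simp: crossing_infinitely_often_shift space_P\<mu> intro: measurable_space[OF measurable_path_shift])
  qed measurable
  then show ?thesis
  proof
    assume "AE \<omega> in P\<mu>. \<omega> \<in> ?IO"
    then show ?thesis by eventually_elim (auto simp: crosses_def INFM_nat)
  next
    assume "AE \<omega> in P\<mu>. \<omega> \<notin> ?IO"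
    with AE_crossing_infinitely_often[OF A] have "AE \<omega> in P\<mu>. \<omega> \<notin> {\<omega> \<in> space \<Omega>. crossing A \<omega>}"
      by eventually_elim blast
    then have "{\<omega> \<in> space \<Omega>. crossing A \<omega>} \<in> null_sets P\<mu>"
      by (rule AE_iff_null_sets[THEN iffD2, rotated]) (simp add: sets_P\<mu>)
    then show ?thesis using cross by (simp add: null_sets_def)
  qed
qed

text \<open>A path starts outside \<open>A\<close> or gets there by the first condition, at a time
  that depends on the path. The second condition is therefore needed at all times simultaneously;
  between leaving and re-entering \<open>A\<close> lies a crossing.\<close>

lemma AE_crosses_if_hits:
  assumes out: "emeasure (chain_law_init X K (restrict_space \<mu> A))
      {\<omega> \<in> space \<Omega>. hit_time (space X - A) \<omega> = \<infinity>} = 0"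
    and into: "emeasure (chain_law_init X K (restrict_space \<mu> (space X - A)))
      {\<omega> \<in> space \<Omega>. hit_time A \<omega> = \<infinity>} = 0"
  shows "AE \<omega> in P\<mu>. crosses A \<omega>"
proof -
  note ne = A_nonempty[OF A cross]
  have out': "AE \<omega> in P\<mu>. \<omega> 0 \<in> A \<longrightarrow> (\<exists>n\<ge>1. \<omega> n \<in> space X - A)"
    by (rule AE_hits_from[OF _ _ ne(1) out]) auto
  have "AE \<omega> in P\<mu>. \<omega> 0 \<in> space X - A \<longrightarrow> (\<exists>n\<ge>1. \<omega> n \<in> A)"
    by (rule AE_hits_from[OF _ _ ne(2) into]) auto
  then have "AE \<omega> in P\<mu>. (path_shift ^^ k) \<omega> 0 \<in> space X - A \<longrightarrow> (\<exists>n\<ge>1. (path_shift ^^ k) \<omega> n \<in> A)" for k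
    by (rule AE_P\<mu>_shift_funpow)
  then have "AE \<omega> in P\<mu>. \<forall>k. (path_shift ^^ k) \<omega> 0 \<in> space X - A \<longrightarrow> (\<exists>n\<ge>1. (path_shift ^^ k) \<omega> n \<in> A)"
    by (subst AE_all_countable) auto
  with out' AE_space show ?thesis
  proof eventually_elim
    fix \<omega> assume out: "\<omega> 0 \<in> A \<longrightarrow> (\<exists>n\<ge>1. \<omega> n \<in> space X - A)"
      and into: "\<forall>k. (path_shift ^^ k) \<omega> 0 \<in> space X - A \<longrightarrow> (\<exists>n\<ge>1. (path_shift ^^ k) \<omega> n \<in> A)"
      and "\<omega> \<in> space P\<mu>"
    then have "\<omega> \<in> space \<Omega>" by (simp add: space_P\<mu>)
    then have "\<omega> 0 \<in> space X" by (rule path_component)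
    with out obtain k where k: "\<omega> k \<in> space X - A" by blast
    with into[rule_format, of k] obtain n where "n \<ge> 1" "\<omega> (k + n) \<in> A" by (auto simp: path_shift_funpow)
    with k show "crosses A \<omega>"
      unfolding crosses_def by (intro crossing_between[of \<omega> k A "k + n"]) auto
  qed
qed

end

end

theorem theorem3p1:
  fixes X :: "'a measure" and K :: "'a \<Rightarrow> 'a measure" and \<mu> :: "'a measure" and A :: "'a set"
  assumes kernel: "K \<in> X \<rightarrow>\<^sub>M prob_algebra X"
    and sigma_finite: "sigma_finite_measure \<mu>"
    and invariant: "invariant_measure X K \<mu>"
    and recurrent: "recurrent_measure X K \<mu>"
    and A: "A \<in> sets X"
    and crossing: "emeasure (chain_law_init X K \<mu>)
      {\<omega> \<in> space (path_space X). \<omega> 0 \<in> space X - A \<and> \<omega> 1 \<in> A} > 0"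
  shows
    "(proper_entr X K A (entr_measure X K A \<mu>) \<and>
      recurrent_measure (entr_space X A) (entr_kernel X K A) (with_cemetery (entr_measure X K A \<mu>)) \<and>
      invariant_measure (entr_space X A) (entr_kernel X K A) (with_cemetery (entr_measure X K A \<mu>))) \<and>
     (proper_exit X K A (exit_measure X K A \<mu>) \<and>
      recurrent_measure (exit_space X A) (exit_kernel X K A) (with_cemetery (exit_measure X K A \<mu>)) \<and>
      invariant_measure (exit_space X A) (exit_kernel X K A) (with_cemetery (exit_measure X K A \<mu>))) \<and>
     (irreducible_measure X K \<mu> \<longrightarrow>
      ergodic_measure (entr_space X A) (entr_kernel X K A) (with_cemetery (entr_measure X K A \<mu>)) \<and>
      ergodic_measure (exit_space X A) (exit_kernel X K A) (with_cemetery (exit_measure X K A \<mu>)) \<and>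
      (\<forall>B\<in>sets X. emeasure \<mu> B = occupation_before_entr X K A (entr_measure X K A \<mu>) B)) \<and>
     (emeasure (chain_law_init X K (restrict_space \<mu> A))
        {\<omega> \<in> space (path_space X). hit_time (space X - A) \<omega> = \<infinity>} = 0 \<and>
      emeasure (chain_law_init X K (restrict_space \<mu> (space X - A)))
        {\<omega> \<in> space (path_space X). hit_time A \<omega> = \<infinity>} = 0 \<longrightarrow>
      (\<forall>B\<in>sets X. emeasure \<mu> B = occupation_before_entr X K A (entr_measure X K A \<mu>) B))"
proof -
  \<comment> \<open>A nonnull crossing event forces \<open>X\<close> to be nonempty, which
    \<open>recurrent_chain\<close> requires.\<close>
  have "{\<omega> \<in> space (path_space X). \<omega> 0 \<in> space X - A \<and> \<omega> 1 \<in> A} \<noteq> {}"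
    using crossing by (metis emeasure_empty less_irrefl)
  then have "space X \<noteq> {}" by auto
  then interpret recurrent_chain X K \<mu>
    by (intro recurrent_chain.intro recurrent_chain_axioms.intro markov_kernel.intro
        kernel sigma_finite invariant recurrent)
  have "{\<omega> \<in> space \<Omega>. \<omega> 0 \<in> space X - A \<and> \<omega> 1 \<in> A} = {\<omega> \<in> space \<Omega>. crossing A \<omega>}"
    by (auto simp: crossing_def path_component)
  with crossing have cross: "emeasure P\<mu> {\<omega> \<in> space \<Omega>. crossing A \<omega>} > 0" by simp
  interpret entr: marked_measure X K A 1 A A "return X" "entr_kernel X K A" \<mu> "entr_measure X K A \<mu>"
    by (rule entrance_marked_measure[OF A cross])
  interpret exit: marked_measure X K A 0 "space X - A" "exit_set X K A"
    "\<lambda>y. if y \<in> exit_set X K A then uniform_measure (K y) A else K y"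
    "exit_kernel X K A" \<mu> "exit_measure X K A \<mu>"
    by (rule exit_marked_measure[OF A])
  have irr: "\<forall>B\<in>sets X. emeasure \<mu> B = occupation_before_entr X K A (entr_measure X K A \<mu>) B"
    if "irreducible_measure X K \<mu>"
    using occupation_before_entr_eq[OF A cross irreducible_AE_crosses[OF A cross that]] by simp
  have hits: "\<forall>B\<in>sets X. emeasure \<mu> B = occupation_before_entr X K A (entr_measure X K A \<mu>) B"
    if "emeasure (chain_law_init X K (restrict_space \<mu> A))
        {\<omega> \<in> space (path_space X). hit_time (space X - A) \<omega> = \<infinity>} = 0 \<and>
      emeasure (chain_law_init X K (restrict_space \<mu> (space X - A)))
        {\<omega> \<in> space (path_space X). hit_time A \<omega> = \<infinity>} = 0"
    using occupation_before_entr_eq[OF A cross AE_crosses_if_hits[OF A cross]] that by simp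
  show ?thesis
    unfolding entr_space_def exit_space_def
    by (intro conjI impI proper_entr_measure[OF A cross] proper_exit_measure[OF A]
        entr.recurrent_marks entr.invariant_marks entr.ergodic_marks
        exit.recurrent_marks exit.invariant_marks exit.ergodic_marks)
      (assumption | (rule irr, assumption) | (rule hits, assumption))+
qed

end
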